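(* Let $T=(T(t))_{t>0}$ be a strongly continuous semigroup of multipliers on a weakly cancellative commutative Banach algebra $\mathcal A$ with dense principal ideals such that $\bigcup_{t>0}T(t)\mathcal A$ is dense in $\mathcal A$. Let $\mathcal L_T=\{u\in\mathcal A:\limsup_{t\to0^+}\|T(t)u\|<+\infty\}\supset\bigcup_{t>0}T(t)\mathcal A$, choose $\lambda>\log\rho_T$, set $\|u\|_\lambda=\sup_{s\ge0}e^{-\lambda s}\|T(s)u\|$ for $u\in\mathcal L_T$ (with $T(0)=I$), and set $\|R\|_{\lambda,op}=\sup\{\|Ru\|_\lambda:u\in\mathcal L_T,\|u\|_\lambda\le1\}=\|R\|_{\mathcal M(\mathcal L_T)}$ for $R\in\mathcal M(\mathcal L_T)$. Denote by $\mathcal A_T$ the closure of $\mathcal A$ in $(\mathcal M(\mathcal L_T),\|\cdot\|_{\lambda,op})$. Then $(\mathcal L_T,\|\cdot\|_\lambda)$ is a Banach algebra, the norm topology on $\mathcal L_T$ does not depend on the choice of $\lambda$, and: (i) The inclusion map $j:\mathcal A\to\mathcal A_T$ is a $\mathcal{QM}$-homomorphism with respect to $w$ for every $w\in\Omega(\mathcal A)\cap\mathcal L_T$; the tautological map $\tilde j:S_{u/v}\mapsto S_{u/v}$ is a pseudobounded isomorphism from $\mathcal{QM}(\mathcal A)$ onto $\mathcal{QM}(\mathcal A_T)$; and if $w\in\Omega(\mathcal A)\cap\mathcal L_T$ then $\tilde j^{-1}(S)=S_{uw/vw}$ for $S=S_{u/v}\in\mathcal{QM}(\mathcal A_T)$.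 (ii) $\tilde j(\mathcal M(\mathcal A))\subset\mathcal M(\mathcal A_T)$, and $\|\tilde j(R)\|_{\mathcal M(\mathcal A_T)}\le\|R\|_{\mathcal M(\mathcal A)}$ for $R\in\mathcal M(\mathcal A)$. (iii) $\|T(t)\|_{\mathcal M(\mathcal A_T)}\le\|T(t)\|_{\lambda,op}\le e^{\lambda t}$ for $t>0$, and $\limsup_{t\to0^+}\|T(t)u-u\|_{\lambda,op}=0$ for every $u\in\mathcal A_T$.
   Context: Banach algebras are complex with submultiplicative norm. A commutative Banach algebra $\mathcal A\neq\{0\}$ is weakly cancellative if $u\mathcal A\ne\{0\}$ for all $u\in\mathcal A\setminus\{0\}$; $\Omega(\mathcal A)=\{u\in\mathcal A: u\mathcal A\text{ is dense in }\mathcal A\}$; $\mathcal A$ has dense principal ideals if $\Omega(\mathcal A)\ne\emptyset$. For such $\mathcal A$, $u\in\mathcal A$, $v\in\Omega(\mathcal A)$, $S_{u/v}$ is the closed operator with domain $\{x\in\mathcal A:ux\in v\mathcal A\}$, $S_{u/v}x$ being the unique $y$ with $vy=ux$. $\mathcal{QM}(\mathcal A)$ is the algebra of all such operators (quasimultipliers), with $S_{u/v}+S_{u'/v'}=S_{(uv'+u'v)/vv'}$ and $S_{u/v}S_{u'/v'}=S_{uu'/vv'}$. A set $V\subset\mathcal{QM}(\mathcal A)$ is pseudobounded if $\sup_{S\in V}\|Su\|<\infty$ for some $u\in\Omega(\mathcal A)$ in the domain of all $S\in V$. A pseudobounded isomorphism is an algebra isomorphism which, together with its inverse, maps pseudobounded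 sets to pseudobounded sets. $\mathcal M(\mathcal A)$ is the Banach algebra (operator norm) of multipliers, i.e. bounded linear $R$ on $\mathcal A$ with $R(uv)=(Ru)v$; it is identified with the quasimultipliers of domain $\mathcal A$. A (continuous) homomorphism $\Phi:\mathcal A\to\mathcal B$ into a weakly cancellative Banach algebra is a $\mathcal{QM}$-homomorphism with respect to $u\in\Omega(\mathcal A)$ if it is injective with dense range and $\Phi(u)\mathcal B\subset\Phi(\mathcal A)$. A semigroup $T=(T(t))_{t>0}\subset\mathcal M(\mathcal A)$ is strongly continuous if $t\mapsto T(t)u$ is continuous on $(0,\infty)$ for every $u\in\mathcal A$; $\rho_T=\lim_{t\to+\infty}\|T(t)\|^{1/t}$ ($\log 0=-\infty$). $\mathcal L_T$ is an ideal of $\mathcal A$; $u\in\mathcal A$ is viewed in $\mathcal M(\mathcal L_T)$ as multiplication by $u$. *)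

theory Defs
  imports "HOL-Analysis.Analysis" "HOL-Algebra.QuotRing" "HOL-Algebra.Algebraic_Closure_Type"
begin

text \<open>
  The algebras below (an algebra, an ideal with another norm, a closure inside an algebra of
  operators) do not live on types of their own, so they are explicit-carrier structures over
  the module records of HOL-Algebra. Algebras need not be unital: the inherited field
  \<^term>\<open>one\<close> is unconstrained in \<open>banach_algebra\<close>.
\<close>

record 'a normed_alg = "(complex, 'a) module" +
  nrm :: "'a \<Rightarrow> real"

abbreviation complex_ring :: "complex ring"
  where "complex_ring \<equiv> ring_of_type_algebra"

text \<open>The distance is \<open>0\<close> off the carrier because \<^locale>\<open>Metric_space\<close> asks for
  nonnegativity and symmetry on the whole type.\<close>

definition norm_dist :: "'a normed_alg \<Rightarrow> 'a \<Rightarrow> 'a \<Rightarrow> real"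
  where "norm_dist A x y =
    (if x \<in> carrier A \<and> y \<in> carrier A then nrm A (x \<ominus>\<^bsub>A\<^esub> y) else 0)"

definition norm_top :: "'a normed_alg \<Rightarrow> 'a topology"
  where "norm_top A = Metric_space.mtopology (carrier A) (norm_dist A)"

definition dense_in :: "'a normed_alg \<Rightarrow> 'a set \<Rightarrow> bool"
  where "dense_in A S \<longleftrightarrow> S \<subseteq> carrier A \<and> norm_top A closure_of S = carrier A"

locale banach_algebra = module complex_ring A for A :: "'a normed_alg" (structure) +
  assumes mult_closed: "\<lbrakk>x \<in> carrier A; y \<in> carrier A\<rbrakk> \<Longrightarrow> x \<otimes> y \<in> carrier A"
    and mult_assoc: "\<lbrakk>x \<in> carrier A; y \<in> carrier A; z \<in> carrier A\<rbrakk>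
          \<Longrightarrow> (x \<otimes> y) \<otimes> z = x \<otimes> (y \<otimes> z)"
    and distr_left: "\<lbrakk>x \<in> carrier A; y \<in> carrier A; z \<in> carrier A\<rbrakk>
          \<Longrightarrow> (x \<oplus> y) \<otimes> z = x \<otimes> z \<oplus> y \<otimes> z"
    and distr_right: "\<lbrakk>x \<in> carrier A; y \<in> carrier A; z \<in> carrier A\<rbrakk>
          \<Longrightarrow> z \<otimes> (x \<oplus> y) = z \<otimes> x \<oplus> z \<otimes> y"
    and smult_mult_left: "\<lbrakk>x \<in> carrier A; y \<in> carrier A\<rbrakk>
          \<Longrightarrow> (c \<odot> x) \<otimes> y = c \<odot> (x \<otimes> y)"
    and smult_mult_right: "\<lbrakk>x \<in> carrier A; y \<in> carrier A\<rbrakk>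
          \<Longrightarrow> x \<otimes> (c \<odot> y) = c \<odot> (x \<otimes> y)"
    and nrm_nonneg: "x \<in> carrier A \<Longrightarrow> 0 \<le> nrm A x"
    and nrm_eq_zero_iff: "x \<in> carrier A \<Longrightarrow> nrm A x = 0 \<longleftrightarrow> x = \<zero>"
    and nrm_triangle: "\<lbrakk>x \<in> carrier A; y \<in> carrier A\<rbrakk> \<Longrightarrow> nrm A (x \<oplus> y) \<le> nrm A x + nrm A y"
    and nrm_smult: "x \<in> carrier A \<Longrightarrow> nrm A (c \<odot> x) = cmod c * nrm A x"
    and nrm_mult: "\<lbrakk>x \<in> carrier A; y \<in> carrier A\<rbrakk> \<Longrightarrow> nrm A (x \<otimes> y) \<le> nrm A x * nrm A y"
    and complete: "Metric_space.mcomplete (carrier A) (norm_dist A)"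

locale weakly_cancellative_algebra = banach_algebra A for A :: "'a normed_alg" (structure) +
  assumes mult_comm: "\<lbrakk>x \<in> carrier A; y \<in> carrier A\<rbrakk> \<Longrightarrow> x \<otimes> y = y \<otimes> x"
    and nonzero: "carrier A \<noteq> {\<zero>}"
    and weakly_cancellative:
      "u \<in> carrier A - {\<zero>} \<Longrightarrow> (\<lambda>x. u \<otimes> x) ` carrier A \<noteq> {\<zero>}"

definition Omega :: "'a normed_alg \<Rightarrow> 'a set"
  where "Omega A = {u \<in> carrier A. dense_in A ((\<lambda>x. u \<otimes>\<^bsub>A\<^esub> x) ` carrier A)}"

definition dense_principal_ideals :: "'a normed_alg \<Rightarrow> bool"
  where "dense_principal_ideals A \<longleftrightarrow> Omega A \<noteq> {}"

text \<open>A partially defined operator is a partial map; \<open>quot_op A u v\<close> is $S_{u/v}$.\<close>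

definition quot_op :: "'a normed_alg \<Rightarrow> 'a \<Rightarrow> 'a \<Rightarrow> 'a \<Rightarrow> 'a option"
  where "quot_op A u v = (\<lambda>x.
    if x \<in> carrier A \<and> u \<otimes>\<^bsub>A\<^esub> x \<in> (\<lambda>y. v \<otimes>\<^bsub>A\<^esub> y) ` carrier A
    then Some (THE y. y \<in> carrier A \<and> v \<otimes>\<^bsub>A\<^esub> y = u \<otimes>\<^bsub>A\<^esub> x) else None)"

definition represents :: "'a normed_alg \<Rightarrow> 'a \<Rightarrow> 'a \<Rightarrow> ('a \<Rightarrow> 'a option) \<Rightarrow> bool"
  where "represents A u v S \<longleftrightarrow> u \<in> carrier A \<and> v \<in> Omega A \<and> S = quot_op A u v"

text \<open>The operations are given on fractions; the definite descriptions select the common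
  value for all representing fractions. Unit and zero are $S_{v/v}$ and $S_{0/v}$, i.e. the
  identity and the zero operator with full domain.\<close>

definition QM :: "'a normed_alg \<Rightarrow> (complex, 'a \<Rightarrow> 'a option) module"
  where "QM A = \<lparr>
    carrier = {quot_op A u v | u v. u \<in> carrier A \<and> v \<in> Omega A},
    monoid.mult = (\<lambda>S S'. THE R. \<exists>u v u' v'. represents A u v S \<and> represents A u' v' S' \<and>
       R = quot_op A (u \<otimes>\<^bsub>A\<^esub> u') (v \<otimes>\<^bsub>A\<^esub> v')),
    one = (\<lambda>x. if x \<in> carrier A then Some x else None),
    ring.zero = (\<lambda>x. if x \<in> carrier A then Some \<zero>\<^bsub>A\<^esub> else None),
    add = (\<lambda>S S'. THE R. \<exists>u v u' v'. represents A u v S \<and> represents A u' v' S' \<and>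
       R = quot_op A (u \<otimes>\<^bsub>A\<^esub> v' \<oplus>\<^bsub>A\<^esub> u' \<otimes>\<^bsub>A\<^esub> v) (v \<otimes>\<^bsub>A\<^esub> v')),
    smult = (\<lambda>c S. THE R. \<exists>u v. represents A u v S \<and> R = quot_op A (c \<odot>\<^bsub>A\<^esub> u) v) \<rparr>"

definition pseudobounded :: "'a normed_alg \<Rightarrow> ('a \<Rightarrow> 'a option) set \<Rightarrow> bool"
  where "pseudobounded A V \<longleftrightarrow> V \<subseteq> carrier (QM A) \<and>
    (\<exists>u \<in> Omega A. (\<forall>S \<in> V. u \<in> dom S) \<and> bdd_above ((\<lambda>S. nrm A (the (S u))) ` V))"

definition pseudobounded_iso ::
    "'a normed_alg \<Rightarrow> 'b normed_alg \<Rightarrow> (('a \<Rightarrow> 'a option) \<Rightarrow> ('b \<Rightarrow> 'b option)) \<Rightarrow> bool"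
  where "pseudobounded_iso A B F \<longleftrightarrow>
    F \<in> ring_iso (QM A) (QM B) \<and>
    (\<forall>c. \<forall>S \<in> carrier (QM A). F (c \<odot>\<^bsub>QM A\<^esub> S) = c \<odot>\<^bsub>QM B\<^esub> F S) \<and>
    (\<forall>V. pseudobounded A V \<longrightarrow> pseudobounded B (F ` V)) \<and>
    (\<forall>W. pseudobounded B W \<longrightarrow> pseudobounded A (inv_into (carrier (QM A)) F ` W))"

definition QM_homomorphism ::
    "'a normed_alg \<Rightarrow> 'b normed_alg \<Rightarrow> 'a \<Rightarrow> ('a \<Rightarrow> 'b) \<Rightarrow> bool"
  where "QM_homomorphism A B u \<Phi> \<longleftrightarrow>
    weakly_cancellative_algebra A \<and> weakly_cancellative_algebra B \<and> u \<in> Omega A \<and>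
    \<Phi> \<in> carrier A \<rightarrow> carrier B \<and>
    (\<forall>x \<in> carrier A. \<forall>y \<in> carrier A. \<Phi> (x \<oplus>\<^bsub>A\<^esub> y) = \<Phi> x \<oplus>\<^bsub>B\<^esub> \<Phi> y) \<and>
    (\<forall>x \<in> carrier A. \<forall>y \<in> carrier A. \<Phi> (x \<otimes>\<^bsub>A\<^esub> y) = \<Phi> x \<otimes>\<^bsub>B\<^esub> \<Phi> y) \<and>
    (\<forall>c. \<forall>x \<in> carrier A. \<Phi> (c \<odot>\<^bsub>A\<^esub> x) = c \<odot>\<^bsub>B\<^esub> \<Phi> x) \<and>
    continuous_map (norm_top A) (norm_top B) \<Phi> \<and>
    inj_on \<Phi> (carrier A) \<and> dense_in B (\<Phi> ` carrier A) \<and>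
    (\<lambda>b. \<Phi> u \<otimes>\<^bsub>B\<^esub> b) ` carrier B \<subseteq> \<Phi> ` carrier A"

text \<open>For \<open>\<Phi>\<close> the inclusion of \<open>A\<close> in a larger algebra \<open>B\<close>, this is the tautological map
  $S_{u/v} \mapsto S_{u/v}$.\<close>

definition QM_map ::
    "'a normed_alg \<Rightarrow> 'b normed_alg \<Rightarrow> ('a \<Rightarrow> 'b) \<Rightarrow> ('a \<Rightarrow> 'a option) \<Rightarrow> ('b \<Rightarrow> 'b option)"
  where "QM_map A B \<Phi> S = (THE R. \<exists>u v. represents A u v S \<and> R = quot_op B (\<Phi> u) (\<Phi> v))"

text \<open>Operators on \<open>A\<close> are represented by functions that are \<^const>\<open>undefined\<close> off the
  carrier, so that equality of functions is equality of operators.\<close>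

definition multiplier_alg :: "'a normed_alg \<Rightarrow> ('a \<Rightarrow> 'a) normed_alg"
  where "multiplier_alg A = \<lparr>
    carrier = {R \<in> carrier A \<rightarrow>\<^sub>E carrier A.
       (\<forall>x \<in> carrier A. \<forall>y \<in> carrier A. R (x \<oplus>\<^bsub>A\<^esub> y) = R x \<oplus>\<^bsub>A\<^esub> R y) \<and>
       (\<forall>c. \<forall>x \<in> carrier A. R (c \<odot>\<^bsub>A\<^esub> x) = c \<odot>\<^bsub>A\<^esub> R x) \<and>
       (\<exists>C. \<forall>x \<in> carrier A. nrm A (R x) \<le> C * nrm A x) \<and>
       (\<forall>x \<in> carrier A. \<forall>y \<in> carrier A. R (x \<otimes>\<^bsub>A\<^esub> y) = R x \<otimes>\<^bsub>A\<^esub> y)},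
    monoid.mult = compose (carrier A),
    one = (\<lambda>x\<in>carrier A. x),
    ring.zero = (\<lambda>x\<in>carrier A. \<zero>\<^bsub>A\<^esub>),
    add = (\<lambda>R S. \<lambda>x\<in>carrier A. R x \<oplus>\<^bsub>A\<^esub> S x),
    smult = (\<lambda>c R. \<lambda>x\<in>carrier A. c \<odot>\<^bsub>A\<^esub> R x),
    nrm = (\<lambda>R. SUP x \<in> {x \<in> carrier A. nrm A x \<le> 1}. nrm A (R x)) \<rparr>"

text \<open>The identification of multipliers with the quasimultipliers of full domain,
  in both directions.\<close>

definition mult_to_QM :: "'a normed_alg \<Rightarrow> ('a \<Rightarrow> 'a) \<Rightarrow> ('a \<Rightarrow> 'a option)"
  where "mult_to_QM A R = (\<lambda>x. if x \<in> carrier A then Some (R x) else None)"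

definition QM_to_mult :: "'a normed_alg \<Rightarrow> ('a \<Rightarrow> 'a option) \<Rightarrow> ('a \<Rightarrow> 'a)"
  where "QM_to_mult A S = (\<lambda>x\<in>carrier A. the (S x))"

text \<open>Only the values \<open>T t\<close> for \<open>t > 0\<close> matter in the following.\<close>

definition strongly_continuous_semigroup :: "'a normed_alg \<Rightarrow> (real \<Rightarrow> 'a \<Rightarrow> 'a) \<Rightarrow> bool"
  where "strongly_continuous_semigroup A T \<longleftrightarrow>
    (\<forall>t>0. T t \<in> carrier (multiplier_alg A)) \<and>
    (\<forall>s>0. \<forall>t>0. T (s + t) = T s \<otimes>\<^bsub>multiplier_alg A\<^esub> T t) \<and>
    (\<forall>u \<in> carrier A. continuous_map (top_of_set {0<..}) (norm_top A) (\<lambda>t. T t u))"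

definition growth_rate :: "'a normed_alg \<Rightarrow> (real \<Rightarrow> 'a \<Rightarrow> 'a) \<Rightarrow> real"
  where "growth_rate A T = Lim at_top (\<lambda>t. nrm (multiplier_alg A) (T t) powr (1 / t))"

definition log_growth_rate :: "'a normed_alg \<Rightarrow> (real \<Rightarrow> 'a \<Rightarrow> 'a) \<Rightarrow> ereal"
  where "log_growth_rate A T =
    (if growth_rate A T = 0 then -\<infinity> else ereal (ln (growth_rate A T)))"

definition L_ideal :: "'a normed_alg \<Rightarrow> (real \<Rightarrow> 'a \<Rightarrow> 'a) \<Rightarrow> 'a set"
  where "L_ideal A T =
    {u \<in> carrier A. Limsup (at_right 0) (\<lambda>t. ereal (nrm A (T t u))) < \<infinity>}"

text \<open>The conditional expresses the convention $T(0) = I$.\<close>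

definition lambda_norm :: "'a normed_alg \<Rightarrow> (real \<Rightarrow> 'a \<Rightarrow> 'a) \<Rightarrow> real \<Rightarrow> 'a \<Rightarrow> real"
  where "lambda_norm A T lam u =
    (SUP s \<in> {0..}. exp (- lam * s) * nrm A (if s = 0 then u else T s u))"

definition L_alg :: "'a normed_alg \<Rightarrow> (real \<Rightarrow> 'a \<Rightarrow> 'a) \<Rightarrow> real \<Rightarrow> 'a normed_alg"
  where "L_alg A T lam = A\<lparr>carrier := L_ideal A T, nrm := lambda_norm A T lam\<rparr>"

text \<open>An element of \<open>A\<close>, viewed as a multiplication operator on the ideal.\<close>

definition L_incl :: "'a normed_alg \<Rightarrow> (real \<Rightarrow> 'a \<Rightarrow> 'a) \<Rightarrow> 'a \<Rightarrow> ('a \<Rightarrow> 'a)"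
  where "L_incl A T u = (\<lambda>x\<in>L_ideal A T. u \<otimes>\<^bsub>A\<^esub> x)"

text \<open>The closure of \<open>A\<close> in the multiplier algebra of \<open>L_alg A T lam\<close>, with the norm
  $\|\cdot\|_{\lambda,op}$ of that multiplier algebra.\<close>

definition closure_alg :: "'a normed_alg \<Rightarrow> (real \<Rightarrow> 'a \<Rightarrow> 'a) \<Rightarrow> real \<Rightarrow> ('a \<Rightarrow> 'a) normed_alg"
  where "closure_alg A T lam = (multiplier_alg (L_alg A T lam))
    \<lparr>carrier := norm_top (multiplier_alg (L_alg A T lam)) closure_of (L_incl A T ` carrier A)\<rparr>"

definition QM_incl :: "'a normed_alg \<Rightarrow> (real \<Rightarrow> 'a \<Rightarrow> 'a) \<Rightarrow> real
    \<Rightarrow> ('a \<Rightarrow> 'a option) \<Rightarrow> (('a \<Rightarrow> 'a) \<Rightarrow> ('a \<Rightarrow> 'a) option)"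
  where "QM_incl A T lam = QM_map A (closure_alg A T lam) (L_incl A T)"

end

theory Submission
  imports Defs
begin

text \<open>
  The point that needs a construction is that \<open>\<Omega>(A) \<inter> L\<^sub>T\<close> is nonempty. Rescale to
  \<open>S(t) = e\<^sup>-\<^sup>\<lambda>\<^sup>t T(t)\<close>, so that \<open>S(t) \<rightarrow> 0\<close> in norm as \<open>t \<rightarrow> \<infinity>\<close> and the \<open>\<lambda>\<close>-norm of
  \<open>u\<close> is the supremum of the orbit \<open>S(s)u\<close>. No \<open>S(d)u\<close> with \<open>u \<in> \<Omega>(A)\<close> need be in
  \<open>\<Omega>(A)\<close>, but it can be approximated in \<open>L\<^sub>T\<close> by \<open>Q S(d')u\<close> with \<open>d' < d\<close> arbitrarily small
  and \<open>Q\<close> a multiplier with dense range: take \<open>Q = ((I + S(t)) / 2)\<^sup>n\<close> with \<open>n t / 2 = d - d'\<close>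
  and \<open>n\<close> large, which by the variance bound for the binomial distribution acts on orbits almost
  like \<open>S(d - d')\<close>. Baire's theorem in the closure of all \<open>Q S(d)u\<close> in \<open>L\<^sub>T\<close> then yields an
  element of \<open>\<Omega>(A) \<inter> L\<^sub>T\<close>.

  Given \<open>w\<close> in that set, \<open>b \<mapsto> b w\<close> maps \<open>A\<^sub>T\<close> boundedly into \<open>A\<close>, which inverts the
  inclusion on fractions: \<open>S\<^bsub>u/v\<^esub> = S\<^bsub>uw/vw\<^esub>\<close>. A multiplier \<open>R\<close> of \<open>A\<close> acts on \<open>A\<^sub>T\<close> by
  composition, \<open>b \<mapsto> R b\<close>. Continuity of \<open>T\<close> at \<open>0\<close> on \<open>A\<^sub>T\<close> reduces by density and
  \<open>\<parallel>T(t)\<parallel> \<le> e\<^sup>\<lambda>\<^sup>t\<close> to elements of \<open>T(d)A\<close>, for which it is the continuity at \<open>d > 0\<close>.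
\<close>

section \<open>Normed spaces with explicit carrier\<close>

text \<open>The hypothesis makes only the union of the ranges of \<open>T t\<close> dense. For right
  translations on the convolution algebra of integrable functions on the half-line no single
  \<open>T t\<close> has dense range, and this is why an orbit point of u can fail to be in
  Omega(A). The strict choice of lambda pays twice: orbits stay bounded away from time 0, and S(nt)
  tends to 0, so that I + S(t) has dense range whatever the range of S(t) is. Replacing S(d) by Q
  S(d') keeps the elapsed time in the mean, so the change in L is small although the time d' left in
  the semigroup itself may be much shorter than d; and a short d' is what brings the ideal generated
  by the new element close to u. Approximating the one element u suffices, because uA is already
  dense; this makes membership in Omega(A) follow from countably many open conditions and opens the
  way to Baire. Elements of this kind are needed even for the parts of the claim that do not mention
  them: without some w there would be no way back from fractions over the closure to fractions over
  A.\<close>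

text \<open>Everything metric is developed without product and completeness, so that it already
  applies to \<open>multiplier_alg\<close> and \<open>L_alg\<close> while these are still being
  shown to be Banach algebras.\<close>

locale normed_space = module complex_ring A for A :: "'a normed_alg" (structure) +
  assumes norm_nonneg: "x \<in> carrier A \<Longrightarrow> 0 \<le> nrm A x"
    and norm_eq_zero_iff: "x \<in> carrier A \<Longrightarrow> nrm A x = 0 \<longleftrightarrow> x = \<zero>"
    and norm_triangle: "\<lbrakk>x \<in> carrier A; y \<in> carrier A\<rbrakk> \<Longrightarrow> nrm A (x \<oplus> y) \<le> nrm A x + nrm A y"
    and norm_smult: "x \<in> carrier A \<Longrightarrow> nrm A (c \<odot> x) = cmod c * nrm A x"
begin

lemma scal_closed [simp, intro]: "x \<in> carrier A \<Longrightarrow> c \<odot> x \<in> carrier A"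
  by (rule smult_closed) (simp_all add: ring_of_type_algebra_def)

lemma scal_add_left: "x \<in> carrier A \<Longrightarrow> (a + b) \<odot> x = a \<odot> x \<oplus> b \<odot> x"
  using smult_l_distr[of a b x] by (simp add: ring_of_type_algebra_def)

lemma scal_add_right: "\<lbrakk>x \<in> carrier A; y \<in> carrier A\<rbrakk> \<Longrightarrow> a \<odot> (x \<oplus> y) = a \<odot> x \<oplus> a \<odot> y"
  using smult_r_distr[of a x y] by (simp add: ring_of_type_algebra_def)

lemma scal_scal: "x \<in> carrier A \<Longrightarrow> a \<odot> (b \<odot> x) = (a * b) \<odot> x"
  using smult_assoc1[of a b x] by (simp add: ring_of_type_algebra_def)

lemma scal_one [simp]: "x \<in> carrier A \<Longrightarrow> 1 \<odot> x = x"
  using smult_one[of x] by (simp add: ring_of_type_algebra_def)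

lemma scal_zero [simp]: "x \<in> carrier A \<Longrightarrow> 0 \<odot> x = \<zero>"
  using smult_l_null[of x] by (simp add: ring_of_type_algebra_def)

lemma scal_zero_right [simp]: "c \<odot> \<zero> = \<zero>"
  using smult_r_null[of c] by (simp add: ring_of_type_algebra_def)

lemma scal_uminus_one: "x \<in> carrier A \<Longrightarrow> (-1) \<odot> x = \<ominus> x"
proof -
  assume x: "x \<in> carrier A"
  have "(-1) \<odot> x \<oplus> x = (-1 + 1) \<odot> x"
    using x by (simp only: scal_add_left scal_one)
  also have "\<dots> = \<zero>"
    using x by simp
  finally show ?thesis
    using x by (simp add: M.minus_equality)
qed

lemma minus_alt: "\<lbrakk>x \<in> carrier A; y \<in> carrier A\<rbrakk> \<Longrightarrow> x \<ominus> y = x \<oplus> (-1) \<odot> y"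
  by (simp add: a_minus_def scal_uminus_one)

lemma scal_minus_right:
  "\<lbrakk>x \<in> carrier A; y \<in> carrier A\<rbrakk> \<Longrightarrow> c \<odot> (x \<ominus> y) = c \<odot> x \<ominus> c \<odot> y"
  by (simp add: minus_alt scal_add_right scal_scal)

lemma add_minus_add:
  "\<lbrakk>x \<in> carrier A; y \<in> carrier A; z \<in> carrier A; w \<in> carrier A\<rbrakk>
    \<Longrightarrow> (x \<oplus> y) \<ominus> (z \<oplus> w) = (x \<ominus> z) \<oplus> (y \<ominus> w)"
  by (simp add: minus_alt scal_add_right M.a_ac)

lemma minus_add_minus:
  "\<lbrakk>x \<in> carrier A; y \<in> carrier A; z \<in> carrier A\<rbrakk> \<Longrightarrow> (x \<ominus> y) \<oplus> (y \<ominus> z) = x \<ominus> z"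
  by (simp add: a_minus_def M.a_assoc M.r_neg1)

lemma minus_self [simp]: "x \<in> carrier A \<Longrightarrow> x \<ominus> x = \<zero>"
  by (simp add: a_minus_def M.r_neg)

lemma minus_add_cancel: "\<lbrakk>x \<in> carrier A; y \<in> carrier A\<rbrakk> \<Longrightarrow> (x \<ominus> y) \<oplus> y = x"
  by (simp add: a_minus_def M.a_assoc M.l_neg)

lemma minus_eq_zero_iff: "\<lbrakk>x \<in> carrier A; y \<in> carrier A\<rbrakk> \<Longrightarrow> x \<ominus> y = \<zero> \<longleftrightarrow> x = y"
  by (metis M.l_zero minus_add_cancel minus_self)

lemma norm_zero [simp]: "nrm A \<zero> = 0"
  by (simp add: norm_eq_zero_iff)

lemma norm_minus_commute:
  "\<lbrakk>x \<in> carrier A; y \<in> carrier A\<rbrakk> \<Longrightarrow> nrm A (x \<ominus> y) = nrm A (y \<ominus> x)"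
proof -
  assume xy: "x \<in> carrier A" "y \<in> carrier A"
  have "(-1) \<odot> (y \<ominus> x) = x \<ominus> y"
    using xy by (simp add: minus_alt scal_add_right scal_scal M.a_comm)
  then show ?thesis
    using norm_smult[of "y \<ominus> x" "-1"] xy by simp
qed

lemma norm_minus_triangle:
  "\<lbrakk>x \<in> carrier A; y \<in> carrier A; z \<in> carrier A\<rbrakk>
    \<Longrightarrow> nrm A (x \<ominus> z) \<le> nrm A (x \<ominus> y) + nrm A (y \<ominus> z)"
  by (metis M.minus_closed minus_add_minus norm_triangle)

lemma norm_le_add_minus:
  "\<lbrakk>x \<in> carrier A; y \<in> carrier A\<rbrakk> \<Longrightarrow> nrm A x \<le> nrm A (x \<ominus> y) + nrm A y"
  by (metis M.minus_closed minus_add_cancel norm_triangle)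

lemma norm_minus_le:
  "\<lbrakk>x \<in> carrier A; y \<in> carrier A\<rbrakk> \<Longrightarrow> nrm A (x \<ominus> y) \<le> nrm A x + nrm A y"
  using norm_triangle[of x "(-1) \<odot> y"] by (simp add: minus_alt norm_smult)

lemma norm_dist_eq: "\<lbrakk>x \<in> carrier A; y \<in> carrier A\<rbrakk> \<Longrightarrow> norm_dist A x y = nrm A (x \<ominus> y)"
  by (simp add: norm_dist_def)

sublocale met: Metric_space "carrier A" "norm_dist A"
proof
  show "0 \<le> norm_dist A x y" for x y
    by (simp add: norm_dist_def norm_nonneg)
  show "norm_dist A x y = norm_dist A y x" for x y
    using norm_minus_commute[of x y] by (auto simp: norm_dist_def)
  show "norm_dist A x y = 0 \<longleftrightarrow> x = y" if "x \<in> carrier A" "y \<in> carrier A" for x y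
    using that by (simp add: norm_dist_def norm_eq_zero_iff minus_eq_zero_iff)
  show "norm_dist A x z \<le> norm_dist A x y + norm_dist A y z"
    if "x \<in> carrier A" "y \<in> carrier A" "z \<in> carrier A" for x y z
    using that by (simp add: norm_dist_def norm_minus_triangle)
qed

lemma norm_top_eq: "norm_top A = met.mtopology"
  by (simp add: norm_top_def)

lemma topspace_norm_top [simp]: "topspace (norm_top A) = carrier A"
  by (simp add: norm_top_eq)

lemma in_closure_iff:
  assumes "S \<subseteq> carrier A"
  shows "x \<in> norm_top A closure_of S \<longleftrightarrow>
    x \<in> carrier A \<and> (\<forall>e>0. \<exists>y\<in>S. nrm A (x \<ominus> y) < e)"
  unfolding norm_top_eq met.metric_closure_of using assms
proof -
  have "(y \<in> met.mball x e) = (nrm A (x \<ominus> y) < e)" if "x \<in> carrier A" "y \<in> S" for x y e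
    using that assms by (auto simp: met.in_mball norm_dist_eq)
  then show "x \<in> {x \<in> carrier A. \<forall>r>0. \<exists>y\<in>S. y \<in> met.mball x r} \<longleftrightarrow>
      x \<in> carrier A \<and> (\<forall>e>0. \<exists>y\<in>S. nrm A (x \<ominus> y) < e)"
    by (simp cong: bex_cong conj_cong)
qed

lemma dense_in_iff:
  "dense_in A S \<longleftrightarrow> S \<subseteq> carrier A \<and> (\<forall>x\<in>carrier A. \<forall>e>0. \<exists>y\<in>S. nrm A (x \<ominus> y) < e)"
proof (cases "S \<subseteq> carrier A")
  case True
  then show ?thesis
    unfolding dense_in_def set_eq_iff by (simp add: in_closure_iff) blast
qed (simp add: dense_in_def)

lemma complete_iff:
  "met.mcomplete \<longleftrightarrow> (\<forall>s :: nat \<Rightarrow> 'a. (\<forall>n. s n \<in> carrier A) \<and>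
      (\<forall>e>0. \<exists>N. \<forall>m\<ge>N. \<forall>n\<ge>N. nrm A (s m \<ominus> s n) < e) \<longrightarrow>
      (\<exists>l\<in>carrier A. \<forall>e>0. \<exists>N. \<forall>n\<ge>N. nrm A (s n \<ominus> l) < e))"
proof -
  have 1: "met.MCauchy s \<longleftrightarrow> (\<forall>n. s n \<in> carrier A) \<and>
      (\<forall>e>0. \<exists>N. \<forall>m\<ge>N. \<forall>n\<ge>N. nrm A (s m \<ominus> s n) < e)" for s
  proof (cases "\<forall>n. s n \<in> carrier A")
    case True
    then show ?thesis
      unfolding met.MCauchy_def by (simp add: image_subset_iff norm_dist_eq)
  qed (auto simp: met.MCauchy_def)
  have 2: "limitin met.mtopology s l sequentially \<longleftrightarrow>
     l \<in> carrier A \<and> (\<forall>e>0. \<exists>N. \<forall>n\<ge>N. nrm A (s n \<ominus> l) < e)" if "\<forall>n. s n \<in> carrier A" for s l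
    unfolding met.limitin_metric eventually_sequentially using that
    by (auto simp: norm_dist_eq)
  show ?thesis
    unfolding met.mcomplete_def 1 using 2 by (simp add: Bex_def)
qed

lemma continuous_map_norm_top_iff:
  assumes "f \<in> S \<rightarrow> carrier A"
  shows "continuous_map (top_of_set S) (norm_top A) f \<longleftrightarrow>
    (\<forall>s\<in>S. \<forall>e>0. \<exists>d>0. \<forall>t\<in>S. dist t s < d \<longrightarrow> nrm A (f t \<ominus> f s) < e)"
    (is "?l = ?r")
proof -
  \<comment> \<open>The parameter set is presented as a metric space itself, so that continuity on
    it becomes an epsilon-delta statement.\<close>
  have *: "top_of_set S = Metric_space.mtopology S dist"
    by (metis mtopology_is_euclidean Submetric.intro Submetric.mtopology_submetric
        Submetric_axioms.intro subset_UNIV Met_TC.Metric_space_axioms)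
  interpret S: Metric_space S dist
    by (simp add: Met_TC.subspace)
  have "?l \<longleftrightarrow> (\<forall>s\<in>S. \<forall>e>0. \<exists>d>0. \<forall>t. t \<in> S \<and> dist s t < d \<longrightarrow> norm_dist A (f s) (f t) < e)"
    unfolding * norm_top_eq S.metric_continuous_map[OF met.Metric_space_axioms]
    using assms by blast
  also have "\<dots> \<longleftrightarrow> ?r"
  proof -
    have "norm_dist A (f s) (f t) = nrm A (f t \<ominus> f s)" if "s \<in> S" "t \<in> S" for s t
      using assms that by (simp add: norm_dist_eq Pi_iff norm_minus_commute)
    then show ?thesis
      by (simp add: dist_commute) (smt (verit))
  qed
  finally show ?thesis .
qed

end

lemma normed_space_continuous_mapI:
  assumes "normed_space A" "normed_space B" "f \<in> carrier A \<rightarrow> carrier B"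
    and "\<And>x y. \<lbrakk>x \<in> carrier A; y \<in> carrier A\<rbrakk>
      \<Longrightarrow> nrm B (f x \<ominus>\<^bsub>B\<^esub> f y) \<le> C * nrm A (x \<ominus>\<^bsub>A\<^esub> y)"
  shows "continuous_map (norm_top A) (norm_top B) f"
proof -
  interpret A: normed_space A by fact
  interpret B: normed_space B by fact
  have "\<exists>d>0. \<forall>y. y \<in> carrier A \<and> norm_dist A x y < d \<longrightarrow> norm_dist B (f x) (f y) < e"
    if "x \<in> carrier A" "e > 0" for x e
  proof (intro exI conjI allI impI)
    show "e / (\<bar>C\<bar> + 1) > 0"
      using that by (simp add: add_nonneg_pos)
    fix y assume y: "y \<in> carrier A \<and> norm_dist A x y < e / (\<bar>C\<bar> + 1)"
    then have "(\<bar>C\<bar> + 1) * nrm A (x \<ominus>\<^bsub>A\<^esub> y) < e"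
      using that by (simp add: A.norm_dist_eq[symmetric] pos_less_divide_eq mult.commute add_nonneg_pos)
    moreover have "nrm B (f x \<ominus>\<^bsub>B\<^esub> f y) \<le> (\<bar>C\<bar> + 1) * nrm A (x \<ominus>\<^bsub>A\<^esub> y)"
      using assms(4)[of x y] that y A.norm_nonneg[of "x \<ominus>\<^bsub>A\<^esub> y"]
      by (smt (verit, ccfv_SIG) A.minus_closed mult_right_mono)
    ultimately show "norm_dist B (f x) (f y) < e"
      using y that assms(3) by (simp add: B.norm_dist_eq Pi_iff)
  qed
  then show ?thesis
    unfolding A.norm_top_eq B.norm_top_eq A.met.metric_continuous_map[OF B.met.Metric_space_axioms]
    using assms(3) by blast
qed

section \<open>Multipliers\<close>

text \<open>Serves every estimate in which an approximation error is multiplied by a fixed norm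
  \<open>m\<close>: the error is chosen below \<open>d\<close>, with no case distinction on
  \<open>m = 0\<close>.\<close>

lemma ex_small_factor:
  fixes m e :: real
  assumes "e > 0"
  obtains d where "d > 0" "\<And>r. \<lbrakk>0 \<le> r; r < d\<rbrakk> \<Longrightarrow> m * r < e"
proof
  show "e / (\<bar>m\<bar> + 1) > 0"
    using assms by (simp add: add_nonneg_pos)
  fix r assume r: "0 \<le> r" "r < e / (\<bar>m\<bar> + 1)"
  have "m * r \<le> (\<bar>m\<bar> + 1) * r"
    using r(1) by (intro mult_right_mono) auto
  then show "m * r < e"
    using r(2) by (simp add: pos_less_divide_eq add_nonneg_pos mult.commute)
qed

text \<open>The norm \<open>n\<close> is free because \<open>L_alg\<close> replaces the norm
  together with the carrier, and the module laws do not involve it.\<close>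

lemma (in normed_space) subspace_module:
  assumes "H \<subseteq> carrier A" "\<zero> \<in> H" "\<And>x y. \<lbrakk>x \<in> H; y \<in> H\<rbrakk> \<Longrightarrow> x \<oplus> y \<in> H"
    "\<And>c x. x \<in> H \<Longrightarrow> c \<odot> x \<in> H"
  shows "module complex_ring (A\<lparr>carrier := H, nrm := n\<rparr>)"
proof (rule moduleI)
  show "cring complex_ring"
    by (rule cring_from_type_algebra)
  show "abelian_group (A\<lparr>carrier := H, nrm := n\<rparr>)"
  proof (rule abelian_groupI)
    fix x assume "x \<in> carrier (A\<lparr>carrier := H, nrm := n\<rparr>)"
    then show "\<exists>y\<in>carrier (A\<lparr>carrier := H, nrm := n\<rparr>).
        y \<oplus>\<^bsub>A\<lparr>carrier := H, nrm := n\<rparr>\<^esub> x = \<zero>\<^bsub>A\<lparr>carrier := H, nrm := n\<rparr>\<^esub>"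
      using assms(1,4) by (intro bexI[of _ "(-1) \<odot> x"]) (auto simp: scal_uminus_one M.l_neg)
  qed (use assms(1-3) in \<open>auto simp: M.a_ac subset_iff\<close>)
qed (use assms in \<open>auto simp: ring_of_type_algebra_def scal_add_left scal_add_right scal_scal subset_iff\<close>)

lemma (in normed_space) subspace_normed_space:
  assumes "H \<subseteq> carrier A" "\<zero> \<in> H" "\<And>x y. \<lbrakk>x \<in> H; y \<in> H\<rbrakk> \<Longrightarrow> x \<oplus> y \<in> H"
    "\<And>c x. x \<in> H \<Longrightarrow> c \<odot> x \<in> H"
  shows "normed_space (A\<lparr>carrier := H\<rparr>)"
proof -
  have "module complex_ring (A\<lparr>carrier := H, nrm := nrm A\<rparr>)"
    using assms by (rule subspace_module)
  show ?thesis
    unfolding normed_space_def normed_space_axioms_def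
  proof (intro conjI)
    show "module complex_ring (A\<lparr>carrier := H\<rparr>)"
      using \<open>module complex_ring (A\<lparr>carrier := H, nrm := nrm A\<rparr>)\<close> by simp
  qed (use assms(1) in \<open>auto simp: norm_nonneg norm_eq_zero_iff norm_triangle norm_smult subset_iff\<close>)
qed

text \<open>Additive inverses in HOL-Algebra are sought inside the carrier, so shrinking the carrier
  might change them. Writing a difference as addition of the multiple by -1 shows that it does
  not.\<close>

lemma minus_carrier_update:
  assumes "normed_space A" "normed_space (A\<lparr>carrier := H, nrm := n\<rparr>)" "H \<subseteq> carrier A"
    "x \<in> H" "y \<in> H"
  shows "x \<ominus>\<^bsub>A\<lparr>carrier := H, nrm := n\<rparr>\<^esub> y = x \<ominus>\<^bsub>A\<^esub> y"
proof -
  have "x \<in> carrier A" "y \<in> carrier A"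
    using assms by auto
  then show ?thesis
    using normed_space.minus_alt[OF assms(1), of x y]
      normed_space.minus_alt[OF assms(2), of x y] assms(4,5) by simp
qed

sublocale banach_algebra \<subseteq> normed_space A
  by unfold_locales (simp_all add: nrm_nonneg nrm_eq_zero_iff nrm_triangle nrm_smult)

context banach_algebra
begin

lemma mult_minus_left:
  "\<lbrakk>x \<in> carrier A; y \<in> carrier A; z \<in> carrier A\<rbrakk> \<Longrightarrow> (x \<ominus> y) \<otimes> z = x \<otimes> z \<ominus> y \<otimes> z"
  by (simp add: minus_alt distr_left smult_mult_left mult_closed)

lemma mult_minus_right:
  "\<lbrakk>x \<in> carrier A; y \<in> carrier A; z \<in> carrier A\<rbrakk> \<Longrightarrow> z \<otimes> (x \<ominus> y) = z \<otimes> x \<ominus> z \<otimes> y"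
  by (simp add: minus_alt distr_right smult_mult_right mult_closed)

lemma mult_zero_left [simp]: "x \<in> carrier A \<Longrightarrow> \<zero> \<otimes> x = \<zero>"
  using smult_mult_left[of \<zero> x 0] by (simp add: mult_closed)

lemma mult_zero_right [simp]: "x \<in> carrier A \<Longrightarrow> x \<otimes> \<zero> = \<zero>"
  using smult_mult_right[of x \<zero> 0] by (simp add: mult_closed)

declare mult_closed [simp, intro]

lemma Omega_iff:
  "u \<in> Omega A \<longleftrightarrow>
    u \<in> carrier A \<and> (\<forall>x\<in>carrier A. \<forall>e>0. \<exists>y\<in>carrier A. nrm A (x \<ominus> u \<otimes> y) < e)"
  by (auto simp: Omega_def dense_in_iff)

lemma Omega_carrier: "u \<in> Omega A \<Longrightarrow> u \<in> carrier A"
  by (simp add: Omega_def)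

end

section \<open>Annihilators and cancellation\<close>

context weakly_cancellative_algebra
begin

lemma mult_lcomm:
  "\<lbrakk>x \<in> carrier A; y \<in> carrier A; z \<in> carrier A\<rbrakk> \<Longrightarrow> x \<otimes> (y \<otimes> z) = y \<otimes> (x \<otimes> z)"
  by (metis mult_assoc mult_comm)

text \<open>Multiplication by \<open>x\<close> is continuous, so \<open>x\<close> annihilates the
  closure of \<open>S\<close>, which is everything; weak cancellativity forbids this for nonzero
  \<open>x\<close>.\<close>

lemma mult_eq_zero_dense:
  assumes "x \<in> carrier A" "dense_in A S" "\<And>s. s \<in> S \<Longrightarrow> x \<otimes> s = \<zero>"
  shows "x = \<zero>"
proof (rule ccontr)
  assume "x \<noteq> \<zero>"
  have "x \<otimes> y = \<zero>" if y: "y \<in> carrier A" for y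
  proof -
    have "nrm A (x \<otimes> y) \<le> 0"
    proof (rule field_le_epsilon)
      fix e :: real assume e: "e > 0"
      obtain d where d: "d > 0" "\<And>r. \<lbrakk>0 \<le> r; r < d\<rbrakk> \<Longrightarrow> nrm A x * r < e"
        using ex_small_factor[OF e] by blast
      then obtain s where s: "s \<in> S" "nrm A (y \<ominus> s) < d"
        using assms(2) y by (meson dense_in_iff)
      then have sc: "s \<in> carrier A"
        using assms(2) by (auto simp: dense_in_iff)
      have "x \<otimes> y = x \<otimes> (y \<ominus> s)"
        using assms(1) y sc assms(3)[OF s(1)] mult_minus_right[of y s x] by (simp add: a_minus_def)
      then have "nrm A (x \<otimes> y) \<le> nrm A x * nrm A (y \<ominus> s)"
        using nrm_mult[of x "y \<ominus> s"] assms(1) y sc by simp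
      also have "\<dots> \<le> e"
        using d(2)[OF norm_nonneg s(2)] y sc by simp
      finally show "nrm A (x \<otimes> y) \<le> 0 + e"
        by simp
    qed
    then show ?thesis
      using assms(1) y norm_nonneg[of "x \<otimes> y"] norm_eq_zero_iff[of "x \<otimes> y"] by simp
  qed
  then have "(\<lambda>y. x \<otimes> y) ` carrier A = {\<zero>}"
    by (auto intro: rev_image_eqI[of "\<zero>"] simp: assms(1))
  then show False
    using weakly_cancellative[of x] \<open>x \<noteq> \<zero>\<close> assms(1) by simp
qed

text \<open>If \<open>v\<close> annihilates \<open>x \<ominus> y\<close>, then
  \<open>x \<ominus> y\<close> annihilates the dense ideal vA. This is the uniqueness behind the
  definite description in \<open>quot_op\<close>.\<close>

lemma Omega_cancel:
  assumes "v \<in> Omega A" "x \<in> carrier A" "y \<in> carrier A" "v \<otimes> x = v \<otimes> y"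
  shows "x = y"
proof -
  have v: "v \<in> carrier A"
    using assms(1) by (simp add: Omega_def)
  have ann: "(x \<ominus> y) \<otimes> (v \<otimes> z) = \<zero>" if "z \<in> carrier A" for z
  proof -
    have "(x \<ominus> y) \<otimes> (v \<otimes> z) = (v \<otimes> (x \<ominus> y)) \<otimes> z"
      using assms(2,3) v that mult_assoc[of "x \<ominus> y" v z] mult_comm[of "x \<ominus> y" v] by simp
    then show ?thesis
      using assms v that by (simp add: mult_minus_right)
  qed
  have "x \<ominus> y = \<zero>"
  proof (rule mult_eq_zero_dense)
    show "dense_in A ((\<lambda>z. v \<otimes> z) ` carrier A)"
      using assms(1) by (simp add: Omega_def)
  qed (use assms(2,3) ann in auto)
  then show ?thesis
    using assms by (simp add: minus_eq_zero_iff)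
qed

text \<open>The elements \<open>v \<otimes> z\<close> are dense, and multiplication by
  \<open>u\<close> carries them to a dense subset of uA.\<close>

lemma Omega_mult:
  assumes "u \<in> Omega A" "v \<in> Omega A"
  shows "u \<otimes> v \<in> Omega A"
  unfolding Omega_iff
proof (intro conjI ballI allI impI)
  have uv: "u \<in> carrier A" "v \<in> carrier A"
    using assms by (simp_all add: Omega_def)
  then show "u \<otimes> v \<in> carrier A"
    by simp
  fix x and e :: real assume x: "x \<in> carrier A" and e: "e > 0"
  obtain y where y: "y \<in> carrier A" "nrm A (x \<ominus> u \<otimes> y) < e / 2"
    using assms(1) x e unfolding Omega_iff by (meson half_gt_zero)
  obtain d where d: "d > 0" "\<And>r. \<lbrakk>0 \<le> r; r < d\<rbrakk> \<Longrightarrow> nrm A u * r < e / 2"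
    using ex_small_factor[of "e / 2"] e by auto
  then obtain z where z: "z \<in> carrier A" "nrm A (y \<ominus> v \<otimes> z) < d"
    using assms(2) y(1) unfolding Omega_iff by meson
  have "nrm A (u \<otimes> y \<ominus> u \<otimes> v \<otimes> z) \<le> nrm A u * nrm A (y \<ominus> v \<otimes> z)"
    using nrm_mult[of u "y \<ominus> v \<otimes> z"] uv y z by (simp add: mult_minus_right mult_assoc)
  also have "\<dots> < e / 2"
    using d(2)[OF norm_nonneg z(2)] y z uv by simp
  finally have "nrm A (x \<ominus> u \<otimes> v \<otimes> z) < e"
    using norm_minus_triangle[of x "u \<otimes> y" "u \<otimes> v \<otimes> z"] x y z uv by simp
  then show "\<exists>y\<in>carrier A. nrm A (x \<ominus> u \<otimes> v \<otimes> y) < e"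
    using z(1) by blast
qed

end

section \<open>Bounds for multipliers and their operator norm\<close>

context normed_space
begin

abbreviation "Mul \<equiv> multiplier_alg A"

lemma multiplierI:
  assumes "R \<in> carrier A \<rightarrow>\<^sub>E carrier A"
    "\<And>x y. \<lbrakk>x \<in> carrier A; y \<in> carrier A\<rbrakk> \<Longrightarrow> R (x \<oplus> y) = R x \<oplus> R y"
    "\<And>c x. x \<in> carrier A \<Longrightarrow> R (c \<odot> x) = c \<odot> R x"
    "\<And>x. x \<in> carrier A \<Longrightarrow> nrm A (R x) \<le> C * nrm A x"
    "\<And>x y. \<lbrakk>x \<in> carrier A; y \<in> carrier A\<rbrakk> \<Longrightarrow> R (x \<otimes> y) = R x \<otimes> y"
  shows "R \<in> carrier Mul"
proof -
  have "\<exists>C. \<forall>x\<in>carrier A. nrm A (R x) \<le> C * nrm A x"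
    using assms(4) by blast
  then show ?thesis
    using assms by (simp add: multiplier_alg_def)
qed

lemma multiplier_closed [simp, intro]:
  "\<lbrakk>R \<in> carrier Mul; x \<in> carrier A\<rbrakk> \<Longrightarrow> R x \<in> carrier A"
  by (auto simp: multiplier_alg_def)

lemma multiplier_extensional:
  "R \<in> carrier Mul \<Longrightarrow> R \<in> extensional (carrier A)"
  unfolding multiplier_alg_def partial_object.simps mem_Collect_eq PiE_def by blast

lemma multiplier_eqI:
  assumes "R \<in> carrier Mul" "S \<in> carrier Mul"
    "\<And>x. x \<in> carrier A \<Longrightarrow> R x = S x"
  shows "R = S"
  using assms by (intro extensionalityI[of _ "carrier A"]) (auto intro: multiplier_extensional)

lemma multiplier_add:
  "\<lbrakk>R \<in> carrier Mul; x \<in> carrier A; y \<in> carrier A\<rbrakk> \<Longrightarrow> R (x \<oplus> y) = R x \<oplus> R y"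
  by (auto simp: multiplier_alg_def)

lemma multiplier_smult:
  "\<lbrakk>R \<in> carrier Mul; x \<in> carrier A\<rbrakk> \<Longrightarrow> R (c \<odot> x) = c \<odot> R x"
  by (auto simp: multiplier_alg_def)

lemma multiplier_mult:
  "\<lbrakk>R \<in> carrier Mul; x \<in> carrier A; y \<in> carrier A\<rbrakk> \<Longrightarrow> R (x \<otimes> y) = R x \<otimes> y"
  by (auto simp: multiplier_alg_def)

lemma multiplier_minus:
  "\<lbrakk>R \<in> carrier Mul; x \<in> carrier A; y \<in> carrier A\<rbrakk> \<Longrightarrow> R (x \<ominus> y) = R x \<ominus> R y"
  by (simp add: minus_alt multiplier_add multiplier_smult)

lemma multiplier_zero: "R \<in> carrier Mul \<Longrightarrow> R \<zero> = \<zero>"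
  using multiplier_smult[of R \<zero> 0] by simp

lemma multiplier_alg_apply:
  "x \<in> carrier A \<Longrightarrow> (R \<oplus>\<^bsub>Mul\<^esub> S) x = R x \<oplus> S x"
  "x \<in> carrier A \<Longrightarrow> (c \<odot>\<^bsub>Mul\<^esub> R) x = c \<odot> R x"
  "x \<in> carrier A \<Longrightarrow> (R \<otimes>\<^bsub>Mul\<^esub> S) x = R (S x)"
  "x \<in> carrier A \<Longrightarrow> \<zero>\<^bsub>Mul\<^esub> x = \<zero>"
  by (simp_all add: multiplier_alg_def compose_def)

lemma norm_multiplier_bdd:
  assumes "R \<in> carrier Mul"
  shows "bdd_above ((\<lambda>x. nrm A (R x)) ` {x \<in> carrier A. nrm A x \<le> 1})"
proof -
  obtain C where C: "\<And>x. x \<in> carrier A \<Longrightarrow> nrm A (R x) \<le> C * nrm A x"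
    using assms unfolding multiplier_alg_def partial_object.simps mem_Collect_eq by blast
  have "nrm A (R x) \<le> \<bar>C\<bar>" if "x \<in> carrier A" "nrm A x \<le> 1" for x
  proof -
    have "C * nrm A x \<le> \<bar>C\<bar> * 1"
      using that norm_nonneg[of x] by (intro mult_mono) auto
    then show ?thesis
      using C[of x] that by simp
  qed
  then show ?thesis
    by (intro bdd_aboveI[of _ "\<bar>C\<bar>"]) auto
qed

lemma norm_multiplier_nonneg:
  assumes "R \<in> carrier Mul"
  shows "0 \<le> nrm Mul R"
proof -
  have "nrm A (R \<zero>) \<le> nrm Mul R"
    unfolding multiplier_alg_def normed_alg.simps
    using norm_multiplier_bdd[OF assms] by (intro cSUP_upper) auto
  then show ?thesis
    by (simp add: multiplier_zero[OF assms])
qed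

lemma norm_multiplier:
  assumes "R \<in> carrier Mul" "x \<in> carrier A"
  shows "nrm A (R x) \<le> nrm Mul R * nrm A x"
proof (cases "x = \<zero>")
  case True
  then show ?thesis
    by (simp add: multiplier_zero[OF assms(1)])
next
  case False
  define r where "r = nrm A x"
  have r: "r > 0"
    using False norm_nonneg[of x] norm_eq_zero_iff[of x] assms(2) by (simp add: r_def less_le)
  define y where "y = complex_of_real (1 / r) \<odot> x"
  have y: "y \<in> carrier A" "nrm A y \<le> 1"
    using assms(2) r by (simp_all add: y_def norm_smult norm_divide flip: r_def)
  have "nrm A (R y) \<le> nrm Mul R"
    unfolding multiplier_alg_def normed_alg.simps
    using norm_multiplier_bdd[OF assms(1)] y by (intro cSUP_upper) auto
  moreover have "nrm A (R y) = nrm A (R x) / r"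
    using assms r by (simp add: y_def multiplier_smult norm_smult norm_divide)
  ultimately show ?thesis
    using r by (simp add: r_def pos_divide_le_eq)
qed

lemma norm_multiplier_le:
  assumes "R \<in> carrier Mul" "0 \<le> C"
    "\<And>x. x \<in> carrier A \<Longrightarrow> nrm A (R x) \<le> C * nrm A x"
  shows "nrm Mul R \<le> C"
proof -
  have "nrm A (R x) \<le> C" if "x \<in> carrier A" "nrm A x \<le> 1" for x
    using assms(3)[OF that(1)] mult_left_le[OF that(2) assms(2)] by simp
  moreover have "{x \<in> carrier A. nrm A x \<le> 1} \<noteq> {}"
    by (auto intro: exI[of _ \<zero>])
  ultimately show ?thesis
    unfolding multiplier_alg_def normed_alg.simps by (intro cSUP_least) auto
qed

end

context banach_algebra
begin

lemma multiplier_add_closed: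
  assumes "R \<in> carrier Mul" "S \<in> carrier Mul"
  shows "R \<oplus>\<^bsub>Mul\<^esub> S \<in> carrier Mul"
proof (rule multiplierI)
  show "R \<oplus>\<^bsub>Mul\<^esub> S \<in> carrier A \<rightarrow>\<^sub>E carrier A"
    using assms by (auto simp: multiplier_alg_def)
  show "nrm A ((R \<oplus>\<^bsub>Mul\<^esub> S) x)
      \<le> (nrm Mul R + nrm Mul S) * nrm A x" if "x \<in> carrier A" for x
    using norm_triangle[of "R x" "S x"] norm_multiplier[OF assms(1), of x]
      norm_multiplier[OF assms(2), of x] assms that
    by (simp add: multiplier_alg_apply distrib_right)
qed (use assms in \<open>simp_all add: multiplier_alg_apply multiplier_add multiplier_smult
      multiplier_mult scal_add_right distr_left M.a_ac\<close>)

lemma multiplier_smult_closed: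
  assumes "R \<in> carrier Mul"
  shows "c \<odot>\<^bsub>Mul\<^esub> R \<in> carrier Mul"
proof (rule multiplierI)
  show "c \<odot>\<^bsub>Mul\<^esub> R \<in> carrier A \<rightarrow>\<^sub>E carrier A"
    using assms by (auto simp: multiplier_alg_def)
  show "nrm A ((c \<odot>\<^bsub>Mul\<^esub> R) x) \<le> (cmod c * nrm Mul R) * nrm A x"
    if "x \<in> carrier A" for x
    using norm_multiplier[OF assms, of x] assms that
    by (simp add: multiplier_alg_apply norm_smult mult.assoc mult_left_mono)
qed (use assms in \<open>simp_all add: multiplier_alg_apply multiplier_add multiplier_smult
      multiplier_mult scal_add_right scal_scal smult_mult_left mult.commute\<close>)

lemma multiplier_comp_norm:
  assumes "R \<in> carrier Mul" "S \<in> carrier Mul" "x \<in> carrier A"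
  shows "nrm A (R (S x)) \<le> nrm Mul R * nrm Mul S * nrm A x"
proof -
  have "nrm A (R (S x)) \<le> nrm Mul R * nrm A (S x)"
    using assms by (intro norm_multiplier) auto
  also have "\<dots> \<le> nrm Mul R * (nrm Mul S * nrm A x)"
    using norm_multiplier[OF assms(2,3)] norm_multiplier_nonneg[OF assms(1)] by (rule mult_left_mono)
  finally show ?thesis
    by (simp add: mult.assoc)
qed

lemma multiplier_mult_closed:
  assumes "R \<in> carrier Mul" "S \<in> carrier Mul"
  shows "R \<otimes>\<^bsub>Mul\<^esub> S \<in> carrier Mul"
proof (rule multiplierI)
  show "R \<otimes>\<^bsub>Mul\<^esub> S \<in> carrier A \<rightarrow>\<^sub>E carrier A"
    using assms by (auto simp: multiplier_alg_def compose_def)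
  show "nrm A ((R \<otimes>\<^bsub>Mul\<^esub> S) x)
      \<le> nrm Mul R * nrm Mul S * nrm A x" if "x \<in> carrier A" for x
    using assms that by (simp add: multiplier_alg_apply multiplier_comp_norm)
qed (use assms in \<open>simp_all add: multiplier_alg_apply multiplier_add multiplier_smult multiplier_mult\<close>)

lemma multiplier_zero_closed: "\<zero>\<^bsub>Mul\<^esub> \<in> carrier Mul"
proof (rule multiplierI)
  show "\<zero>\<^bsub>Mul\<^esub> \<in> carrier A \<rightarrow>\<^sub>E carrier A"
    by (auto simp: multiplier_alg_def)
  show "nrm A (\<zero>\<^bsub>Mul\<^esub> x) \<le> 0 * nrm A x" if "x \<in> carrier A" for x
    using that by (simp add: multiplier_alg_apply)
qed (simp_all add: multiplier_alg_apply)

lemmas multiplier_alg_closed =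
  multiplier_add_closed multiplier_smult_closed multiplier_mult_closed multiplier_zero_closed

lemma multiplier_norm_mult:
  assumes "R \<in> carrier Mul" "S \<in> carrier Mul"
  shows "nrm Mul (R \<otimes>\<^bsub>Mul\<^esub> S)
    \<le> nrm Mul R * nrm Mul S"
  using assms by (intro norm_multiplier_le)
    (auto simp: multiplier_alg_apply multiplier_comp_norm norm_multiplier_nonneg multiplier_mult_closed)

lemma multiplier_normed_space: "normed_space Mul"
  unfolding normed_space_def normed_space_axioms_def
proof (intro conjI allI impI)
  note [simp] = multiplier_alg_apply
  note [intro] = multiplier_alg_closed
  have eq: "R = S \<longleftrightarrow> (\<forall>x\<in>carrier A. R x = S x)"
    if "R \<in> carrier Mul" "S \<in> carrier Mul" for R S
    using multiplier_eqI[OF that] by blast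
  show "module complex_ring Mul"
  proof (rule moduleI)
    show "cring complex_ring"
      by (rule cring_from_type_algebra)
    show "abelian_group Mul"
    proof (rule abelian_groupI)
      fix R assume R: "R \<in> carrier Mul"
      have "(-1) \<odot>\<^bsub>Mul\<^esub> R \<oplus>\<^bsub>Mul\<^esub> R = \<zero>\<^bsub>Mul\<^esub>"
        using R by (subst eq) (auto simp: scal_uminus_one M.l_neg)
      then show "\<exists>y\<in>carrier Mul.
          y \<oplus>\<^bsub>Mul\<^esub> R = \<zero>\<^bsub>Mul\<^esub>"
        using R by blast
    qed (auto simp: eq multiplier_alg_closed M.a_ac)
  qed (auto simp: eq multiplier_alg_closed ring_of_type_algebra_def scal_add_left scal_add_right
      scal_scal)
  fix R assume R: "R \<in> carrier Mul"
  show "0 \<le> nrm Mul R"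
    using R by (rule norm_multiplier_nonneg)
  show "nrm Mul R = 0 \<longleftrightarrow> R = \<zero>\<^bsub>Mul\<^esub>"
  proof
    assume 0: "nrm Mul R = 0"
    show "R = \<zero>\<^bsub>Mul\<^esub>"
    proof (rule multiplier_eqI[OF R multiplier_zero_closed])
      fix x assume x: "x \<in> carrier A"
      have "nrm A (R x) = 0"
        using norm_multiplier[OF R x] 0 norm_nonneg[of "R x"] R x by simp
      then show "R x = \<zero>\<^bsub>Mul\<^esub> x"
        using norm_eq_zero_iff[of "R x"] R x by simp
    qed
  next
    assume "R = \<zero>\<^bsub>Mul\<^esub>"
    then have "nrm Mul R \<le> 0"
      using R by (intro norm_multiplier_le) auto
    then show "nrm Mul R = 0"
      using norm_multiplier_nonneg[OF R] by simp
  qed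
  show "nrm Mul (c \<odot>\<^bsub>Mul\<^esub> R) = cmod c * nrm Mul R" for c
  proof -
    have le: "nrm Mul (c \<odot>\<^bsub>Mul\<^esub> S) \<le> cmod c * nrm Mul S"
      if S: "S \<in> carrier Mul" for S c
    proof (rule norm_multiplier_le)
      show "nrm A ((c \<odot>\<^bsub>Mul\<^esub> S) x) \<le> cmod c * nrm Mul S * nrm A x"
        if "x \<in> carrier A" for x
        using norm_multiplier[OF S that] S that
        by (simp add: norm_smult mult.assoc mult_left_mono)
    qed (use S in \<open>auto simp: norm_multiplier_nonneg\<close>)
    show ?thesis
    proof (cases "c = 0")
      case True
      then show ?thesis
        using le[OF R, of c] norm_multiplier_nonneg[of "c \<odot>\<^bsub>Mul\<^esub> R"]
          multiplier_smult_closed[OF R] by fastforce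
    next
      case False
      \<comment> \<open>The upper bound applied to the inverse scalar gives the reverse
        inequality.\<close>
      have "inverse c \<odot>\<^bsub>Mul\<^esub> (c \<odot>\<^bsub>Mul\<^esub> R) = R"
        using R False by (subst eq) (auto simp: scal_scal multiplier_alg_closed)
      then have "nrm Mul R
          \<le> cmod (inverse c) * nrm Mul (c \<odot>\<^bsub>Mul\<^esub> R)"
        using le[OF multiplier_smult_closed[OF R, of c], of "inverse c"] by simp
      then show ?thesis
        using le[OF R, of c] False
        by (simp add: norm_inverse inverse_eq_divide norm_divide pos_le_divide_eq mult.commute)
    qed
  qed
  fix S assume S: "S \<in> carrier Mul"
  show "nrm Mul (R \<oplus>\<^bsub>Mul\<^esub> S)
      \<le> nrm Mul R + nrm Mul S"
  proof (rule norm_multiplier_le)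
    show "nrm A ((R \<oplus>\<^bsub>Mul\<^esub> S) x)
        \<le> (nrm Mul R + nrm Mul S) * nrm A x" if "x \<in> carrier A" for x
      using norm_triangle[of "R x" "S x"] norm_multiplier[OF R that] norm_multiplier[OF S that] R S that
      by (simp add: distrib_right)
  qed (use R S in \<open>auto simp: norm_multiplier_nonneg\<close>)
qed

end

lemma (in banach_algebra) multiplier_minus_apply:
  assumes "R \<in> carrier Mul" "S \<in> carrier Mul" "x \<in> carrier A"
  shows "(R \<ominus>\<^bsub>Mul\<^esub> S) x = R x \<ominus> S x"
proof -
  interpret M: normed_space "Mul"
    by (rule multiplier_normed_space)
  show ?thesis
    using assms by (simp add: M.minus_alt minus_alt multiplier_alg_apply)
qed

section \<open>Completeness\<close>

context normed_space
begin

definition converges :: "(nat \<Rightarrow> 'a) \<Rightarrow> 'a \<Rightarrow> bool"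
  where "converges s l \<longleftrightarrow>
    (\<forall>n. s n \<in> carrier A) \<and> l \<in> carrier A \<and> (\<lambda>n. nrm A (s n \<ominus> l)) \<longlonglongrightarrow> 0"

lemma converges_closed: "converges s l \<Longrightarrow> s n \<in> carrier A" "converges s l \<Longrightarrow> l \<in> carrier A"
  by (simp_all add: converges_def)

lemma convergesI:
  assumes "\<And>n. s n \<in> carrier A" "l \<in> carrier A"
    "\<And>n. nrm A (s n \<ominus> l) \<le> r n" "r \<longlonglongrightarrow> 0"
  shows "converges s l"
proof -
  have "(\<lambda>n. nrm A (s n \<ominus> l)) \<longlonglongrightarrow> 0"
    using assms(4) by (rule Lim_null_comparison[rotated])
      (simp add: assms(1,2,3) norm_nonneg)
  then show ?thesis
    by (simp add: converges_def assms(1,2))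
qed

lemma converges_unique:
  assumes "converges s l" "converges s l'"
  shows "l = l'"
proof -
  have c: "s n \<in> carrier A" "l \<in> carrier A" "l' \<in> carrier A" for n
    using assms by (simp_all add: converges_def)
  have "(\<lambda>n. nrm A (s n \<ominus> l) + nrm A (s n \<ominus> l')) \<longlonglongrightarrow> 0 + 0"
    using assms unfolding converges_def by (intro tendsto_add) auto
  moreover have "nrm A (l \<ominus> l') \<le> nrm A (s n \<ominus> l) + nrm A (s n \<ominus> l')" for n
    using norm_minus_triangle[of l "s n" l'] norm_minus_commute[of l "s n"] c by simp
  ultimately have "nrm A (l \<ominus> l') \<le> 0"
    using LIMSEQ_le_const[of _ "0 + 0" "nrm A (l \<ominus> l')"] by auto
  then show ?thesis
    using norm_nonneg[of "l \<ominus> l'"] norm_eq_zero_iff[of "l \<ominus> l'"] c by (simp add: minus_eq_zero_iff)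
qed

lemma converges_add:
  assumes "converges s l" "converges p m"
  shows "converges (\<lambda>n. s n \<oplus> p n) (l \<oplus> m)"
proof (rule convergesI)
  have c: "s n \<in> carrier A" "l \<in> carrier A" "p n \<in> carrier A" "m \<in> carrier A" for n
    using assms by (simp_all add: converges_def)
  then show "nrm A (s n \<oplus> p n \<ominus> (l \<oplus> m)) \<le> nrm A (s n \<ominus> l) + nrm A (p n \<ominus> m)" for n
    by (simp add: add_minus_add norm_triangle)
  show "(\<lambda>n. nrm A (s n \<ominus> l) + nrm A (p n \<ominus> m)) \<longlonglongrightarrow> 0"
    using tendsto_add[of "\<lambda>n. nrm A (s n \<ominus> l)" 0 _ "\<lambda>n. nrm A (p n \<ominus> m)" 0] assms
    by (simp add: converges_def)
  show "s n \<oplus> p n \<in> carrier A" "l \<oplus> m \<in> carrier A" for n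
    using c by simp_all
qed

lemma converges_smult:
  assumes "converges s l"
  shows "converges (\<lambda>n. c \<odot> s n) (c \<odot> l)"
proof (rule convergesI)
  have c: "s n \<in> carrier A" "l \<in> carrier A" for n
    using assms by (simp_all add: converges_def)
  then show "nrm A (c \<odot> s n \<ominus> c \<odot> l) \<le> cmod c * nrm A (s n \<ominus> l)" for n
    by (simp add: norm_smult flip: scal_minus_right)
  show "(\<lambda>n. cmod c * nrm A (s n \<ominus> l)) \<longlonglongrightarrow> 0"
    using tendsto_mult_left[of "\<lambda>n. nrm A (s n \<ominus> l)" 0] assms
    by (auto simp: converges_def tendsto_mult_right_zero)
  show "c \<odot> s n \<in> carrier A" "c \<odot> l \<in> carrier A" for n
    using c by simp_all
qed

lemma converges_const: "x \<in> carrier A \<Longrightarrow> converges (\<lambda>n. x) x"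
  by (simp add: converges_def)

lemma converges_norm:
  assumes "converges s l"
  shows "(\<lambda>n. nrm A (s n)) \<longlonglongrightarrow> nrm A l"
proof -
  have c: "s n \<in> carrier A" "l \<in> carrier A" for n
    using assms by (simp_all add: converges_def)
  have "\<bar>nrm A (s n) - nrm A l\<bar> \<le> nrm A (s n \<ominus> l)" for n
    using norm_le_add_minus[of "s n" l] norm_le_add_minus[of l "s n"]
      norm_minus_commute[of l "s n"] c by simp
  then have "\<forall>\<^sub>F n in sequentially. norm (nrm A (s n) - nrm A l) \<le> nrm A (s n \<ominus> l)"
    by simp
  moreover have "(\<lambda>n. nrm A (s n \<ominus> l)) \<longlonglongrightarrow> 0"
    using assms by (simp add: converges_def)
  ultimately have "(\<lambda>n. nrm A (s n) - nrm A l) \<longlonglongrightarrow> 0"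
    by (rule Lim_null_comparison)
  then show ?thesis
    by (simp add: LIM_zero_iff)
qed

text \<open>Passes a Cauchy estimate to the limit in one of its two indices; completeness of the
  multiplier algebra and of the ideal both rest on this.\<close>

lemma converges_norm_minus_le:
  assumes "converges s l" "x \<in> carrier A" "\<forall>\<^sub>F n in sequentially. nrm A (x \<ominus> s n) \<le> C"
  shows "nrm A (x \<ominus> l) \<le> C"
proof -
  have "converges (\<lambda>n. x \<oplus> (-1) \<odot> s n) (x \<oplus> (-1) \<odot> l)"
    using assms by (intro converges_add converges_smult converges_const)
  then have "(\<lambda>n. nrm A (x \<ominus> s n)) \<longlonglongrightarrow> nrm A (x \<ominus> l)"
    using converges_norm[of "\<lambda>n. x \<oplus> (-1) \<odot> s n" "x \<oplus> (-1) \<odot> l"] assms(2) converges_closed[OF assms(1)]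
    by (simp add: minus_alt)
  then show ?thesis
    using assms(3) by (rule tendsto_upperbound) simp
qed

text \<open>Approximation is demanded only with \<open>\<le>\<close>, since that is what limits of
  Cauchy estimates give; halving \<open>e\<close> restores the strict inequality.\<close>

lemma completeI:
  assumes "\<And>s :: nat \<Rightarrow> 'a. \<lbrakk>\<And>n. s n \<in> carrier A;
      \<And>e. e > 0 \<Longrightarrow> \<exists>N. \<forall>m\<ge>N. \<forall>n\<ge>N. nrm A (s m \<ominus> s n) < e\<rbrakk>
      \<Longrightarrow> \<exists>l\<in>carrier A. \<forall>e>0. \<exists>N. \<forall>n\<ge>N. nrm A (s n \<ominus> l) \<le> e"
  shows "met.mcomplete"
  unfolding complete_iff
proof (intro allI impI)
  fix s :: "nat \<Rightarrow> 'a"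
  assume "(\<forall>n. s n \<in> carrier A) \<and> (\<forall>e>0. \<exists>N. \<forall>m\<ge>N. \<forall>n\<ge>N. nrm A (s m \<ominus> s n) < e)"
  then obtain l where l: "l \<in> carrier A" "\<And>e. e > 0 \<Longrightarrow> \<exists>N. \<forall>n\<ge>N. nrm A (s n \<ominus> l) \<le> e"
    using assms[of s] by auto
  have "\<exists>N. \<forall>n\<ge>N. nrm A (s n \<ominus> l) < e" if "e > 0" for e
  proof -
    obtain N where N: "\<forall>n\<ge>N. nrm A (s n \<ominus> l) \<le> e / 2"
      using l(2)[of "e / 2"] \<open>e > 0\<close> by auto
    have "nrm A (s n \<ominus> l) < e" if "n \<ge> N" for n
      using N[rule_format, OF that] \<open>e > 0\<close> by linarith
    then show ?thesis
      by blast
  qed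
  then show "\<exists>l\<in>carrier A. \<forall>e>0. \<exists>N. \<forall>n\<ge>N. nrm A (s n \<ominus> l) < e"
    using l(1) by blast
qed

end

context banach_algebra
begin

lemma Cauchy_converges:
  assumes "\<And>n. s n \<in> carrier A"
    "\<And>e. e > 0 \<Longrightarrow> \<exists>N. \<forall>m\<ge>N. \<forall>n\<ge>N. nrm A (s m \<ominus> s n) < e"
  obtains l where "converges s l"
proof -
  obtain l where l: "l \<in> carrier A" "\<forall>e>0. \<exists>N. \<forall>n\<ge>N. nrm A (s n \<ominus> l) < e"
    using complete[unfolded complete_iff, rule_format, of s] assms by blast
  then have "converges s l"
    using assms(1) by (auto simp: converges_def LIMSEQ_iff norm_nonneg)
  then show ?thesis
    using that by blast
qed

lemma converges_mult:
  assumes "converges s l" "converges p m"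
  shows "converges (\<lambda>n. s n \<otimes> p n) (l \<otimes> m)"
proof (rule convergesI)
  have c: "s n \<in> carrier A" "l \<in> carrier A" "p n \<in> carrier A" "m \<in> carrier A" for n
    using assms by (simp_all add: converges_def)
  show "nrm A (s n \<otimes> p n \<ominus> l \<otimes> m)
      \<le> nrm A (s n \<ominus> l) * nrm A (p n) + nrm A l * nrm A (p n \<ominus> m)" for n
    using norm_minus_triangle[of "s n \<otimes> p n" "l \<otimes> p n" "l \<otimes> m"] nrm_mult[of "s n \<ominus> l" "p n"]
      nrm_mult[of l "p n \<ominus> m"] c by (simp add: mult_minus_left mult_minus_right)
  have "(\<lambda>n. nrm A (s n \<ominus> l) * nrm A (p n) + nrm A l * nrm A (p n \<ominus> m))
      \<longlonglongrightarrow> 0 * nrm A m + nrm A l * 0"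
    using assms converges_norm[OF assms(2)] by (intro tendsto_intros) (auto simp: converges_def)
  then show "(\<lambda>n. nrm A (s n \<ominus> l) * nrm A (p n) + nrm A l * nrm A (p n \<ominus> m)) \<longlonglongrightarrow> 0"
    by simp
  show "s n \<otimes> p n \<in> carrier A" "l \<otimes> m \<in> carrier A" for n
    using c by simp_all
qed

lemma converges_multiplier:
  assumes "converges s l" "R \<in> carrier Mul"
  shows "converges (\<lambda>n. R (s n)) (R l)"
proof (rule convergesI)
  have c: "s n \<in> carrier A" "l \<in> carrier A" for n
    using assms by (simp_all add: converges_def)
  then show "nrm A (R (s n) \<ominus> R l) \<le> nrm Mul R * nrm A (s n \<ominus> l)" for n
    using assms(2) norm_multiplier[of R "s n \<ominus> l"] by (simp add: multiplier_minus)
  show "(\<lambda>n. nrm Mul R * nrm A (s n \<ominus> l)) \<longlonglongrightarrow> 0"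
    using assms by (auto simp: converges_def tendsto_mult_right_zero)
  show "R (s n) \<in> carrier A" "R l \<in> carrier A" for n
    using c assms(2) by simp_all
qed

text \<open>A Cauchy sequence in operator norm is Cauchy at every vector, so it has a pointwise
  limit, and the algebraic laws pass to that limit by uniqueness of limits. The Cauchy estimate
  passes to it with a bound proportional to \<open>nrm A x\<close>, which is convergence in operator
  norm.\<close>

theorem multiplier_banach_algebra: "banach_algebra Mul"
proof -
  interpret M: normed_space "Mul"
    by (rule multiplier_normed_space)
  note [simp] = multiplier_alg_apply
  note [intro, simp] = multiplier_alg_closed
  have eq: "R = S \<longleftrightarrow> (\<forall>x\<in>carrier A. R x = S x)"
    if "R \<in> carrier Mul" "S \<in> carrier Mul" for R S
    using multiplier_eqI[OF that] by blast
  have "M.met.mcomplete"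
  proof (rule M.completeI)
    fix s :: "nat \<Rightarrow> 'a \<Rightarrow> 'a"
    assume s: "\<And>n. s n \<in> carrier Mul"
      and Cauchy: "\<And>e. e > 0 \<Longrightarrow> \<exists>N. \<forall>m\<ge>N. \<forall>n\<ge>N.
        nrm Mul (s m \<ominus>\<^bsub>Mul\<^esub> s n) < e"
    have le: "nrm A (s m x \<ominus> s n x)
        \<le> nrm Mul (s m \<ominus>\<^bsub>Mul\<^esub> s n) * nrm A x"
      if "x \<in> carrier A" for m n x
      using norm_multiplier[of "s m \<ominus>\<^bsub>Mul\<^esub> s n" x] s that
      by (simp add: multiplier_minus_apply)
    have "\<exists>l. converges (\<lambda>n. s n x) l" if x: "x \<in> carrier A" for x
    proof -
      have "\<exists>N. \<forall>m\<ge>N. \<forall>n\<ge>N. nrm A (s m x \<ominus> s n x) < e" if e: "e > 0" for e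
      proof -
        obtain d where d: "d > 0" "\<And>r. \<lbrakk>0 \<le> r; r < d\<rbrakk> \<Longrightarrow> nrm A x * r < e"
          using ex_small_factor[OF e] by blast
        then obtain N where N: "\<And>m n. \<lbrakk>m \<ge> N; n \<ge> N\<rbrakk> \<Longrightarrow>
            nrm Mul (s m \<ominus>\<^bsub>Mul\<^esub> s n) < d"
          using Cauchy by meson
        have "nrm A (s m x \<ominus> s n x) < e" if "m \<ge> N" "n \<ge> N" for m n
          using le[OF x, of m n] d(2)[OF norm_multiplier_nonneg N[OF that]] s
          by (simp add: mult.commute)
        then show ?thesis
          by blast
      qed
      then show ?thesis
        using Cauchy_converges[of "\<lambda>n. s n x"] s x by (metis multiplier_closed)
    qed
    then obtain l where l: "\<And>x. x \<in> carrier A \<Longrightarrow> converges (\<lambda>n. s n x) (l x)"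
      by metis
    have close: "\<exists>N. \<forall>n\<ge>N. \<forall>x\<in>carrier A. nrm A (s n x \<ominus> l x) \<le> e * nrm A x" if "e > 0" for e
    proof -
      obtain N where N: "\<And>m n. \<lbrakk>m \<ge> N; n \<ge> N\<rbrakk> \<Longrightarrow>
          nrm Mul (s m \<ominus>\<^bsub>Mul\<^esub> s n) < e"
        using Cauchy \<open>e > 0\<close> by meson
      have "nrm A (s n x \<ominus> l x) \<le> e * nrm A x" if "n \<ge> N" "x \<in> carrier A" for n x
      proof (rule converges_norm_minus_le[OF l])
        show "\<forall>\<^sub>F m in sequentially. nrm A (s n x \<ominus> s m x) \<le> e * nrm A x"
          unfolding eventually_sequentially
        proof (intro exI allI impI)
          fix m assume "N \<le> m"
          then have "nrm Mul (s n \<ominus>\<^bsub>Mul\<^esub> s m) * nrm A x \<le> e * nrm A x"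
            using N[OF that(1), of m] norm_nonneg[OF that(2)] by (intro mult_right_mono) auto
          then show "nrm A (s n x \<ominus> s m x) \<le> e * nrm A x"
            using le[OF that(2), of n m] by simp
        qed
      qed (use that s in auto)
      then show ?thesis
        by blast
    qed
    define R where "R = restrict l (carrier A)"
    have lc: "l x \<in> carrier A" if "x \<in> carrier A" for x
      using l[OF that] by (rule converges_closed)
    have R: "R \<in> carrier Mul"
    proof -
      \<comment> \<open>One index at operator distance 1 bounds the limit by
        \<open>1 + nrm Mul (s N)\<close>.\<close>
      obtain N where N: "\<And>x. x \<in> carrier A \<Longrightarrow> nrm A (s N x \<ominus> l x) \<le> 1 * nrm A x"
        using close[of 1] by auto
      show ?thesis
      proof (rule multiplierI)
        show "R \<in> carrier A \<rightarrow>\<^sub>E carrier A"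
          using lc by (auto simp: R_def)
        fix x assume x: "x \<in> carrier A"
        show "nrm A (R x) \<le> (1 + nrm Mul (s N)) * nrm A x"
          using N[OF x] norm_le_add_minus[of "l x" "s N x"] norm_minus_commute[of "l x" "s N x"]
            norm_multiplier[OF s, of x N] lc[OF x] x s
          by (simp add: R_def distrib_right)
        show "R (c \<odot> x) = c \<odot> R x" for c
          using converges_unique[OF l[of "c \<odot> x"], of "c \<odot> l x"] converges_smult[OF l[OF x]] x s
          by (simp add: R_def multiplier_smult)
        fix y assume y: "y \<in> carrier A"
        show "R (x \<oplus> y) = R x \<oplus> R y"
          using converges_unique[OF l[of "x \<oplus> y"], of "l x \<oplus> l y"] converges_add[OF l[OF x] l[OF y]]
            x y s by (simp add: R_def multiplier_add)
        show "R (x \<otimes> y) = R x \<otimes> y"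
          using converges_unique[OF l[of "x \<otimes> y"], of "l x \<otimes> y"] converges_mult[OF l[OF x] converges_const[OF y]]
            x y s by (simp add: R_def multiplier_mult)
      qed
    qed
    have "\<exists>N. \<forall>n\<ge>N. nrm Mul (s n \<ominus>\<^bsub>Mul\<^esub> R) \<le> e" if "e > 0" for e
    proof -
      obtain N where N: "\<And>n x. \<lbrakk>n \<ge> N; x \<in> carrier A\<rbrakk> \<Longrightarrow> nrm A (s n x \<ominus> l x) \<le> e * nrm A x"
        using close[OF \<open>e > 0\<close>] by blast
      have "nrm Mul (s n \<ominus>\<^bsub>Mul\<^esub> R) \<le> e" if "n \<ge> N" for n
        using N[OF that] \<open>e > 0\<close> s R
        by (intro norm_multiplier_le) (auto simp: multiplier_minus_apply R_def)
      then show ?thesis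
        by blast
    qed
    then show "\<exists>l\<in>carrier Mul. \<forall>e>0. \<exists>N. \<forall>n\<ge>N.
        nrm Mul (s n \<ominus>\<^bsub>Mul\<^esub> l) \<le> e"
      using R by blast
  qed
  then show ?thesis
    by unfold_locales
      (auto simp: eq multiplier_norm_mult M.norm_nonneg M.norm_eq_zero_iff M.norm_triangle
        M.norm_smult multiplier_add multiplier_smult)
qed

lemma in_closure_sequentially:
  assumes "S \<subseteq> carrier A"
  shows "x \<in> norm_top A closure_of S \<longleftrightarrow> (\<exists>s. range s \<subseteq> S \<and> converges s x)"
proof
  assume "x \<in> norm_top A closure_of S"
  then have x: "x \<in> carrier A" "\<And>e. e > 0 \<Longrightarrow> \<exists>y\<in>S. nrm A (x \<ominus> y) < e"
    using in_closure_iff[OF assms] by auto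
  have "\<forall>n. \<exists>y. y \<in> S \<and> nrm A (x \<ominus> y) < 1 / real (Suc n)"
    using x(2) by (simp add: Bex_def)
  then obtain s where s: "\<And>n. s n \<in> S" "\<And>n. nrm A (x \<ominus> s n) < 1 / real (Suc n)"
    by metis
  have "converges s x"
  proof (rule convergesI)
    show "nrm A (s n \<ominus> x) \<le> 1 / real (Suc n)" for n
      using s[of n] x(1) assms norm_minus_commute[of "s n" x] by auto
    show "(\<lambda>n. 1 / real (Suc n)) \<longlonglongrightarrow> 0"
      by (rule LIMSEQ_inverse_real_of_nat[unfolded inverse_eq_divide])
  qed (use s(1) x(1) assms in auto)
  then show "\<exists>s. range s \<subseteq> S \<and> converges s x"
    using s(1) by blast
next
  assume "\<exists>s. range s \<subseteq> S \<and> converges s x"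
  then obtain s where s: "range s \<subseteq> S" "converges s x"
    by blast
  have "\<exists>y\<in>S. nrm A (x \<ominus> y) < e" if e: "e > 0" for e
  proof -
    have "\<forall>\<^sub>F n in sequentially. nrm A (s n \<ominus> x) < e"
      using s(2) e by (auto simp: converges_def intro: order_tendstoD(2))
    then obtain n where "nrm A (s n \<ominus> x) < e"
      by (auto simp: eventually_sequentially)
    then show ?thesis
      using s converges_closed[OF s(2)] norm_minus_commute[of "s n" x] by (intro bexI[of _ "s n"]) auto
  qed
  then show "x \<in> norm_top A closure_of S"
    using in_closure_iff[OF assms] converges_closed[OF s(2)] by blast
qed

text \<open>The operations are sequentially continuous, so they do not leave the closure;
  completeness is inherited because limits of sequences in the closure stay there.\<close>

lemma closure_banach_algebra:
  assumes "S \<subseteq> carrier A" "\<zero> \<in> S" "\<And>x y. \<lbrakk>x \<in> S; y \<in> S\<rbrakk> \<Longrightarrow> x \<oplus> y \<in> S"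
    "\<And>c x. x \<in> S \<Longrightarrow> c \<odot> x \<in> S" "\<And>x y. \<lbrakk>x \<in> S; y \<in> S\<rbrakk> \<Longrightarrow> x \<otimes> y \<in> S"
  shows "banach_algebra (A\<lparr>carrier := norm_top A closure_of S\<rparr>)"
proof -
  define C where "C = norm_top A closure_of S"
  have C: "C \<subseteq> carrier A"
    using closure_of_subset_topspace[of "norm_top A" S] by (simp add: C_def)
  have SC: "S \<subseteq> C"
    using assms(1) closure_of_subset[of S "norm_top A"] by (simp add: C_def)
  have Cclosed: "x \<in> C" if "range s \<subseteq> C" "converges s x" for s x
    using that in_closure_sequentially[OF C, of x] closure_of_closure_of[of "norm_top A" S]
    by (auto simp: C_def)
  have C_seq: "\<exists>s. range s \<subseteq> S \<and> converges s x" if "x \<in> C" for x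
    using that in_closure_sequentially[OF assms(1)] by (simp add: C_def)
  have C_lim: "x \<in> C" if "range s \<subseteq> S" "converges s x" for s x
    using that SC by (intro Cclosed[of s]) auto
  have add: "x \<oplus> y \<in> C" if xy: "x \<in> C" "y \<in> C" for x y
  proof -
    obtain s p where sp: "range s \<subseteq> S" "converges s x" "range p \<subseteq> S" "converges p y"
      using C_seq[OF xy(1)] C_seq[OF xy(2)] by auto
    show ?thesis
      by (rule C_lim[OF _ converges_add[OF sp(2,4)]]) (use sp(1,3) assms(3) in auto)
  qed
  have smult: "c \<odot> x \<in> C" if x: "x \<in> C" for c x
  proof -
    obtain s where s: "range s \<subseteq> S" "converges s x"
      using C_seq[OF x] by auto
    show ?thesis
      by (rule C_lim[OF _ converges_smult[OF s(2)]]) (use s(1) assms(4) in auto)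
  qed
  have mult: "x \<otimes> y \<in> C" if xy: "x \<in> C" "y \<in> C" for x y
  proof -
    obtain s p where sp: "range s \<subseteq> S" "converges s x" "range p \<subseteq> S" "converges p y"
      using C_seq[OF xy(1)] C_seq[OF xy(2)] by auto
    show ?thesis
      by (rule C_lim[OF _ converges_mult[OF sp(2,4)]]) (use sp(1,3) assms(5) in auto)
  qed
  interpret C: normed_space "A\<lparr>carrier := C\<rparr>"
    using C SC assms(2) add smult by (intro subspace_normed_space) auto
  have minus: "x \<ominus>\<^bsub>A\<lparr>carrier := C\<rparr>\<^esub> y = x \<ominus> y" if "x \<in> C" "y \<in> C" for x y
    using that C C.minus_alt[of x y] by (simp add: subset_iff minus_alt)
  have "C.met.mcomplete"
  proof (rule C.completeI)
    fix s :: "nat \<Rightarrow> 'a"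
    assume s: "\<And>n. s n \<in> carrier (A\<lparr>carrier := C\<rparr>)"
      and Cauchy: "\<And>e. e > 0 \<Longrightarrow> \<exists>N. \<forall>m\<ge>N. \<forall>n\<ge>N.
        nrm (A\<lparr>carrier := C\<rparr>) (s m \<ominus>\<^bsub>A\<lparr>carrier := C\<rparr>\<^esub> s n) < e"
    have sC: "s n \<in> C" for n
      using s[of n] by simp
    have "\<exists>N. \<forall>m\<ge>N. \<forall>n\<ge>N. nrm A (s m \<ominus> s n) < e" if "e > 0" for e
      using Cauchy[OF that] by (simp add: minus[OF sC sC])
    then obtain l where l: "converges s l"
      using Cauchy_converges[of s] sC C by blast
    then have lc: "l \<in> carrier A" and lim: "\<And>e. e > 0 \<Longrightarrow> \<exists>N. \<forall>n\<ge>N. nrm A (s n \<ominus> l) \<le> e"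
      using sC C by (auto simp: converges_def LIMSEQ_iff norm_nonneg subset_iff) (meson less_imp_le)
    have "l \<in> C"
      using sC l by (intro Cclosed[of s]) auto
    then show "\<exists>l\<in>carrier (A\<lparr>carrier := C\<rparr>). \<forall>e>0. \<exists>N. \<forall>n\<ge>N.
        nrm (A\<lparr>carrier := C\<rparr>) (s n \<ominus>\<^bsub>A\<lparr>carrier := C\<rparr>\<^esub> l) \<le> e"
      using lim by (auto simp: minus sC)
  qed
  moreover have "x \<in> C \<Longrightarrow> x \<in> carrier A" for x
    using C by auto
  ultimately have "banach_algebra (A\<lparr>carrier := C\<rparr>)"
    by unfold_locales (auto simp: mult mult_assoc distr_left distr_right smult_mult_left
        smult_mult_right nrm_nonneg nrm_eq_zero_iff nrm_triangle nrm_smult nrm_mult)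
  then show ?thesis
    by (simp add: C_def)
qed

end

section \<open>Commutation of multipliers\<close>

lemma (in weakly_cancellative_algebra) multiplier_mult_left:
  assumes "R \<in> carrier Mul" "x \<in> carrier A" "y \<in> carrier A"
  shows "R (x \<otimes> y) = x \<otimes> R y"
proof -
  have "R (x \<otimes> y) = R y \<otimes> x"
    using assms by (metis mult_comm multiplier_mult)
  then show ?thesis
    using assms mult_comm[of "R y" x] by simp
qed

lemma (in weakly_cancellative_algebra) annihilator_trivial:
  assumes "x \<in> carrier A" "\<And>y. y \<in> carrier A \<Longrightarrow> x \<otimes> y = \<zero>"
  shows "x = \<zero>"
proof (rule mult_eq_zero_dense[OF assms(1)])
  show "dense_in A (carrier A)"
    unfolding dense_in_iff using minus_self norm_zero by (auto intro!: bexI)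
qed (use assms in auto)

text \<open>A multiplier can be moved to either factor of a product, so
  \<open>R (S x) \<otimes> y\<close> and \<open>S (R x) \<otimes> y\<close> both equal
  \<open>R x \<otimes> S y\<close>; the trivial annihilator removes \<open>y\<close>.\<close>

lemma (in weakly_cancellative_algebra) multiplier_commute:
  assumes "R \<in> carrier Mul" "S \<in> carrier Mul" "x \<in> carrier A"
  shows "R (S x) = S (R x)"
proof -
  have "(R (S x) \<ominus> S (R x)) \<otimes> y = \<zero>" if y: "y \<in> carrier A" for y
  proof -
    have "S x \<otimes> y = x \<otimes> S y"
      using assms y multiplier_mult[of S x y] multiplier_mult_left[of S x y] by simp
    then have "R (S x) \<otimes> y = R x \<otimes> S y"
      using assms y multiplier_mult[of R "S x" y] multiplier_mult[of R x "S y"] by simp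
    moreover have "S (R x) \<otimes> y = R x \<otimes> S y"
      using assms y multiplier_mult[of S "R x" y] multiplier_mult_left[of S "R x" y] by simp
    ultimately show ?thesis
      using assms y by (simp add: mult_minus_left)
  qed
  then have "R (S x) \<ominus> S (R x) = \<zero>"
    using assms by (intro annihilator_trivial[of "R (S x) \<ominus> S (R x)"] M.minus_closed) auto
  then show ?thesis
    using assms by (simp add: minus_eq_zero_iff)
qed

section \<open>Quasimultipliers\<close>

context weakly_cancellative_algebra
begin

text \<open>With the graph described by an equation, later arguments do not meet the definite
  description in \<open>quot_op\<close>.\<close>

lemma quot_op_eq_Some_iff:
  assumes "v \<in> Omega A"
  shows "quot_op A u v x = Some y \<longleftrightarrow> x \<in> carrier A \<and> y \<in> carrier A \<and> v \<otimes> y = u \<otimes> x"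
proof -
  have the: "(THE z. z \<in> carrier A \<and> v \<otimes> z = u \<otimes> x) = y" if "y \<in> carrier A" "v \<otimes> y = u \<otimes> x" for y
    using that Omega_cancel[OF assms] by (intro the_equality) auto
  show ?thesis
  proof
    assume *: "quot_op A u v x = Some y"
    then have x: "x \<in> carrier A" and "u \<otimes> x \<in> (\<lambda>y. v \<otimes> y) ` carrier A"
      by (auto simp: quot_op_def split: if_splits)
    then obtain z where z: "z \<in> carrier A" "v \<otimes> z = u \<otimes> x"
      by auto
    have "y = z"
      using * the[OF z] by (auto simp: quot_op_def split: if_splits)
    then show "x \<in> carrier A \<and> y \<in> carrier A \<and> v \<otimes> y = u \<otimes> x"
      using x z by simp
  next
    assume *: "x \<in> carrier A \<and> y \<in> carrier A \<and> v \<otimes> y = u \<otimes> x"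
    then have "u \<otimes> x \<in> (\<lambda>y. v \<otimes> y) ` carrier A"
      by (metis imageI)
    then show "quot_op A u v x = Some y"
      using * the[of y] by (simp add: quot_op_def)
  qed
qed

lemma quot_op_eqI:
  assumes "v \<in> Omega A" "\<And>x y. S x = Some y \<longleftrightarrow> x \<in> carrier A \<and> y \<in> carrier A \<and> v \<otimes> y = u \<otimes> x"
  shows "S = quot_op A u v"
proof
  show "S x = quot_op A u v x" for x
    using quot_op_eq_Some_iff[OF assms(1), of u x] assms(2)[of x] by (metis not_None_eq)
qed

text \<open>Evaluation at \<open>v\<close> recovers the numerator, which gives the cross-multiplied
  equation. Conversely the equation of one graph, multiplied by \<open>v'\<close>, becomes that of
  the other after cancelling \<open>v\<close>.\<close>

lemma quot_op_eq_iff: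
  assumes "u \<in> carrier A" "v \<in> Omega A" "u' \<in> carrier A" "v' \<in> Omega A"
  shows "quot_op A u v = quot_op A u' v' \<longleftrightarrow> u \<otimes> v' = u' \<otimes> v"
proof
  have v: "v \<in> carrier A" "v' \<in> carrier A"
    using assms by (simp_all add: Omega_def)
  {
    assume "quot_op A u v = quot_op A u' v'"
    moreover have "quot_op A u v v = Some u"
      using assms v by (simp add: quot_op_eq_Some_iff mult_comm)
    ultimately have "quot_op A u' v' v = Some u"
      by simp
    then show "u \<otimes> v' = u' \<otimes> v"
      using assms v by (simp add: quot_op_eq_Some_iff mult_comm)
  next
    assume eq: "u \<otimes> v' = u' \<otimes> v"
    show "quot_op A u v = quot_op A u' v'"
    proof (rule quot_op_eqI[OF assms(4)])
      fix x y
      have "v \<otimes> y = u \<otimes> x \<longleftrightarrow> v' \<otimes> y = u' \<otimes> x" if xy: "x \<in> carrier A" "y \<in> carrier A"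
      proof -
        have "v \<otimes> y = u \<otimes> x \<longleftrightarrow> v' \<otimes> (v \<otimes> y) = v' \<otimes> (u \<otimes> x)"
          using Omega_cancel[OF assms(4)] xy v assms by (metis mult_closed)
        also have "v' \<otimes> (u \<otimes> x) = v \<otimes> (u' \<otimes> x)"
          using eq xy v assms by (metis mult_assoc mult_comm)
        also have "v' \<otimes> (v \<otimes> y) = v \<otimes> (u' \<otimes> x) \<longleftrightarrow> v' \<otimes> y = u' \<otimes> x"
          using Omega_cancel[OF assms(2)] xy v assms mult_lcomm[of v' v y] by (metis mult_closed)
        finally show ?thesis .
      qed
      then show "quot_op A u v x = Some y \<longleftrightarrow> x \<in> carrier A \<and> y \<in> carrier A \<and> v' \<otimes> y = u' \<otimes> x"
        using quot_op_eq_Some_iff[OF assms(2), of u x y] by auto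
    qed
  }
qed

lemma QM_carrier: "carrier (QM A) = {quot_op A u v | u v. u \<in> carrier A \<and> v \<in> Omega A}"
  by (simp add: QM_def)

lemma quot_op_in_QM [intro]: "\<lbrakk>u \<in> carrier A; v \<in> Omega A\<rbrakk> \<Longrightarrow> quot_op A u v \<in> carrier (QM A)"
  by (auto simp: QM_carrier)

lemma QM_carrierE:
  assumes "S \<in> carrier (QM A)"
  obtains u v where "u \<in> carrier A" "v \<in> Omega A" "S = quot_op A u v"
  using assms by (auto simp: QM_carrier)

lemma represents_quot_op_iff:
  assumes "u \<in> carrier A" "v \<in> Omega A"
  shows "represents A u' v' (quot_op A u v) \<longleftrightarrow>
    u' \<in> carrier A \<and> v' \<in> Omega A \<and> u \<otimes> v' = u' \<otimes> v"
  using quot_op_eq_iff[OF assms, of u' v'] by (auto simp: represents_def)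

text \<open>The definite description in \<open>QM\<close> is resolved by independence of the
  representatives: multiply the two cross-multiplied equations. The sum and the scalar multiple
  below are treated alike.\<close>

lemma QM_mult_quot_op:
  assumes "u \<in> carrier A" "v \<in> Omega A" "u' \<in> carrier A" "v' \<in> Omega A"
  shows "quot_op A u v \<otimes>\<^bsub>QM A\<^esub> quot_op A u' v' = quot_op A (u \<otimes> u') (v \<otimes> v')"
  unfolding QM_def monoid.simps
proof (rule the_equality)
  show "\<exists>p q p' q'. represents A p q (quot_op A u v) \<and> represents A p' q' (quot_op A u' v') \<and>
      quot_op A (u \<otimes> u') (v \<otimes> v') = quot_op A (p \<otimes> p') (q \<otimes> q')"
    using assms by (auto simp: represents_def)
  fix R
  assume "\<exists>p q p' q'. represents A p q (quot_op A u v) \<and> represents A p' q' (quot_op A u' v') \<and>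
      R = quot_op A (p \<otimes> p') (q \<otimes> q')"
  then obtain p q p' q' where pq: "p \<in> carrier A" "q \<in> Omega A" "u \<otimes> q = p \<otimes> v"
      "p' \<in> carrier A" "q' \<in> Omega A" "u' \<otimes> q' = p' \<otimes> v'"
    and R: "R = quot_op A (p \<otimes> p') (q \<otimes> q')"
    using assms by (auto simp: represents_quot_op_iff)
  have c: "v \<in> carrier A" "v' \<in> carrier A" "q \<in> carrier A" "q' \<in> carrier A"
    using assms pq by (simp_all add: Omega_carrier)
  have "(p \<otimes> p') \<otimes> (v \<otimes> v') = (p \<otimes> v) \<otimes> (p' \<otimes> v')"
    using pq(1,2,4,5) assms c by (simp add: mult_assoc mult_lcomm)
  also have "\<dots> = (u \<otimes> q) \<otimes> (u' \<otimes> q')"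
    using pq by simp
  also have "\<dots> = (u \<otimes> u') \<otimes> (q \<otimes> q')"
    using pq(1,2,4,5) assms c by (simp add: mult_assoc mult_lcomm)
  finally show "R = quot_op A (u \<otimes> u') (v \<otimes> v')"
    unfolding R using pq assms by (subst quot_op_eq_iff) (auto simp: Omega_mult)
qed

lemma QM_add_quot_op:
  assumes "u \<in> carrier A" "v \<in> Omega A" "u' \<in> carrier A" "v' \<in> Omega A"
  shows "quot_op A u v \<oplus>\<^bsub>QM A\<^esub> quot_op A u' v' =
    quot_op A (u \<otimes> v' \<oplus> u' \<otimes> v) (v \<otimes> v')"
  unfolding QM_def ring.simps
proof (rule the_equality)
  show "\<exists>p q p' q'. represents A p q (quot_op A u v) \<and> represents A p' q' (quot_op A u' v') \<and>
      quot_op A (u \<otimes> v' \<oplus> u' \<otimes> v) (v \<otimes> v') = quot_op A (p \<otimes> q' \<oplus> p' \<otimes> q) (q \<otimes> q')"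
    using assms by (auto simp: represents_def)
  fix R
  assume "\<exists>p q p' q'. represents A p q (quot_op A u v) \<and> represents A p' q' (quot_op A u' v') \<and>
      R = quot_op A (p \<otimes> q' \<oplus> p' \<otimes> q) (q \<otimes> q')"
  then obtain p q p' q' where pq: "p \<in> carrier A" "q \<in> Omega A" "u \<otimes> q = p \<otimes> v"
      "p' \<in> carrier A" "q' \<in> Omega A" "u' \<otimes> q' = p' \<otimes> v'"
    and R: "R = quot_op A (p \<otimes> q' \<oplus> p' \<otimes> q) (q \<otimes> q')"
    using assms by (auto simp: represents_quot_op_iff)
  have c: "v \<in> carrier A" "v' \<in> carrier A" "q \<in> carrier A" "q' \<in> carrier A"
    using assms pq by (simp_all add: Omega_carrier)
  have "(p \<otimes> q' \<oplus> p' \<otimes> q) \<otimes> (v \<otimes> v') = (p \<otimes> v) \<otimes> (q' \<otimes> v') \<oplus> (p' \<otimes> v') \<otimes> (q \<otimes> v)"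
    using pq(1,2,4,5) assms c by (simp add: distr_left distr_right mult_assoc mult_lcomm mult_comm)
  also have "\<dots> = (u \<otimes> q) \<otimes> (q' \<otimes> v') \<oplus> (u' \<otimes> q') \<otimes> (q \<otimes> v)"
    using pq by simp
  also have "\<dots> = (u \<otimes> v' \<oplus> u' \<otimes> v) \<otimes> (q \<otimes> q')"
    using pq(1,2,4,5) assms c by (simp add: distr_left distr_right mult_assoc mult_lcomm mult_comm)
  finally show "R = quot_op A (u \<otimes> v' \<oplus> u' \<otimes> v) (v \<otimes> v')"
    unfolding R using pq assms c by (subst quot_op_eq_iff) (auto simp: Omega_mult)
qed

lemma QM_smult_quot_op:
  assumes "u \<in> carrier A" "v \<in> Omega A"
  shows "c \<odot>\<^bsub>QM A\<^esub> quot_op A u v = quot_op A (c \<odot> u) v"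
  unfolding QM_def module.simps
proof (rule the_equality)
  show "\<exists>p q. represents A p q (quot_op A u v) \<and> quot_op A (c \<odot> u) v = quot_op A (c \<odot> p) q"
    using assms by (auto simp: represents_def)
  fix R
  assume "\<exists>p q. represents A p q (quot_op A u v) \<and> R = quot_op A (c \<odot> p) q"
  then obtain p q where pq: "p \<in> carrier A" "q \<in> Omega A" "u \<otimes> q = p \<otimes> v"
    and R: "R = quot_op A (c \<odot> p) q"
    using assms by (auto simp: represents_quot_op_iff)
  have c: "v \<in> carrier A" "q \<in> carrier A"
    using assms pq by (simp_all add: Omega_carrier)
  show "R = quot_op A (c \<odot> u) v"
    unfolding R using pq assms c by (subst quot_op_eq_iff) (auto simp: smult_mult_left)
qed

lemma QM_one:
  assumes "v \<in> Omega A"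
  shows "\<one>\<^bsub>QM A\<^esub> = quot_op A v v"
proof (rule quot_op_eqI[OF assms])
  show "\<one>\<^bsub>QM A\<^esub> x = Some y \<longleftrightarrow> x \<in> carrier A \<and> y \<in> carrier A \<and> v \<otimes> y = v \<otimes> x" for x y
    using Omega_cancel[OF assms, of y x] by (auto simp: QM_def)
qed

text \<open>Since \<open>R v \<otimes> x = v \<otimes> R x\<close> and \<open>v\<close> can be
  cancelled, the graph of \<open>R\<close> is the solution set of
  \<open>v \<otimes> y = R v \<otimes> x\<close>. Any element of \<open>Omega A\<close> can thus
  serve as denominator of a multiplier.\<close>

lemma mult_to_QM_eq_quot_op:
  assumes "R \<in> carrier Mul" "v \<in> Omega A"
  shows "mult_to_QM A R = quot_op A (R v) v"
proof (rule quot_op_eqI[OF assms(2)])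
  fix x y
  have v: "v \<in> carrier A"
    using assms(2) by (rule Omega_carrier)
  have "R v \<otimes> x = v \<otimes> R x" if "x \<in> carrier A"
    using multiplier_mult[OF assms(1) v that] multiplier_mult_left[OF assms(1) v that] by simp
  then show "mult_to_QM A R x = Some y \<longleftrightarrow> x \<in> carrier A \<and> y \<in> carrier A \<and> v \<otimes> y = R v \<otimes> x"
    using Omega_cancel[OF assms(2), of y "R x"] assms(1) by (auto simp: mult_to_QM_def)
qed

end

text \<open>\<open>\<theta>\<close> is the map \<open>b \<mapsto> \<Phi>\<^sup>-\<^sup>1 (\<Phi> w \<otimes> b)\<close>; its boundedness is what makes
  the inverse of the induced map of quasimultipliers pseudobounded.\<close>

locale bounded_QM_homomorphism =
  A: weakly_cancellative_algebra A + B: weakly_cancellative_algebra B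
  for A :: "'a normed_alg" (structure) and B :: "'b normed_alg" +
  fixes \<Phi> :: "'a \<Rightarrow> 'b" and w :: 'a and \<theta> :: "'b \<Rightarrow> 'a" and K :: real
  assumes hom_closed [simp, intro]: "x \<in> carrier A \<Longrightarrow> \<Phi> x \<in> carrier B"
    and hom_add: "\<lbrakk>x \<in> carrier A; y \<in> carrier A\<rbrakk> \<Longrightarrow> \<Phi> (x \<oplus> y) = \<Phi> x \<oplus>\<^bsub>B\<^esub> \<Phi> y"
    and hom_mult: "\<lbrakk>x \<in> carrier A; y \<in> carrier A\<rbrakk> \<Longrightarrow> \<Phi> (x \<otimes> y) = \<Phi> x \<otimes>\<^bsub>B\<^esub> \<Phi> y"
    and hom_smult: "x \<in> carrier A \<Longrightarrow> \<Phi> (c \<odot> x) = c \<odot>\<^bsub>B\<^esub> \<Phi> x"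
    and hom_norm: "x \<in> carrier A \<Longrightarrow> nrm B (\<Phi> x) \<le> nrm A x"
    and hom_inj: "inj_on \<Phi> (carrier A)"
    and hom_dense: "\<lbrakk>b \<in> carrier B; e > 0\<rbrakk> \<Longrightarrow> \<exists>x\<in>carrier A. nrm B (b \<ominus>\<^bsub>B\<^esub> \<Phi> x) < e"
    and w_Omega: "w \<in> Omega A"
    and theta_closed [simp, intro]: "b \<in> carrier B \<Longrightarrow> \<theta> b \<in> carrier A"
    and hom_theta: "b \<in> carrier B \<Longrightarrow> \<Phi> (\<theta> b) = \<Phi> w \<otimes>\<^bsub>B\<^esub> b"
    and theta_norm: "b \<in> carrier B \<Longrightarrow> nrm A (\<theta> b) \<le> K * nrm B b"
    and K_pos: "K > 0"
begin

lemma w_closed [simp, intro]: "w \<in> carrier A"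
  using w_Omega by (rule A.Omega_carrier)

lemma hom_eq_iff: "\<lbrakk>x \<in> carrier A; y \<in> carrier A\<rbrakk> \<Longrightarrow> \<Phi> x = \<Phi> y \<longleftrightarrow> x = y"
  using hom_inj by (auto simp: inj_on_def)

lemma hom_minus:
  "\<lbrakk>x \<in> carrier A; y \<in> carrier A\<rbrakk> \<Longrightarrow> \<Phi> (x \<ominus> y) = \<Phi> x \<ominus>\<^bsub>B\<^esub> \<Phi> y"
  by (simp add: A.minus_alt B.minus_alt hom_add hom_smult)

text \<open>This and the next identities for \<open>\<theta>\<close> are tested after applying the
  injective \<open>\<Phi>\<close>, which turns \<open>\<theta>\<close> into multiplication by
  \<open>\<Phi> w\<close>.\<close>

lemma theta_minus:
  "\<lbrakk>a \<in> carrier B; b \<in> carrier B\<rbrakk> \<Longrightarrow> \<theta> (a \<ominus>\<^bsub>B\<^esub> b) = \<theta> a \<ominus> \<theta> b"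
  by (subst hom_eq_iff[symmetric]) (auto simp: hom_minus hom_theta B.mult_minus_right)

lemma theta_hom: "x \<in> carrier A \<Longrightarrow> \<theta> (\<Phi> x) = w \<otimes> x"
  by (subst hom_eq_iff[symmetric]) (auto simp: hom_mult hom_theta)

lemma theta_mult_hom:
  "\<lbrakk>b \<in> carrier B; x \<in> carrier A\<rbrakk> \<Longrightarrow> \<theta> (b \<otimes>\<^bsub>B\<^esub> \<Phi> x) = \<theta> b \<otimes> x"
  by (subst hom_eq_iff[symmetric]) (auto simp: hom_mult hom_theta B.mult_assoc)

text \<open>\<open>\<Phi>\<close> is contractive with dense range, so an element of \<open>B\<close>
  is first replaced by some \<open>\<Phi> x\<close>, and then \<open>x\<close> is approximated
  inside \<open>A\<close>.\<close>

lemma hom_Omega: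
  assumes "v \<in> Omega A"
  shows "\<Phi> v \<in> Omega B"
  unfolding B.Omega_iff
proof (intro conjI ballI allI impI)
  have v: "v \<in> carrier A"
    using assms by (rule A.Omega_carrier)
  then show "\<Phi> v \<in> carrier B"
    by simp
  fix b and e :: real assume b: "b \<in> carrier B" and e: "e > 0"
  obtain x where x: "x \<in> carrier A" "nrm B (b \<ominus>\<^bsub>B\<^esub> \<Phi> x) < e / 2"
    using hom_dense[OF b, of "e / 2"] e by auto
  obtain y where y: "y \<in> carrier A" "nrm A (x \<ominus> v \<otimes> y) < e / 2"
    using assms x(1) e unfolding A.Omega_iff by (meson half_gt_zero)
  have "nrm B (\<Phi> x \<ominus>\<^bsub>B\<^esub> \<Phi> v \<otimes>\<^bsub>B\<^esub> \<Phi> y) \<le> nrm A (x \<ominus> v \<otimes> y)"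
    using hom_norm[of "x \<ominus> v \<otimes> y"] x y v by (simp add: hom_minus hom_mult)
  then have "nrm B (b \<ominus>\<^bsub>B\<^esub> \<Phi> v \<otimes>\<^bsub>B\<^esub> \<Phi> y) < e"
    using B.norm_minus_triangle[of b "\<Phi> x" "\<Phi> v \<otimes>\<^bsub>B\<^esub> \<Phi> y"] x y v b by simp
  then show "\<exists>y\<in>carrier B. nrm B (b \<ominus>\<^bsub>B\<^esub> \<Phi> v \<otimes>\<^bsub>B\<^esub> y) < e"
    using y(1) by blast
qed

text \<open>The approximation makes a detour through \<open>B\<close>: \<open>x\<close> is near
  \<open>w \<otimes> y\<close>, the image of \<open>y\<close> is near a multiple of \<open>q\<close>
  by some \<open>b\<close>, and \<open>b\<close> is near some \<open>\<Phi> a\<close>. Then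
  \<open>\<theta>\<close> leads back, as it sends \<open>\<Phi> y\<close> to
  \<open>w \<otimes> y\<close> and the product of \<open>q\<close> and \<open>\<Phi> a\<close> to
  \<open>\<theta> q \<otimes> a\<close>, at the cost of the factor \<open>K\<close>.\<close>

lemma theta_Omega:
  assumes "q \<in> Omega B"
  shows "\<theta> q \<in> Omega A"
  unfolding A.Omega_iff
proof (intro conjI ballI allI impI)
  have q: "q \<in> carrier B"
    using assms by (rule B.Omega_carrier)
  then show "\<theta> q \<in> carrier A"
    by simp
  fix x and e :: real assume x: "x \<in> carrier A" and e: "e > 0"
  obtain y where y: "y \<in> carrier A" "nrm A (x \<ominus> w \<otimes> y) < e / 2"
    using w_Omega x e unfolding A.Omega_iff by (meson half_gt_zero)
  \<comment> \<open>Two errors of size \<open>d\<close> arise in \<open>B\<close>, and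
    \<open>\<theta>\<close> multiplies them by \<open>K\<close>; together they use up
    \<open>e / 2\<close>.\<close>
  define d where "d = e / (4 * K)"
  have d: "d > 0"
    using e K_pos by (simp add: d_def)
  obtain b where b: "b \<in> carrier B" "nrm B (\<Phi> y \<ominus>\<^bsub>B\<^esub> q \<otimes>\<^bsub>B\<^esub> b) < d"
    using assms y(1) d unfolding B.Omega_iff by (meson hom_closed)
  obtain r where r: "r > 0" "\<And>t. \<lbrakk>0 \<le> t; t < r\<rbrakk> \<Longrightarrow> nrm B q * t < d"
    using ex_small_factor[OF d] by blast
  obtain a where a: "a \<in> carrier A" "nrm B (b \<ominus>\<^bsub>B\<^esub> \<Phi> a) < r"
    using hom_dense[OF b(1) r(1)] by blast
  have "nrm B (q \<otimes>\<^bsub>B\<^esub> b \<ominus>\<^bsub>B\<^esub> q \<otimes>\<^bsub>B\<^esub> \<Phi> a) \<le> nrm B q * nrm B (b \<ominus>\<^bsub>B\<^esub> \<Phi> a)"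
    using B.nrm_mult[of q "b \<ominus>\<^bsub>B\<^esub> \<Phi> a"] q b a by (simp add: B.mult_minus_right)
  also have "\<dots> < d"
    using r(2)[OF B.norm_nonneg a(2)] a b by simp
  finally have "nrm B (\<Phi> y \<ominus>\<^bsub>B\<^esub> q \<otimes>\<^bsub>B\<^esub> \<Phi> a) < 2 * d"
    using B.norm_minus_triangle[of "\<Phi> y" "q \<otimes>\<^bsub>B\<^esub> b" "q \<otimes>\<^bsub>B\<^esub> \<Phi> a"] a b q y by simp
  then have "K * nrm B (\<Phi> y \<ominus>\<^bsub>B\<^esub> q \<otimes>\<^bsub>B\<^esub> \<Phi> a) < e / 2"
    using K_pos by (simp add: d_def field_simps)
  moreover have "nrm A (w \<otimes> y \<ominus> \<theta> q \<otimes> a) \<le> K * nrm B (\<Phi> y \<ominus>\<^bsub>B\<^esub> q \<otimes>\<^bsub>B\<^esub> \<Phi> a)"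
    using theta_norm[of "\<Phi> y \<ominus>\<^bsub>B\<^esub> q \<otimes>\<^bsub>B\<^esub> \<Phi> a"] y a q
    by (simp add: theta_minus theta_hom theta_mult_hom)
  ultimately have "nrm A (x \<ominus> \<theta> q \<otimes> a) < e"
    using A.norm_minus_triangle[of x "w \<otimes> y" "\<theta> q \<otimes> a"] x y a q by simp
  then show "\<exists>y\<in>carrier A. nrm A (x \<ominus> \<theta> q \<otimes> y) < e"
    using a(1) by blast
qed

lemma QM_homomorphism: "QM_homomorphism A B w \<Phi>"
proof -
  have "continuous_map (norm_top A) (norm_top B) \<Phi>"
  proof (rule normed_space_continuous_mapI)
    show "nrm B (\<Phi> x \<ominus>\<^bsub>B\<^esub> \<Phi> y) \<le> 1 * nrm A (x \<ominus> y)"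
      if "x \<in> carrier A" "y \<in> carrier A" for x y
      using hom_norm[of "x \<ominus> y"] that by (simp add: hom_minus)
  qed (auto intro: A.normed_space_axioms B.normed_space_axioms)
  moreover have "dense_in B (\<Phi> ` carrier A)"
    unfolding B.dense_in_iff using hom_dense by (auto simp: image_iff)
  moreover have "(\<lambda>b. \<Phi> w \<otimes>\<^bsub>B\<^esub> b) ` carrier B \<subseteq> \<Phi> ` carrier A"
    using hom_theta by (metis (no_types, lifting) image_iff image_subsetI theta_closed)
  ultimately show ?thesis
    unfolding QM_homomorphism_def using w_Omega hom_inj
    by (auto simp: hom_add hom_mult hom_smult A.weakly_cancellative_algebra_axioms
        B.weakly_cancellative_algebra_axioms)
qed

abbreviation F :: "('a \<Rightarrow> 'a option) \<Rightarrow> ('b \<Rightarrow> 'b option)"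
  where "F \<equiv> QM_map A B \<Phi>"

lemma quot_op_hom_eq_iff:
  assumes "u \<in> carrier A" "v \<in> Omega A" "u' \<in> carrier A" "v' \<in> Omega A"
  shows "quot_op B (\<Phi> u) (\<Phi> v) = quot_op B (\<Phi> u') (\<Phi> v') \<longleftrightarrow> quot_op A u v = quot_op A u' v'"
proof -
  have v: "v \<in> carrier A" "v' \<in> carrier A"
    using assms by (simp_all add: A.Omega_carrier)
  have "\<Phi> u \<otimes>\<^bsub>B\<^esub> \<Phi> v' = \<Phi> u' \<otimes>\<^bsub>B\<^esub> \<Phi> v \<longleftrightarrow> u \<otimes> v' = u' \<otimes> v"
    using assms v by (simp add: hom_eq_iff flip: hom_mult)
  then show ?thesis
    using assms by (simp add: A.quot_op_eq_iff B.quot_op_eq_iff hom_Omega)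
qed

lemma QM_map_quot_op:
  assumes "u \<in> carrier A" "v \<in> Omega A"
  shows "F (quot_op A u v) = quot_op B (\<Phi> u) (\<Phi> v)"
  unfolding QM_map_def
proof (rule the_equality)
  show "\<exists>p q. represents A p q (quot_op A u v) \<and> quot_op B (\<Phi> u) (\<Phi> v) = quot_op B (\<Phi> p) (\<Phi> q)"
    using assms by (auto simp: represents_def)
  show "R = quot_op B (\<Phi> u) (\<Phi> v)"
    if "\<exists>p q. represents A p q (quot_op A u v) \<and> R = quot_op B (\<Phi> p) (\<Phi> q)" for R
    using that assms quot_op_hom_eq_iff unfolding represents_def by metis
qed

text \<open>Multiplying numerator and denominator by \<open>\<Phi> w\<close> moves both into the
  image of \<open>A\<close>. Surjectivity of \<open>F\<close> and the formula for its inverse follow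
  from this.\<close>

lemma quot_op_theta:
  assumes "p \<in> carrier B" "q \<in> Omega B"
  shows "quot_op B p q = F (quot_op A (\<theta> p) (\<theta> q))"
proof -
  have q: "q \<in> carrier B"
    using assms by (simp add: B.Omega_carrier)
  have "p \<otimes>\<^bsub>B\<^esub> (\<Phi> w \<otimes>\<^bsub>B\<^esub> q) = (\<Phi> w \<otimes>\<^bsub>B\<^esub> p) \<otimes>\<^bsub>B\<^esub> q"
    using assms(1) q by (simp add: B.mult_lcomm B.mult_assoc)
  moreover have "\<Phi> w \<otimes>\<^bsub>B\<^esub> q \<in> Omega B"
    using hom_Omega[OF theta_Omega[OF assms(2)]] by (simp add: hom_theta q)
  ultimately show ?thesis
    using assms q by (simp add: QM_map_quot_op theta_Omega hom_theta B.quot_op_eq_iff)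
qed

lemma QM_map_bij: "bij_betw F (carrier (QM A)) (carrier (QM B))"
  unfolding bij_betw_def
proof
  show "inj_on F (carrier (QM A))"
  proof (rule inj_onI)
    fix S S' assume S: "S \<in> carrier (QM A)" "S' \<in> carrier (QM A)" "F S = F S'"
    obtain u v u' v' where "u \<in> carrier A" "v \<in> Omega A" "S = quot_op A u v"
      "u' \<in> carrier A" "v' \<in> Omega A" "S' = quot_op A u' v'"
      using S(1,2) by (elim A.QM_carrierE)
    then show "S = S'"
      using S(3) by (simp add: QM_map_quot_op quot_op_hom_eq_iff)
  qed
  show "F ` carrier (QM A) = carrier (QM B)"
  proof
    show "F ` carrier (QM A) \<subseteq> carrier (QM B)"
      by (auto elim!: A.QM_carrierE simp: QM_map_quot_op intro!: B.quot_op_in_QM hom_Omega)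
    show "carrier (QM B) \<subseteq> F ` carrier (QM A)"
      by (auto elim!: B.QM_carrierE simp: quot_op_theta
          intro!: imageI A.quot_op_in_QM theta_Omega)
  qed
qed

lemma inv_QM_map_quot_op:
  assumes "p \<in> carrier B" "q \<in> Omega B"
  shows "inv_into (carrier (QM A)) F (quot_op B p q) = quot_op A (\<theta> p) (\<theta> q)"
  unfolding quot_op_theta[OF assms]
  using QM_map_bij assms by (intro inv_into_f_f) (auto simp: bij_betw_def theta_Omega)

text \<open>The element at which a family is bounded is transported along with it:
  \<open>\<Phi> x\<close> works for the image, with the same constant because \<open>\<Phi>\<close>
  is contractive, and \<open>\<theta> b\<close> for the inverse image, with the constant
  \<open>K * C\<close>.\<close>

theorem QM_map_pseudobounded_iso: "pseudobounded_iso A B F"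
  unfolding pseudobounded_iso_def
proof (intro conjI allI ballI impI)
  show "F \<in> ring_iso (QM A) (QM B)"
  proof (rule ring_iso_memI)
    show "bij_betw F (carrier (QM A)) (carrier (QM B))"
      by (rule QM_map_bij)
    then show "F S \<in> carrier (QM B)" if "S \<in> carrier (QM A)" for S
      using that by (rule bij_betw_apply)
    show "F \<one>\<^bsub>QM A\<^esub> = \<one>\<^bsub>QM B\<^esub>"
      using w_Omega by (simp add: A.QM_one[of w] B.QM_one[of "\<Phi> w"] QM_map_quot_op hom_Omega)
    fix S S' assume S: "S \<in> carrier (QM A)" "S' \<in> carrier (QM A)"
    obtain u v u' v' where uv: "u \<in> carrier A" "v \<in> Omega A" "S = quot_op A u v"
      "u' \<in> carrier A" "v' \<in> Omega A" "S' = quot_op A u' v'"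
      using S by (elim A.QM_carrierE)
    then have v: "v \<in> carrier A" "v' \<in> carrier A"
      by (simp_all add: A.Omega_carrier)
    show "F (S \<otimes>\<^bsub>QM A\<^esub> S') = F S \<otimes>\<^bsub>QM B\<^esub> F S'"
      using uv v by (simp add: QM_map_quot_op A.QM_mult_quot_op B.QM_mult_quot_op hom_Omega
          A.Omega_mult hom_mult)
    show "F (S \<oplus>\<^bsub>QM A\<^esub> S') = F S \<oplus>\<^bsub>QM B\<^esub> F S'"
      using uv v by (simp add: QM_map_quot_op A.QM_add_quot_op B.QM_add_quot_op hom_Omega
          A.Omega_mult hom_mult hom_add)
  qed
  show "F (c \<odot>\<^bsub>QM A\<^esub> S) = c \<odot>\<^bsub>QM B\<^esub> F S" if "S \<in> carrier (QM A)" for c S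
    using that by (auto elim!: A.QM_carrierE simp: QM_map_quot_op A.QM_smult_quot_op
        B.QM_smult_quot_op hom_Omega hom_smult)
next
  fix V assume "pseudobounded A V"
  then obtain x where V: "V \<subseteq> carrier (QM A)" and x: "x \<in> Omega A" "\<And>S. S \<in> V \<Longrightarrow> x \<in> dom S"
    and "bdd_above ((\<lambda>S. nrm A (the (S x))) ` V)"
    by (auto simp: pseudobounded_def)
  then obtain C where C: "\<And>S. S \<in> V \<Longrightarrow> nrm A (the (S x)) \<le> C"
    by (auto simp: bdd_above_def)
  have key: "F S (\<Phi> x) = Some (\<Phi> (the (S x)))" "nrm B (the (F S (\<Phi> x))) \<le> C" if S: "S \<in> V" for S
  proof -
    obtain u v where uv: "u \<in> carrier A" "v \<in> Omega A" "S = quot_op A u v"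
      using S V by (blast elim: A.QM_carrierE)
    obtain y where y: "S x = Some y"
      using x(2)[OF S] by auto
    then have xy: "x \<in> carrier A" "y \<in> carrier A" "v \<otimes> y = u \<otimes> x"
      using uv by (simp_all add: A.quot_op_eq_Some_iff)
    then have "\<Phi> v \<otimes>\<^bsub>B\<^esub> \<Phi> y = \<Phi> u \<otimes>\<^bsub>B\<^esub> \<Phi> x"
      using uv by (simp add: A.Omega_carrier flip: hom_mult)
    then show *: "F S (\<Phi> x) = Some (\<Phi> (the (S x)))"
      using uv xy y by (simp add: QM_map_quot_op B.quot_op_eq_Some_iff hom_Omega)
    show "nrm B (the (F S (\<Phi> x))) \<le> C"
      using C[OF S] hom_norm[OF xy(2)] y * by simp
  qed
  show "pseudobounded B (F ` V)"
    unfolding pseudobounded_def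
  proof (intro conjI bexI ballI)
    show "F ` V \<subseteq> carrier (QM B)"
      using V QM_map_bij by (auto simp: bij_betw_def)
    show "\<Phi> x \<in> Omega B"
      using x(1) by (rule hom_Omega)
    show "\<Phi> x \<in> dom S" if "S \<in> F ` V" for S
      using that key(1) by auto
    show "bdd_above ((\<lambda>S. nrm B (the (S (\<Phi> x)))) ` F ` V)"
      using key(2) by (auto intro!: bdd_aboveI[of _ C])
  qed
next
  fix W assume "pseudobounded B W"
  then obtain b where W: "W \<subseteq> carrier (QM B)" and b: "b \<in> Omega B" "\<And>S. S \<in> W \<Longrightarrow> b \<in> dom S"
    and "bdd_above ((\<lambda>S. nrm B (the (S b))) ` W)"
    by (auto simp: pseudobounded_def)
  then obtain C where C: "\<And>S. S \<in> W \<Longrightarrow> nrm B (the (S b)) \<le> C"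
    by (auto simp: bdd_above_def)
  let ?G = "inv_into (carrier (QM A)) F"
  have key: "?G S (\<theta> b) = Some (\<theta> (the (S b)))" "nrm A (the (?G S (\<theta> b))) \<le> K * C"
    if S: "S \<in> W" for S
  proof -
    obtain p q where pq: "p \<in> carrier B" "q \<in> Omega B" "S = quot_op B p q"
      using S W by (blast elim: B.QM_carrierE)
    obtain y where y: "S b = Some y"
      using b(2)[OF S] by auto
    then have xy: "b \<in> carrier B" "y \<in> carrier B" "q \<otimes>\<^bsub>B\<^esub> y = p \<otimes>\<^bsub>B\<^esub> b"
      using pq by (simp_all add: B.quot_op_eq_Some_iff)
    have q: "q \<in> carrier B"
      using pq by (simp add: B.Omega_carrier)
    \<comment> \<open>After applying \<open>\<Phi>\<close>, both sides of the desired equation carry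
      the factor \<open>\<Phi> w\<close> twice, so the defining equation of \<open>y\<close> in
      \<open>B\<close> is enough.\<close>
    have "(\<Phi> w \<otimes>\<^bsub>B\<^esub> q) \<otimes>\<^bsub>B\<^esub> (\<Phi> w \<otimes>\<^bsub>B\<^esub> y) = \<Phi> w \<otimes>\<^bsub>B\<^esub> (\<Phi> w \<otimes>\<^bsub>B\<^esub> (q \<otimes>\<^bsub>B\<^esub> y))"
      using q xy by (simp add: B.mult_assoc B.mult_lcomm)
    also have "\<dots> = (\<Phi> w \<otimes>\<^bsub>B\<^esub> p) \<otimes>\<^bsub>B\<^esub> (\<Phi> w \<otimes>\<^bsub>B\<^esub> b)"
      using pq xy by (simp add: B.mult_assoc B.mult_lcomm)
    finally have "\<theta> q \<otimes> \<theta> y = \<theta> p \<otimes> \<theta> b"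
      using pq q xy by (subst hom_eq_iff[symmetric]) (auto simp: hom_mult hom_theta)
    then show *: "?G S (\<theta> b) = Some (\<theta> (the (S b)))"
      using pq xy y by (simp add: inv_QM_map_quot_op A.quot_op_eq_Some_iff theta_Omega)
    have "nrm A (\<theta> y) \<le> K * nrm B y"
      using xy by (simp add: theta_norm)
    also have "\<dots> \<le> K * C"
      using C[OF S] y K_pos by simp
    finally show "nrm A (the (?G S (\<theta> b))) \<le> K * C"
      using y * by simp
  qed
  show "pseudobounded A (?G ` W)"
    unfolding pseudobounded_def
  proof (intro conjI bexI ballI)
    show "?G ` W \<subseteq> carrier (QM A)"
      using W bij_betw_imp_surj_on[OF QM_map_bij] inv_into_into[of _ F "carrier (QM A)"] by blast
    show "\<theta> b \<in> Omega A"
      using b(1) by (rule theta_Omega)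
    show "\<theta> b \<in> dom S" if "S \<in> ?G ` W" for S
      using that key(1) by auto
    show "bdd_above ((\<lambda>S. nrm A (the (S (\<theta> b)))) ` ?G ` W)"
      using key(2) by (auto intro!: bdd_aboveI[of _ "K * C"])
  qed
qed

end

section \<open>Growth of semigroups\<close>

text \<open>Fekete's lemma in continuous time: the limit is the infimum of the roots. Bounds on
  compact intervals away from 0 control the remainder when a time is divided by a fixed
  \<open>t0\<close>. The lemma is needed because \<open>growth_rate\<close> is defined by
  \<open>Lim\<close>, which says nothing until convergence is known.\<close>

lemma submultiplicative_root_tendsto:
  fixes n :: "real \<Rightarrow> real"
  assumes nonneg: "\<And>t. t > 0 \<Longrightarrow> 0 \<le> n t"
    and submult: "\<And>s t. \<lbrakk>s > 0; t > 0\<rbrakk> \<Longrightarrow> n (s + t) \<le> n s * n t"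
    and bounded: "\<And>a b. 0 < a \<Longrightarrow> \<exists>C. \<forall>t\<in>{a..b}. n t \<le> C"
  shows "\<exists>L\<ge>0. ((\<lambda>t. n t powr (1 / t)) \<longlongrightarrow> L) at_top"
proof -
  define f where "f t = n t powr (1 / t)" for t
  define L where "L = Inf (f ` {0<..})"
  have bdd: "bdd_below (f ` {0<..})"
    by (rule bdd_belowI[of _ 0]) (auto simp: f_def)
  have L_le: "L \<le> f t" if "t > 0" for t
    unfolding L_def using bdd that by (intro cINF_lower) auto
  have L0: "L \<ge> 0"
    unfolding L_def by (intro cINF_greatest) (auto simp: f_def intro: exI[of _ 1])
  have "\<forall>\<^sub>F t in at_top. f t < c" if c: "L < c" for c
  proof -
    obtain q where q: "L < q" "q < c"
      using dense[OF c] by blast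
    then have q0: "q > 0"
      using L0 by simp
    obtain t0 where t0: "t0 > 0" "f t0 < q"
      using q(1) cINF_less_iff[OF _ bdd, of q] unfolding L_def by (auto intro: exI[of _ 1])
    have nt0: "n t0 \<le> q powr t0"
    proof (cases "n t0 = 0")
      case False
      then have "n t0 = (n t0 powr (1 / t0)) powr t0"
        using nonneg[OF t0(1)] t0(1) by (simp add: powr_powr)
      also have "\<dots> \<le> q powr t0"
        using t0 unfolding f_def by (intro powr_mono2) auto
      finally show ?thesis .
    qed simp
    obtain C0 where C0: "\<And>t. t \<in> {t0..2 * t0} \<Longrightarrow> n t \<le> C0"
      using bounded[OF t0(1)] by blast
    define C where "C = max C0 1"
    have C: "C > 0" "\<And>t. t \<in> {t0..2 * t0} \<Longrightarrow> n t \<le> C"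
      using C0 by (auto simp: C_def le_max_iff_disj)
    \<comment> \<open>Dominates \<open>C * q powr (- r)\<close> for all \<open>r\<close> between
      \<open>t0\<close> and \<open>2 * t0\<close>, whether \<open>q\<close> lies above or below
      1.\<close>
    define D where "D = C * (q powr (- t0) + q powr (- (2 * t0)))"
    have D: "D > 0"
      using C(1) q0 by (simp add: D_def add_pos_pos)
    have step: "n (real k * t0 + r) \<le> q powr (real k * t0) * C" if "r \<in> {t0..2 * t0}" for k r
    proof (induction k)
      case 0
      then show ?case
        using C(2)[OF that] q0 by simp
    next
      case (Suc k)
      have "0 \<le> real k * t0" "0 < r"
        using that t0 by auto
      then have pos: "0 < real k * t0 + r"
        by linarith
      have "n (real (Suc k) * t0 + r) = n (t0 + (real k * t0 + r))"
        by (simp add: algebra_simps)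
      also have "\<dots> \<le> n t0 * n (real k * t0 + r)"
        using that t0 by (intro submult) (auto intro: add_nonneg_pos)
      also have "\<dots> \<le> q powr t0 * (q powr (real k * t0) * C)"
        using nt0 Suc pos nonneg[of "real k * t0 + r"] that t0 by (intro mult_mono) (auto intro: add_nonneg_pos)
      finally show ?case
        by (simp add: distrib_right powr_add mult.assoc)
    qed
    have le: "f t \<le> q * D powr (1 / t)" if t: "t \<ge> t0" for t
    proof -
      \<comment> \<open>One less than the integer quotient, so that the remainder falls in
        \<open>{t0..2 * t0}\<close> and not near 0, where \<open>n\<close> may be unbounded.\<close>
      define k where "k = nat \<lfloor>t / t0\<rfloor> - 1"
      define r where "r = t - real k * t0"
      have "1 \<le> t / t0"
        using t t0 by simp
      then have "1 \<le> \<lfloor>t / t0\<rfloor>"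
        by (simp add: le_floor_iff)
      then have "real k = of_int \<lfloor>t / t0\<rfloor> - 1"
        unfolding k_def by linarith
      then have "real k \<le> t / t0 - 1" "t / t0 - 2 < real k"
        by linarith+
      then have r: "r \<in> {t0..2 * t0}"
        using t0(1) by (auto simp: r_def field_simps)
      have "n t \<le> q powr (real k * t0) * C"
        using step[OF r, of k] by (simp add: r_def)
      also have "\<dots> = q powr t * (C * q powr (- r))"
        by (simp add: r_def flip: powr_add)
      also have "\<dots> \<le> q powr t * D"
      proof (intro mult_left_mono)
        have "q powr (- r) \<le> q powr (- t0) + q powr (- (2 * t0))"
        proof (cases "q \<ge> 1")
          case True
          then have "q powr (- r) \<le> q powr (- t0)"
            using r by (intro powr_mono) auto
          then show ?thesis
            using powr_ge_zero[of q "- (2 * t0)"] by linarith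
        next
          case False
          then have "q powr (- r) \<le> q powr (- (2 * t0))"
            using r q0 by (intro powr_mono') auto
          then show ?thesis
            using powr_ge_zero[of q "- t0"] by linarith
        qed
        then show "C * q powr (- r) \<le> D"
          using C(1) by (simp add: D_def)
      qed auto
      finally have "n t \<le> q powr t * D" .
      then have "f t \<le> (q powr t * D) powr (1 / t)"
        unfolding f_def using nonneg[of t] t t0 by (intro powr_mono2) auto
      also have "\<dots> = q * D powr (1 / t)"
        using q0 D t t0 by (simp add: powr_mult powr_powr)
      finally show ?thesis .
    qed
    \<comment> \<open>The constant \<open>D\<close> disappears under the \<open>t\<close>-th root,
      so the bound tends to \<open>q\<close>, which is below \<open>c\<close>.\<close>
    have "((\<lambda>t. q * D powr (1 / t)) \<longlongrightarrow> q * D powr 0) at_top"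
      using D by (intro tendsto_intros tendsto_divide_0[OF tendsto_const] filterlim_at_top_imp_at_infinity
          filterlim_ident) auto
    then have "\<forall>\<^sub>F t in at_top. q * D powr (1 / t) < c"
      using q(2) D by (intro order_tendstoD) auto
    then show ?thesis
      using eventually_ge_at_top[of t0] by eventually_elim (use le in \<open>auto intro: le_less_trans\<close>)
  qed
  moreover have "\<forall>\<^sub>F t in at_top. c < f t" if "c < L" for c
    using eventually_gt_at_top[of 0] by eventually_elim (use that L_le in \<open>auto intro: less_le_trans\<close>)
  ultimately have "(f \<longlongrightarrow> L) at_top"
    by (rule order_tendstoI[rotated])
  then show ?thesis
    using L0 unfolding f_def by blast
qed

section \<open>Local boundedness and growth of the semigroup\<close>

locale multiplier_semigroup = weakly_cancellative_algebra A for A :: "'a normed_alg" (structure) +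
  fixes T :: "real \<Rightarrow> 'a \<Rightarrow> 'a"
  assumes strongly_continuous: "strongly_continuous_semigroup A T"
begin

lemma T_multiplier [simp, intro]: "t > 0 \<Longrightarrow> T t \<in> carrier Mul"
  using strongly_continuous by (simp add: strongly_continuous_semigroup_def)

lemma T_add: "\<lbrakk>s > 0; t > 0; x \<in> carrier A\<rbrakk> \<Longrightarrow> T (s + t) x = T s (T t x)"
  using strongly_continuous by (simp add: strongly_continuous_semigroup_def multiplier_alg_apply)

lemma T_continuous:
  assumes "u \<in> carrier A" "s > 0" "e > 0"
  shows "\<exists>d>0. \<forall>t>0. \<bar>t - s\<bar> < d \<longrightarrow> nrm A (T t u \<ominus> T s u) < e"
proof -
  have "continuous_map (top_of_set {0<..}) (norm_top A) (\<lambda>t. T t u)"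
    using strongly_continuous assms(1) by (simp add: strongly_continuous_semigroup_def)
  then have "\<exists>d>0. \<forall>t\<in>{0<..}. dist t s < d \<longrightarrow> nrm A (T t u \<ominus> T s u) < e"
    using assms by (subst (asm) continuous_map_norm_top_iff) auto
  then show ?thesis
    by (auto simp: dist_real_def)
qed

lemma T_orbit_bounded:
  assumes "u \<in> carrier A" "0 < a"
  shows "\<exists>C. \<forall>t\<in>{a..b}. nrm A (T t u) \<le> C"
proof -
  have "continuous_on {a..b} (\<lambda>t. nrm A (T t u))"
    unfolding continuous_on_iff
  proof (intro ballI allI impI)
    fix s and e :: real assume s: "s \<in> {a..b}" and e: "e > 0"
    then have s0: "s > 0"
      using assms by simp
    obtain d where d: "d > 0" "\<And>t. \<lbrakk>t > 0; \<bar>t - s\<bar> < d\<rbrakk> \<Longrightarrow> nrm A (T t u \<ominus> T s u) < e"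
      using T_continuous[OF assms(1) s0 e] by blast
    have "dist (nrm A (T t u)) (nrm A (T s u)) < e" if t: "t \<in> {a..b}" "dist t s < d" for t
    proof -
      have t0: "t > 0"
        using t assms(2) by simp
      have "nrm A (T t u \<ominus> T s u) < e"
        using d(2)[OF t0] t by (simp add: dist_real_def)
      then show ?thesis
        using norm_le_add_minus[of "T t u" "T s u"] norm_le_add_minus[of "T s u" "T t u"]
          norm_minus_commute[of "T t u" "T s u"] t0 s0 assms(1)
        by (simp add: dist_real_def abs_less_iff)
    qed
    then show "\<exists>d>0. \<forall>t\<in>{a..b}. dist t s < d \<longrightarrow> dist (nrm A (T t u)) (nrm A (T s u)) < e"
      using d(1) by blast
  qed
  then have "bounded ((\<lambda>t. nrm A (T t u)) ` {a..b})"
    by (intro compact_imp_bounded compact_continuous_image compact_Icc)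
  then show ?thesis
    by (auto simp: bounded_real abs_le_iff)
qed

text \<open>Uniform boundedness by Baire: every orbit is bounded on the compact interval, so one of
  the closed sets \<open>G n\<close> contains a ball, and linearity moves the bound from there to
  the origin.\<close>

lemma T_locally_bounded:
  assumes a: "0 < a"
  shows "\<exists>C. \<forall>t\<in>{a..b}. nrm Mul (T t) \<le> C"
proof -
  define G where "G n = {x \<in> carrier A. \<forall>t\<in>{a..b}. nrm A (T t x) \<le> real n}" for n :: nat
  have closed: "closedin met.mtopology (G n)" for n
  proof -
    have "norm_top A closure_of G n \<subseteq> G n"
    proof
      have sub: "G n \<subseteq> carrier A"
        by (auto simp: G_def)
      fix x assume "x \<in> norm_top A closure_of G n"
      then have x: "x \<in> carrier A" "\<And>e. e > 0 \<Longrightarrow> \<exists>y\<in>G n. nrm A (x \<ominus> y) < e"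
        using in_closure_iff[OF sub] by auto
      have "nrm A (T t x) \<le> real n" if t: "t \<in> {a..b}" for t
      proof (rule field_le_epsilon)
        fix e :: real assume e: "e > 0"
        have tM: "T t \<in> carrier Mul"
          using t a by simp
        let ?m = "nrm Mul (T t)"
        obtain d where d: "d > 0" "\<And>r. \<lbrakk>0 \<le> r; r < d\<rbrakk> \<Longrightarrow> ?m * r < e"
          using ex_small_factor[OF e] by blast
        then obtain y where y: "y \<in> G n" "nrm A (x \<ominus> y) < d"
          using x(2) by blast
        have yc: "y \<in> carrier A"
          using y(1) sub by auto
        have "nrm A (T t x \<ominus> T t y) \<le> ?m * nrm A (x \<ominus> y)"
          using norm_multiplier[OF tM, of "x \<ominus> y"] x yc tM by (simp add: multiplier_minus)
        also have "\<dots> \<le> e"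
          using d(2)[OF norm_nonneg y(2)] x yc by simp
        finally have "nrm A (T t x \<ominus> T t y) \<le> e" .
        moreover have "nrm A (T t y) \<le> real n"
          using y(1) t by (simp add: G_def)
        ultimately show "nrm A (T t x) \<le> real n + e"
          using norm_le_add_minus[of "T t x" "T t y"] x yc tM by simp
      qed
      then show "x \<in> G n"
        using x(1) by (simp add: G_def)
    qed
    then show ?thesis
      using closure_of_subset_eq[of "G n" "norm_top A"] by (auto simp: G_def norm_top_eq)
  qed
  have "(\<Union>n. G n) = carrier A"
  proof
    show "carrier A \<subseteq> (\<Union>n. G n)"
    proof
      fix x assume x: "x \<in> carrier A"
      obtain C where C: "\<And>t. t \<in> {a..b} \<Longrightarrow> nrm A (T t x) \<le> C"
        using T_orbit_bounded[OF x a] by blast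
      obtain n :: nat where "C \<le> real n"
        using real_arch_simple by blast
      then have "x \<in> G n"
        using C x by (force simp: G_def)
      then show "x \<in> (\<Union>n. G n)"
        by blast
    qed
  qed (auto simp: G_def)
  moreover have "met.mtopology interior_of carrier A = carrier A"
    by (metis met.topspace_mtopology interior_of_topspace)
  moreover have "carrier A \<noteq> {}"
    using M.zero_closed by blast
  ultimately have "met.mtopology interior_of (\<Union>(range G)) \<noteq> {}"
    by simp
  then obtain n where n: "met.mtopology interior_of G n \<noteq> {}"
    using met.metric_Baire_category_alt[OF complete, of "range G"] closed by auto
  then obtain x0 r where x0: "x0 \<in> carrier A" and r: "r > 0" "met.mball x0 r \<subseteq> G n"
    unfolding met.metric_interior_of by auto
  \<comment> \<open>A small vector is the difference of two points of the ball, hence the doubled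
    bound.\<close>
  have small: "nrm A (T t y) \<le> 2 * real n" if y: "y \<in> carrier A" "nrm A y < r" and t: "t \<in> {a..b}" for y t
  proof -
    have t0: "t > 0"
      using t a by simp
    have "x0 \<ominus> (x0 \<oplus> y) = (-1) \<odot> y"
    proof -
      have "x0 \<ominus> (x0 \<oplus> y) = (x0 \<oplus> \<zero>) \<ominus> (x0 \<oplus> y)"
        using x0 by simp
      also have "\<dots> = (x0 \<ominus> x0) \<oplus> (\<zero> \<ominus> y)"
        using x0 y(1) by (intro add_minus_add) auto
      finally show ?thesis
        using x0 y by (simp add: minus_alt)
    qed
    then have "x0 \<oplus> y \<in> met.mball x0 r"
      using x0 y r by (simp add: met.in_mball norm_dist_eq norm_smult)
    then have "x0 \<oplus> y \<in> G n" "x0 \<in> G n"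
      using r x0 by auto
    then have "nrm A (T t (x0 \<oplus> y)) \<le> real n" "nrm A (T t x0) \<le> real n"
      using t by (simp_all add: G_def)
    moreover have "T t y = T t (x0 \<oplus> y) \<ominus> T t x0"
    proof -
      have "T t (x0 \<oplus> y) \<ominus> T t x0 = (T t y \<oplus> T t x0) \<ominus> (\<zero> \<oplus> T t x0)"
        using x0 y t0 by (simp add: multiplier_add M.a_comm)
      also have "\<dots> = (T t y \<ominus> \<zero>) \<oplus> (T t x0 \<ominus> T t x0)"
        using x0 y t0 by (intro add_minus_add) auto
      finally show ?thesis
        using x0 y t0 by (simp add: minus_alt)
    qed
    ultimately show ?thesis
      using norm_minus_le[of "T t (x0 \<oplus> y)" "T t x0"] x0 y t0 by simp
  qed
  have "nrm Mul (T t) \<le> 4 * real n / r" if t: "t \<in> {a..b}" for t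
  proof (rule norm_multiplier_le)
    have t0: "t > 0"
      using t a by simp
    then show "T t \<in> carrier Mul"
      by simp
    show "0 \<le> 4 * real n / r"
      using r by simp
    fix x assume x: "x \<in> carrier A"
    show "nrm A (T t x) \<le> 4 * real n / r * nrm A x"
    proof (cases "x = \<zero>")
      case True
      then show ?thesis
        using t0 by (simp add: multiplier_zero)
    next
      case False
      then have nx: "nrm A x > 0"
        using x norm_nonneg[OF x] norm_eq_zero_iff[OF x] by linarith
      \<comment> \<open>Scales \<open>x\<close> to norm \<open>r / 2\<close>; undoing this turns the
        bound \<open>2 * n\<close> into \<open>4 * n / r\<close> times the norm of
        \<open>x\<close>.\<close>
      define c where "c = r / (2 * nrm A x)"
      have c: "c > 0"
        using r nx by (simp add: c_def)
      have "nrm A (T t (complex_of_real c \<odot> x)) \<le> 2 * real n"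
      proof (rule small[OF _ _ t])
        have "nrm A (complex_of_real c \<odot> x) = r / 2"
          using x c nx by (simp add: norm_smult) (simp add: c_def)
        then show "nrm A (complex_of_real c \<odot> x) < r"
          using r by simp
      qed (use x in auto)
      then have "c * nrm A (T t x) \<le> 2 * real n"
        using x t0 c by (simp add: multiplier_smult norm_smult)
      then show ?thesis
        using r nx by (simp add: c_def field_simps)
    qed
  qed
  then show ?thesis
    by blast
qed

text \<open>Strictness leaves room for some \<open>q\<close> between the growth rate and
  \<open>exp lam\<close>. The gap between \<open>lam\<close> and \<open>ln q\<close> is the margin
  \<open>\<eta>\<close>, which becomes exponential decay after rescaling.\<close>

lemma growth_rate_bound:
  assumes "log_growth_rate A T < ereal lam"
  shows "\<exists>b>0. \<exists>\<eta>>0. \<forall>t\<ge>b. nrm Mul (T t) \<le> exp ((lam - \<eta>) * t)"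
proof -
  interpret M: banach_algebra "Mul"
    by (rule multiplier_banach_algebra)
  have "T (s + t) = T s \<otimes>\<^bsub>Mul\<^esub> T t" if "s > 0" "t > 0" for s t
    using strongly_continuous that by (simp add: strongly_continuous_semigroup_def)
  then have "\<exists>L\<ge>0. ((\<lambda>t. nrm Mul (T t) powr (1 / t)) \<longlongrightarrow> L) at_top"
    using T_locally_bounded M.norm_nonneg M.nrm_mult
    by (intro submultiplicative_root_tendsto) auto
  then obtain L where L: "L \<ge> 0" "((\<lambda>t. nrm Mul (T t) powr (1 / t)) \<longlongrightarrow> L) at_top"
    by blast
  have "growth_rate A T = L"
    unfolding growth_rate_def by (rule tendsto_Lim[OF _ L(2)]) simp
  then have "L < exp lam"
  proof (cases "L = 0")
    case False
    then have "ln L < lam" "L > 0"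
      using assms \<open>growth_rate A T = L\<close> L(1) by (simp_all add: log_growth_rate_def)
    then show ?thesis
      by (metis exp_less_cancel_iff exp_ln)
  qed simp
  then obtain q where q: "L < q" "q < exp lam"
    using dense by blast
  then have q0: "q > 0"
    using L(1) by simp
  have "\<forall>\<^sub>F t in at_top. nrm Mul (T t) powr (1 / t) < q"
    using L(2) q(1) by (rule order_tendstoD)
  then obtain b where b: "\<And>t. t \<ge> b \<Longrightarrow> nrm Mul (T t) powr (1 / t) < q"
    by (auto simp: eventually_at_top_linorder)
  \<comment> \<open>Starting at 1 at the earliest keeps \<open>t\<close> positive, so that the
    \<open>t\<close>-th root can be undone.\<close>
  have "nrm Mul (T t) \<le> exp ((lam - (lam - ln q)) * t)" if "t \<ge> max b 1" for t
  proof (cases "nrm Mul (T t) = 0")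
    case False
    let ?n = "nrm Mul (T t)"
    have "0 \<le> ?n"
      using that by (intro norm_multiplier_nonneg) simp
    then have "?n = (?n powr (1 / t)) powr t"
      using False that by (simp add: powr_powr)
    also have "\<dots> \<le> q powr t"
      using b[of t] that by (intro powr_mono2) auto
    finally show ?thesis
      using q0 by (simp add: powr_def mult.commute)
  qed simp
  moreover have "lam - ln q > 0"
    using q(2) q0 by (metis diff_gt_0_iff_gt ln_exp ln_less_cancel_iff exp_gt_zero)
  ultimately show ?thesis
    by (intro exI[of _ "max b 1"] conjI exI[of _ "lam - ln q"]) auto
qed

end

section \<open>The ideal \<open>L\<^sub>T\<close>\<close>

locale growth_semigroup = multiplier_semigroup A T
  for A :: "'a normed_alg" (structure) and T :: "real \<Rightarrow> 'a \<Rightarrow> 'a" +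
  fixes lam :: real
  assumes growth: "log_growth_rate A T < ereal lam"
    and dense_range: "dense_in A (\<Union>t\<in>{0<..}. T t ` carrier A)"
begin

text \<open>The case distinction makes \<open>S 0\<close> the identity, because \<open>T 0\<close>
  is unconstrained.\<close>

definition S :: "real \<Rightarrow> 'a \<Rightarrow> 'a"
  where "S s u = (if s = 0 then u else complex_of_real (exp (- lam * s)) \<odot> T s u)"

lemma S_0 [simp]: "S 0 u = u"
  by (simp add: S_def)

lemma S_closed [simp, intro]: "\<lbrakk>s \<ge> 0; x \<in> carrier A\<rbrakk> \<Longrightarrow> S s x \<in> carrier A"
  by (simp add: S_def)

lemma S_plus: "\<lbrakk>s \<ge> 0; x \<in> carrier A; y \<in> carrier A\<rbrakk> \<Longrightarrow> S s (x \<oplus> y) = S s x \<oplus> S s y"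
  by (simp add: S_def multiplier_add scal_add_right)

lemma S_smult: "\<lbrakk>s \<ge> 0; x \<in> carrier A\<rbrakk> \<Longrightarrow> S s (c \<odot> x) = c \<odot> S s x"
  by (simp add: S_def multiplier_smult scal_scal mult.commute)

lemma S_mult: "\<lbrakk>s \<ge> 0; x \<in> carrier A; y \<in> carrier A\<rbrakk> \<Longrightarrow> S s (x \<otimes> y) = S s x \<otimes> y"
  by (simp add: S_def multiplier_mult smult_mult_left)

lemma S_minus: "\<lbrakk>s \<ge> 0; x \<in> carrier A; y \<in> carrier A\<rbrakk> \<Longrightarrow> S s (x \<ominus> y) = S s x \<ominus> S s y"
  by (simp add: minus_alt S_plus S_smult)

lemma S_zero: "s \<ge> 0 \<Longrightarrow> S s \<zero> = \<zero>"
  using S_smult[of s \<zero> 0] by simp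

lemma S_add:
  assumes "s \<ge> 0" "t \<ge> 0" "x \<in> carrier A"
  shows "S (s + t) x = S s (S t x)"
proof (cases "s = 0 \<or> t = 0")
  case False
  then have st: "s > 0" "t > 0"
    using assms by auto
  have "complex_of_real (exp (- lam * (s + t))) = complex_of_real (exp (- lam * s)) * complex_of_real (exp (- lam * t))"
    by (simp add: algebra_simps flip: exp_add of_real_mult)
  then show ?thesis
    using st assms by (simp add: S_def T_add multiplier_smult scal_scal)
qed auto

lemma S_commute_multiplier:
  assumes "s \<ge> 0" "R \<in> carrier Mul" "x \<in> carrier A"
  shows "R (S s x) = S s (R x)"
proof (cases "s = 0")
  case False
  then show ?thesis
    using assms multiplier_commute[OF assms(2), of "T s" x] by (simp add: S_def multiplier_smult)
qed simp

lemma norm_S: "\<lbrakk>s > 0; x \<in> carrier A\<rbrakk> \<Longrightarrow> nrm A (S s x) = exp (- lam * s) * nrm A (T s x)"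
  by (simp add: S_def norm_smult)

lemma S_decay:
  obtains b \<eta> where "b > 0" "\<eta> > 0"
    "\<And>s x. \<lbrakk>s \<ge> b; x \<in> carrier A\<rbrakk> \<Longrightarrow> nrm A (S s x) \<le> exp (- \<eta> * s) * nrm A x"
proof -
  obtain b \<eta> where b: "b > 0" and \<eta>: "\<eta> > 0"
    and le: "\<And>t. t \<ge> b \<Longrightarrow> nrm Mul (T t) \<le> exp ((lam - \<eta>) * t)"
    using growth_rate_bound[OF growth] by auto
  show ?thesis
  proof (rule that[OF b \<eta>])
    fix s x assume s: "s \<ge> b" and x: "x \<in> carrier A"
    then have s0: "s > 0"
      using b by simp
    have "nrm A (T s x) \<le> nrm Mul (T s) * nrm A x"
      using norm_multiplier[OF T_multiplier[OF s0] x] .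
    also have "\<dots> \<le> exp ((lam - \<eta>) * s) * nrm A x"
      using le[OF s] norm_nonneg[OF x] by (rule mult_right_mono)
    finally have "nrm A (S s x) \<le> exp (- lam * s) * (exp ((lam - \<eta>) * s) * nrm A x)"
      using s0 x by (simp add: norm_S)
    also have "\<dots> = exp (- \<eta> * s) * nrm A x"
      by (simp add: algebra_simps flip: mult.assoc exp_add)
    finally show "nrm A (S s x) \<le> exp (- \<eta> * s) * nrm A x" .
  qed
qed

text \<open>Local boundedness covers a compact range of times and decay the rest. Such a bound need
  not extend down to time 0; the vectors whose orbits are bounded there make up
  \<open>L_ideal A T\<close>.\<close>

lemma S_bounded:
  assumes "d > 0"
  obtains C where "C > 0" "\<And>s x. \<lbrakk>s \<ge> d; x \<in> carrier A\<rbrakk> \<Longrightarrow> nrm A (S s x) \<le> C * nrm A x"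
proof -
  obtain b \<eta> where b: "b > 0" "\<eta> > 0"
    "\<And>s x. \<lbrakk>s \<ge> b; x \<in> carrier A\<rbrakk> \<Longrightarrow> nrm A (S s x) \<le> exp (- \<eta> * s) * nrm A x"
    using S_decay by blast
  obtain C0 where C0: "\<And>t. t \<in> {d..b} \<Longrightarrow> nrm Mul (T t) \<le> C0"
    using T_locally_bounded[OF assms] by blast
  define C where "C = max 1 (exp (\<bar>lam\<bar> * b) * max C0 0)"
  show ?thesis
  proof (rule that)
    show "C > 0"
      by (simp add: C_def)
    fix s x assume s: "s \<ge> d" and x: "x \<in> carrier A"
    then have s0: "s > 0"
      using assms by simp
    show "nrm A (S s x) \<le> C * nrm A x"
    proof (cases "s \<ge> b")
      case True
      have "exp (- \<eta> * s) \<le> C"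
        using b(2) s0 by (simp add: C_def le_max_iff_disj)
      then have "exp (- \<eta> * s) * nrm A x \<le> C * nrm A x"
        using norm_nonneg[OF x] by (rule mult_right_mono)
      then show ?thesis
        using b(3)[OF True x] by simp
    next
      case False
      have "- lam * s \<le> \<bar>lam\<bar> * s"
        using s0 mult_right_mono[of "- lam" "\<bar>lam\<bar>" s] by simp
      also have "\<dots> \<le> \<bar>lam\<bar> * b"
        using False by (intro mult_left_mono) auto
      finally have "exp (- lam * s) \<le> exp (\<bar>lam\<bar> * b)"
        by simp
      moreover have "nrm Mul (T s) \<le> max C0 0"
        using C0[of s] False s by auto
      ultimately have "exp (- lam * s) * nrm Mul (T s) \<le> exp (\<bar>lam\<bar> * b) * max C0 0"
        using norm_multiplier_nonneg[OF T_multiplier[OF s0]] by (intro mult_mono) auto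
      then have "exp (- lam * s) * nrm Mul (T s) \<le> C"
        by (simp add: C_def le_max_iff_disj)
      then have "exp (- lam * s) * nrm Mul (T s) * nrm A x \<le> C * nrm A x"
        using norm_nonneg[OF x] by (rule mult_right_mono)
      moreover have "exp (- lam * s) * nrm A (T s x)
          \<le> exp (- lam * s) * nrm Mul (T s) * nrm A x"
        using norm_multiplier[OF T_multiplier[OF s0] x] by (simp add: mult.assoc)
      ultimately show ?thesis
        unfolding norm_S[OF s0 x] by linarith
    qed
  qed
qed

lemma S_tendsto_zero:
  assumes "t > 0" "x \<in> carrier A"
  shows "(\<lambda>n. nrm A (S (real n * t) x)) \<longlonglongrightarrow> 0"
proof -
  obtain b \<eta> where b: "b > 0" "\<eta> > 0"
    "\<And>s x. \<lbrakk>s \<ge> b; x \<in> carrier A\<rbrakk> \<Longrightarrow> nrm A (S s x) \<le> exp (- \<eta> * s) * nrm A x"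
    using S_decay by blast
  have top: "filterlim (\<lambda>n. real n * t) at_top sequentially"
    using assms(1) by (intro filterlim_at_top_mult_tendsto_pos[OF tendsto_const]
        filterlim_real_sequentially)
  have "filterlim (\<lambda>n. - \<eta> * (real n * t)) at_bot sequentially"
    using b(2) by (intro filterlim_tendsto_neg_mult_at_bot[OF tendsto_const _ top]) simp
  then have "((\<lambda>n. exp (- \<eta> * (real n * t)) * nrm A x) \<longlongrightarrow> 0 * nrm A x) sequentially"
    by (intro tendsto_intros filterlim_compose[OF exp_at_bot])
  then have lim: "(\<lambda>n. exp (- \<eta> * (real n * t)) * nrm A x) \<longlonglongrightarrow> 0"
    by simp
  have "\<forall>\<^sub>F n in sequentially. real n * t \<ge> b"
    using top by (simp add: filterlim_at_top)
  then have "\<forall>\<^sub>F n in sequentially. norm (nrm A (S (real n * t) x)) \<le> exp (- \<eta> * (real n * t)) * nrm A x"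
  proof eventually_elim
    case (elim n)
    then show ?case
      using b(3)[of "real n * t" x] assms by (simp add: norm_nonneg)
  qed
  then show ?thesis
    using lim by (rule Lim_null_comparison)
qed

lemma S_continuous:
  assumes "x \<in> carrier A" "s > 0" "e > 0"
  shows "\<exists>d>0. \<forall>t>0. \<bar>t - s\<bar> < d \<longrightarrow> nrm A (S t x \<ominus> S s x) < e"
proof -
  define f where "f t = exp (- lam * t)" for t
  obtain d1 where d1: "d1 > 0"
    "\<And>t. \<lbrakk>t > 0; \<bar>t - s\<bar> < d1\<rbrakk> \<Longrightarrow> nrm A (T t x \<ominus> T s x) < e / (2 * (f s + 1))"
    using T_continuous[OF assms(1,2), of "e / (2 * (f s + 1))"] assms(3)
    by (auto simp: f_def add_pos_pos)
  \<comment> \<open>Bounds \<open>nrm A (T t x)\<close> for all \<open>t\<close> within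
    \<open>d1\<close> of \<open>s\<close>; it multiplies the change of the scalar factor.\<close>
  define M where "M = nrm A (T s x) + e / (2 * (f s + 1))"
  have fs: "f s > 0"
    by (simp add: f_def)
  have M0: "M > 0"
    using assms fs norm_nonneg[of "T s x"] by (auto simp: M_def intro!: add_nonneg_pos divide_pos_pos)
  have "isCont f s"
    unfolding f_def by (intro continuous_intros)
  then obtain d2 where d2: "d2 > 0" "\<And>t. \<bar>t - s\<bar> < d2 \<Longrightarrow> \<bar>f t - f s\<bar> < e / (2 * M)"
    using assms(3) M0 unfolding continuous_at_eps_delta dist_real_def
    by (metis divide_pos_pos mult_pos_pos zero_less_numeral)
  have "nrm A (S t x \<ominus> S s x) < e" if t: "t > 0" "\<bar>t - s\<bar> < min d1 d2" for t
  proof -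
    have c: "T t x \<in> carrier A" "T s x \<in> carrier A"
      using t assms by auto
    have close: "nrm A (T t x \<ominus> T s x) < e / (2 * (f s + 1))"
      using d1(2) t by simp
    then have bd: "nrm A (T t x) \<le> M"
      using norm_le_add_minus[OF c] by (simp add: M_def)
    have "S t x \<ominus> S s x = (complex_of_real (f t - f s) \<odot> T t x) \<oplus> (complex_of_real (f s) \<odot> (T t x \<ominus> T s x))"
    proof -
      have "S t x \<ominus> S s x = (complex_of_real (f t) \<odot> T t x \<ominus> complex_of_real (f s) \<odot> T t x)
          \<oplus> (complex_of_real (f s) \<odot> T t x \<ominus> complex_of_real (f s) \<odot> T s x)"
        using c t assms by (simp add: S_def f_def minus_add_minus)
      also have "complex_of_real (f t) \<odot> T t x \<ominus> complex_of_real (f s) \<odot> T t x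
          = complex_of_real (f t - f s) \<odot> T t x"
        using c scal_add_left[of "T t x" "complex_of_real (f t)" "- complex_of_real (f s)"]
        by (simp add: minus_alt scal_scal)
      finally show ?thesis
        using c by (simp add: scal_minus_right)
    qed
    then have "nrm A (S t x \<ominus> S s x) \<le> \<bar>f t - f s\<bar> * nrm A (T t x) + f s * nrm A (T t x \<ominus> T s x)"
      using norm_triangle[of "complex_of_real (f t - f s) \<odot> T t x"
          "complex_of_real (f s) \<odot> (T t x \<ominus> T s x)"] c fs
      by (simp add: norm_smult del: of_real_diff)
    also have "\<bar>f t - f s\<bar> * nrm A (T t x) \<le> \<bar>f t - f s\<bar> * M"
      using bd by (intro mult_left_mono) auto
    also have "\<bar>f t - f s\<bar> * M < e / 2"
      using d2(2)[of t] t M0 by (simp add: field_simps)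
    also have "f s * nrm A (T t x \<ominus> T s x) \<le> (f s + 1) * nrm A (T t x \<ominus> T s x)"
      using c by (intro mult_right_mono norm_nonneg) auto
    also have "\<dots> < e / 2"
      using close fs by (simp add: field_simps)
    finally show ?thesis
      by simp
  qed
  then show ?thesis
    using d1(1) d2(1) by (intro exI[of _ "min d1 d2"]) auto
qed

text \<open>The scalar \<open>exp (lam * t)\<close> is absorbed into the argument, so rescaling
  leaves the ranges unchanged.\<close>

lemma S_dense:
  assumes "x \<in> carrier A" "e > 0"
  shows "\<exists>t>0. \<exists>a\<in>carrier A. nrm A (x \<ominus> S t a) < e"
proof -
  obtain t a where t: "t > 0" "a \<in> carrier A" "nrm A (x \<ominus> T t a) < e"
  proof -
    have "\<exists>y\<in>(\<Union>t\<in>{0<..}. T t ` carrier A). nrm A (x \<ominus> y) < e"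
      using dense_range assms unfolding dense_in_iff by blast
    then show ?thesis
      using that by (auto simp: greaterThan_iff)
  qed
  have "T t a = S t (complex_of_real (exp (lam * t)) \<odot> a)"
    using t by (simp add: S_def multiplier_smult scal_scal flip: of_real_mult exp_add)
  then show ?thesis
    using t by (intro exI[of _ t] conjI bexI[of _ "complex_of_real (exp (lam * t)) \<odot> a"]) auto
qed

lemma lambda_norm_eq:
  assumes "u \<in> carrier A"
  shows "lambda_norm A T lam u = (SUP s\<in>{0..}. nrm A (S s u))"
  unfolding lambda_norm_def using assms by (intro SUP_cong) (auto simp: S_def norm_smult)

text \<open>By \<open>S_bounded\<close>, only times near 0 can make an orbit unbounded, and there
  the factor \<open>exp (- lam * s)\<close> lies between positive constants. A condition on
  \<open>T\<close> at 0 thus becomes one on the whole rescaled orbit, and the set does not depend on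
  \<open>lam\<close>.\<close>

lemma L_ideal_iff:
  "u \<in> L_ideal A T \<longleftrightarrow> u \<in> carrier A \<and> bdd_above ((\<lambda>s. nrm A (S s u)) ` {0..})"
proof
  assume "u \<in> L_ideal A T"
  then have u: "u \<in> carrier A" and lim: "Limsup (at_right 0) (\<lambda>t. ereal (nrm A (T t u))) < \<infinity>"
    by (auto simp: L_ideal_def)
  obtain C where C: "Limsup (at_right 0) (\<lambda>t. ereal (nrm A (T t u))) < ereal C"
    using ereal_dense2[OF lim] by blast
  then have "\<forall>\<^sub>F t in at_right 0. ereal (nrm A (T t u)) < ereal C"
    by (rule Limsup_lessD)
  then obtain d where d: "d > 0" "\<And>t. \<lbrakk>t > 0; t < d\<rbrakk> \<Longrightarrow> nrm A (T t u) < C"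
    by (auto simp: eventually_at_right_field)
  obtain C' where C': "C' > 0" "\<And>s. s \<ge> d \<Longrightarrow> nrm A (S s u) \<le> C' * nrm A u"
    using S_bounded[OF d(1)] u by metis
  have "nrm A (S s u) \<le> max (nrm A u) (max (exp (\<bar>lam\<bar> * d) * C) (C' * nrm A u))" if s: "s \<ge> 0" for s
  proof -
    consider "s = 0" | "0 < s" "s < d" | "s \<ge> d"
      using s by linarith
    then show ?thesis
    proof cases
      case 2
      have "- lam * s \<le> \<bar>lam\<bar> * s"
        using 2 mult_right_mono[of "- lam" "\<bar>lam\<bar>" s] by simp
      also have "\<dots> \<le> \<bar>lam\<bar> * d"
        using 2 by (intro mult_left_mono) auto
      finally have "exp (- lam * s) \<le> exp (\<bar>lam\<bar> * d)"
        by simp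
      then have "exp (- lam * s) * nrm A (T s u) \<le> exp (\<bar>lam\<bar> * d) * C"
        using d(2)[OF 2] 2 u by (intro mult_mono) (auto simp: norm_nonneg)
      then show ?thesis
        using 2 u by (simp add: norm_S le_max_iff_disj)
    qed (use C'(2) in \<open>auto simp: le_max_iff_disj\<close>)
  qed
  then show "u \<in> carrier A \<and> bdd_above ((\<lambda>s. nrm A (S s u)) ` {0..})"
    using u by (auto intro!: bdd_aboveI2)
next
  assume u: "u \<in> carrier A \<and> bdd_above ((\<lambda>s. nrm A (S s u)) ` {0..})"
  then obtain C where C: "\<And>s. s \<ge> 0 \<Longrightarrow> nrm A (S s u) \<le> C"
    by (auto simp: bdd_above_def)
  have "\<forall>\<^sub>F t in at_right 0. ereal (nrm A (T t u)) \<le> ereal (exp \<bar>lam\<bar> * C)"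
    unfolding eventually_at_right_field
  proof (intro exI conjI allI impI)
    fix t :: real assume t: "0 < t" "t < 1"
    have "lam * t \<le> \<bar>lam\<bar> * t"
      using t by (intro mult_right_mono) auto
    also have "\<dots> \<le> \<bar>lam\<bar> * 1"
      using t by (intro mult_left_mono) auto
    finally have "exp (lam * t) * nrm A (S t u) \<le> exp \<bar>lam\<bar> * C"
      using C[of t] t u by (intro mult_mono) (auto simp: norm_nonneg)
    moreover have "exp (lam * t) * nrm A (S t u) = nrm A (T t u)"
      using t u by (simp add: norm_S flip: mult.assoc exp_add)
    ultimately show "ereal (nrm A (T t u)) \<le> ereal (exp \<bar>lam\<bar> * C)"
      by simp
  qed simp
  then have "Limsup (at_right 0) (\<lambda>t. ereal (nrm A (T t u))) \<le> ereal (exp \<bar>lam\<bar> * C)"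
    by (rule Limsup_bounded)
  then show "u \<in> L_ideal A T"
    using u by (auto simp: L_ideal_def intro: le_less_trans)
qed

abbreviation "L \<equiv> L_alg A T lam"

lemma L_carrier [simp]: "carrier L = L_ideal A T"
  by (simp add: L_alg_def)

lemma L_ops [simp]:
  "x \<oplus>\<^bsub>L\<^esub> y = x \<oplus> y" "x \<otimes>\<^bsub>L\<^esub> y = x \<otimes> y" "c \<odot>\<^bsub>L\<^esub> x = c \<odot> x" "\<zero>\<^bsub>L\<^esub> = \<zero>"
  by (simp_all add: L_alg_def)

lemma L_norm_eq: "u \<in> carrier A \<Longrightarrow> nrm L u = (SUP s\<in>{0..}. nrm A (S s u))"
  by (simp add: L_alg_def lambda_norm_eq)

lemma L_closed: "u \<in> L_ideal A T \<Longrightarrow> u \<in> carrier A"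
  by (simp add: L_ideal_iff)

lemma L_norm_upper: "\<lbrakk>u \<in> L_ideal A T; s \<ge> 0\<rbrakk> \<Longrightarrow> nrm A (S s u) \<le> nrm L u"
  unfolding L_ideal_iff by (auto simp: L_norm_eq intro: cSUP_upper)

lemma L_norm_ge: "u \<in> L_ideal A T \<Longrightarrow> nrm A u \<le> nrm L u"
  using L_norm_upper[of u 0] by simp

lemma L_idealI:
  "\<lbrakk>u \<in> carrier A; \<And>s. s \<ge> 0 \<Longrightarrow> nrm A (S s u) \<le> C\<rbrakk> \<Longrightarrow> u \<in> L_ideal A T"
  by (auto simp: L_ideal_iff intro!: bdd_aboveI2)

lemma L_norm_least:
  "\<lbrakk>u \<in> carrier A; \<And>s. s \<ge> 0 \<Longrightarrow> nrm A (S s u) \<le> C\<rbrakk> \<Longrightarrow> nrm L u \<le> C"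
  by (auto simp: L_norm_eq intro!: cSUP_least)

lemma L_ideal_zero: "\<zero> \<in> L_ideal A T"
  by (rule L_idealI[of _ 0]) (auto simp: S_zero)

lemma L_ideal_add:
  assumes "u \<in> L_ideal A T" "v \<in> L_ideal A T"
  shows "u \<oplus> v \<in> L_ideal A T" "nrm L (u \<oplus> v) \<le> nrm L u + nrm L v"
proof -
  have "nrm A (S s (u \<oplus> v)) \<le> nrm L u + nrm L v" if "s \<ge> 0" for s
    using norm_triangle[of "S s u" "S s v"] L_norm_upper[OF assms(1) that]
      L_norm_upper[OF assms(2) that] assms that by (simp add: S_plus L_closed)
  then show "u \<oplus> v \<in> L_ideal A T" "nrm L (u \<oplus> v) \<le> nrm L u + nrm L v"
    using assms by (auto intro: L_idealI L_norm_least L_closed)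
qed

text \<open>\<open>R\<close> commutes with the semigroup, so the orbit of \<open>R u\<close> is the
  image under \<open>R\<close> of the orbit of \<open>u\<close>.\<close>

lemma L_ideal_multiplier:
  assumes "u \<in> L_ideal A T" "R \<in> carrier Mul"
  shows "R u \<in> L_ideal A T" "nrm L (R u) \<le> nrm Mul R * nrm L u"
proof -
  have u: "u \<in> carrier A"
    using assms(1) by (rule L_closed)
  have "nrm A (S s (R u)) \<le> nrm Mul R * nrm L u" if "s \<ge> 0" for s
  proof -
    have "nrm A (S s (R u)) \<le> nrm Mul R * nrm A (S s u)"
      using norm_multiplier[OF assms(2), of "S s u"] u that assms(2)
      by (simp add: S_commute_multiplier)
    also have "\<dots> \<le> nrm Mul R * nrm L u"
      using L_norm_upper[OF assms(1) that] norm_multiplier_nonneg[OF assms(2)]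
      by (intro mult_left_mono)
    finally show ?thesis .
  qed
  then show "R u \<in> L_ideal A T" "nrm L (R u) \<le> nrm Mul R * nrm L u"
    using assms u by (auto intro: L_idealI L_norm_least)
qed

text \<open>The second factor is measured in the norm of \<open>A\<close>. This gives the ideal
  property and, later, contractivity of the inclusion of \<open>A\<close> in the multipliers of
  \<open>L\<close>.\<close>

lemma L_ideal_mult:
  assumes "u \<in> L_ideal A T" "v \<in> carrier A"
  shows "u \<otimes> v \<in> L_ideal A T" "nrm L (u \<otimes> v) \<le> nrm L u * nrm A v"
proof -
  have "nrm A (S s (u \<otimes> v)) \<le> nrm L u * nrm A v" if "s \<ge> 0" for s
  proof -
    have "nrm A (S s (u \<otimes> v)) \<le> nrm A (S s u) * nrm A v"
      using nrm_mult[of "S s u" v] assms that by (simp add: S_mult L_closed)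
    also have "\<dots> \<le> nrm L u * nrm A v"
      using L_norm_upper[OF assms(1) that] norm_nonneg[OF assms(2)] by (rule mult_right_mono)
    finally show ?thesis .
  qed
  then show "u \<otimes> v \<in> L_ideal A T" "nrm L (u \<otimes> v) \<le> nrm L u * nrm A v"
    using assms by (auto intro: L_idealI L_norm_least L_closed)
qed

lemma L_ideal_smult:
  assumes "u \<in> L_ideal A T"
  shows "c \<odot> u \<in> L_ideal A T" "nrm L (c \<odot> u) = cmod c * nrm L u"
proof -
  have u: "u \<in> carrier A"
    using assms by (rule L_closed)
  have le: "nrm A (S s (c \<odot> v)) \<le> cmod c * nrm L v" if "s \<ge> 0" "v \<in> L_ideal A T" for s c v
    using L_norm_upper[OF that(2,1)] that
    by (simp add: S_smult norm_smult mult_left_mono L_closed)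
  show cu: "c \<odot> u \<in> L_ideal A T"
    using le[OF _ assms, of _ c] u by (auto intro: L_idealI)
  show "nrm L (c \<odot> u) = cmod c * nrm L u"
  proof (rule antisym)
    show "nrm L (c \<odot> u) \<le> cmod c * nrm L u"
      using le[OF _ assms, of _ c] u by (auto intro: L_norm_least)
    show "cmod c * nrm L u \<le> nrm L (c \<odot> u)"
    proof (cases "c = 0")
      case True
      then show ?thesis
        using L_norm_ge[OF cu] u by simp
    next
      case False
      have "nrm L (inverse c \<odot> (c \<odot> u)) \<le> cmod (inverse c) * nrm L (c \<odot> u)"
        using le[OF _ cu, of _ "inverse c"] u by (auto intro!: L_norm_least)
      then have "nrm L u \<le> nrm L (c \<odot> u) / cmod c"
        using False u by (simp add: scal_scal norm_inverse inverse_eq_divide norm_divide)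
      then show ?thesis
        using False by (simp add: pos_le_divide_eq mult.commute)
    qed
  qed
qed

lemma L_normed_space: "normed_space L"
  unfolding normed_space_def normed_space_axioms_def
proof (intro conjI allI impI)
  show "module complex_ring L"
    unfolding L_alg_def by (rule subspace_module)
      (auto intro: L_closed L_ideal_zero L_ideal_add L_ideal_smult)
  fix u assume "u \<in> carrier L"
  then have u: "u \<in> L_ideal A T"
    by simp
  have "0 \<le> nrm A u"
    using L_closed[OF u] by (rule norm_nonneg)
  then show "0 \<le> nrm L u"
    using L_norm_ge[OF u] by linarith
  show "nrm L u = 0 \<longleftrightarrow> u = \<zero>\<^bsub>L\<^esub>"
  proof
    assume "nrm L u = 0"
    then have "nrm A u = 0"
      using L_norm_ge[OF u] \<open>0 \<le> nrm A u\<close> by simp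
    then show "u = \<zero>\<^bsub>L\<^esub>"
      using L_closed[OF u] by (simp add: norm_eq_zero_iff)
  next
    assume "u = \<zero>\<^bsub>L\<^esub>"
    then have "nrm L u \<le> 0"
      by (intro L_norm_least) (auto simp: S_zero)
    then show "nrm L u = 0"
      using \<open>0 \<le> nrm L u\<close> by simp
  qed
qed (auto simp: L_ideal_add L_ideal_smult)

lemma L_minus:
  assumes "x \<in> L_ideal A T" "y \<in> L_ideal A T"
  shows "x \<ominus>\<^bsub>L\<^esub> y = x \<ominus> y"
  using minus_carrier_update[OF normed_space_axioms L_normed_space[unfolded L_alg_def]] assms L_closed
  by (auto simp: L_alg_def)

lemma L_ideal_minus:
  assumes "x \<in> L_ideal A T" "y \<in> L_ideal A T"
  shows "x \<ominus> y \<in> L_ideal A T"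
  using assms by (simp add: minus_alt L_closed L_ideal_add L_ideal_smult)

text \<open>The norm of \<open>L\<close> dominates that of \<open>A\<close>, so a Cauchy sequence
  converges in \<open>A\<close>. Its Cauchy estimate passes to the limit at each time
  \<open>s\<close> with a bound independent of \<open>s\<close>; this puts the limit into the ideal
  and gives convergence in the norm of \<open>L\<close>.\<close>

lemma L_banach_algebra: "banach_algebra L"
proof -
  interpret L: normed_space L
    by (rule L_normed_space)
  have "L.met.mcomplete"
  proof (rule L.completeI)
    fix f :: "nat \<Rightarrow> 'a"
    assume "\<And>n. f n \<in> carrier L"
      and Cauchy: "\<And>e. e > 0 \<Longrightarrow> \<exists>N. \<forall>m\<ge>N. \<forall>n\<ge>N. nrm L (f m \<ominus>\<^bsub>L\<^esub> f n) < e"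
    then have f: "f n \<in> L_ideal A T" for n
      by simp
    have fA: "f n \<in> carrier A" for n
      using L_closed[OF f] .
    have "\<exists>N. \<forall>m\<ge>N. \<forall>n\<ge>N. nrm A (f m \<ominus> f n) < e" if e: "e > 0" for e
    proof -
      obtain N where N: "\<And>m n. \<lbrakk>m \<ge> N; n \<ge> N\<rbrakk> \<Longrightarrow> nrm L (f m \<ominus> f n) < e"
        using Cauchy[OF e] by (auto simp: L_minus f)
      have "nrm A (f m \<ominus> f n) < e" if "m \<ge> N" "n \<ge> N" for m n
        using N[OF that] L_norm_ge[OF L_ideal_minus[OF f f], of m n] by simp
      then show ?thesis
        by blast
    qed
    then obtain l where l: "converges f l"
      using Cauchy_converges[of f] fA by blast
    then have lA: "l \<in> carrier A"
      by (rule converges_closed)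
    have close: "\<exists>N. \<forall>n\<ge>N. \<forall>s\<ge>0. nrm A (S s (f n \<ominus> l)) \<le> e" if e: "e > 0" for e
    proof -
      obtain N where N: "\<And>m n. \<lbrakk>m \<ge> N; n \<ge> N\<rbrakk> \<Longrightarrow> nrm L (f m \<ominus> f n) < e"
        using Cauchy[OF e] by (auto simp: L_minus f)
      have "nrm A (S s (f n \<ominus> l)) \<le> e" if n: "n \<ge> N" and s: "s \<ge> 0" for n s
      proof -
        have conv: "converges (\<lambda>m. S s (f m)) (S s l)"
        proof (cases "s = 0")
          case False
          then show ?thesis
            using s l by (simp add: S_def converges_smult converges_multiplier)
        qed (simp add: l)
        have "nrm A (S s (f n) \<ominus> S s l) \<le> e"
        proof (rule converges_norm_minus_le[OF conv])
          show "\<forall>\<^sub>F m in sequentially. nrm A (S s (f n) \<ominus> S s (f m)) \<le> e"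
            unfolding eventually_sequentially
          proof (intro exI allI impI)
            fix m assume "N \<le> m"
            then show "nrm A (S s (f n) \<ominus> S s (f m)) \<le> e"
              using N[OF n, of m] L_norm_upper[OF L_ideal_minus[OF f f] s, of n m] s fA
              by (simp add: S_minus)
          qed
        qed (use s fA in auto)
        then show ?thesis
          using s fA lA by (simp add: S_minus)
      qed
      then show ?thesis
        by blast
    qed
    have lL: "l \<in> L_ideal A T"
    proof -
      obtain N where N: "\<And>s. s \<ge> 0 \<Longrightarrow> nrm A (S s (f N \<ominus> l)) \<le> 1"
        using close[of 1] by auto
      show ?thesis
      proof (rule L_idealI[OF lA])
        fix s :: real assume s: "s \<ge> 0"
        show "nrm A (S s l) \<le> 1 + nrm L (f N)"
          using N[OF s] L_norm_upper[OF f s, of N] norm_le_add_minus[of "S s l" "S s (f N)"]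
            norm_minus_commute[of "S s l" "S s (f N)"] s fA lA by (simp add: S_minus)
      qed
    qed
    have "\<exists>N. \<forall>n\<ge>N. nrm L (f n \<ominus> l) \<le> e" if e: "e > 0" for e
    proof -
      obtain N where N: "\<And>n s. \<lbrakk>n \<ge> N; s \<ge> 0\<rbrakk> \<Longrightarrow> nrm A (S s (f n \<ominus> l)) \<le> e"
        using close[OF e] by blast
      have "nrm L (f n \<ominus> l) \<le> e" if "n \<ge> N" for n
        using N[OF that] fA lA by (intro L_norm_least) auto
      then show ?thesis
        by blast
    qed
    then show "\<exists>l\<in>carrier L. \<forall>e>0. \<exists>N. \<forall>n\<ge>N. nrm L (f n \<ominus>\<^bsub>L\<^esub> l) \<le> e"
      using lL by (auto simp: L_minus f intro!: bexI[of _ l])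
  qed
  moreover have "nrm L (u \<otimes> v) \<le> nrm L u * nrm L v" if u: "u \<in> L_ideal A T" and v: "v \<in> L_ideal A T" for u v
  proof -
    have "nrm L u * nrm A v \<le> nrm L u * nrm L v"
      using L_norm_ge[OF v] u by (intro mult_left_mono L.norm_nonneg) auto
    then show ?thesis
      using L_ideal_mult(2)[OF u L_closed[OF v]] by simp
  qed
  ultimately show ?thesis
    by unfold_locales (auto simp: L_ideal_mult L_closed mult_assoc distr_left distr_right
        smult_mult_left smult_mult_right L.norm_nonneg L.norm_eq_zero_iff[simplified]
        L_ideal_add L_ideal_smult)
qed

text \<open>Up to a scalar, the orbit of \<open>T t x\<close> is the orbit of \<open>x\<close> from
  time \<open>t\<close> on, where it is bounded.\<close>

lemma T_range_subset_L: "(\<Union>t\<in>{0<..}. T t ` carrier A) \<subseteq> L_ideal A T"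
proof (clarsimp)
  fix t :: real and x assume t: "t > 0" and x: "x \<in> carrier A"
  obtain C where C: "C > 0" "\<And>s. s \<ge> t \<Longrightarrow> nrm A (S s x) \<le> C * nrm A x"
    using S_bounded[OF t] x by metis
  have "T t x = S t (complex_of_real (exp (lam * t)) \<odot> x)"
    using t x by (simp add: S_def multiplier_smult scal_scal flip: of_real_mult exp_add)
  then have *: "S s (T t x) = complex_of_real (exp (lam * t)) \<odot> S (s + t) x" if "s \<ge> 0" for s
    using t x that by (simp add: S_smult flip: S_add)
  show "T t x \<in> L_ideal A T"
  proof (rule L_idealI)
    show "nrm A (S s (T t x)) \<le> exp (lam * t) * (C * nrm A x)" if "s \<ge> 0" for s
      using C(2)[of "s + t"] that x t by (simp add: * norm_smult)
  qed (use t x in auto)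
qed

lemma L_dense: "dense_in A (L_ideal A T)"
  using dense_range T_range_subset_L L_closed unfolding dense_in_iff by (meson subsetD subsetI)

text \<open>An element annihilating the ideal annihilates a dense subset of \<open>A\<close>, hence
  vanishes.\<close>

lemma L_weakly_cancellative: "weakly_cancellative_algebra L"
proof -
  have zero: "u = \<zero>" if "u \<in> carrier A" "\<And>x. x \<in> L_ideal A T \<Longrightarrow> u \<otimes> x = \<zero>" for u
    using that L_dense by (intro mult_eq_zero_dense[of u "L_ideal A T"]) auto
  show ?thesis
    unfolding weakly_cancellative_algebra_def weakly_cancellative_algebra_axioms_def
  proof (intro conjI allI impI)
    show "banach_algebra L"
      by (rule L_banach_algebra)
    show "carrier L \<noteq> {\<zero>\<^bsub>L\<^esub>}"
    proof
      assume "carrier L = {\<zero>\<^bsub>L\<^esub>}"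
      then have "\<forall>u\<in>carrier A. u = \<zero>"
        using zero by auto
      then show False
        using nonzero M.zero_closed by blast
    qed
    fix u assume u: "u \<in> carrier L - {\<zero>\<^bsub>L\<^esub>}"
    show "(\<lambda>x. u \<otimes>\<^bsub>L\<^esub> x) ` carrier L \<noteq> {\<zero>\<^bsub>L\<^esub>}"
    proof
      assume "(\<lambda>x. u \<otimes>\<^bsub>L\<^esub> x) ` carrier L = {\<zero>\<^bsub>L\<^esub>}"
      then have "\<And>x. x \<in> L_ideal A T \<Longrightarrow> u \<otimes> x = \<zero>"
        by auto
      then show False
        using zero[of u] u L_closed by auto
    qed
  next
    fix x y assume "x \<in> carrier L" "y \<in> carrier L"
    then show "x \<otimes>\<^bsub>L\<^esub> y = y \<otimes>\<^bsub>L\<^esub> x"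
      by (simp add: L_closed mult_comm)
  qed
qed

end

section \<open>Independence of the choice of lambda\<close>

text \<open>Up to time \<open>b\<close> the two weights differ by a factor of at most
  \<open>exp (\<bar>lam - mu\<bar> * b)\<close>; after \<open>b\<close> the orbit rescaled by
  \<open>mu\<close> has decayed below \<open>nrm A u\<close>, which the other norm
  dominates.\<close>

lemma L_norm_le:
  assumes "growth_semigroup A T lam" "growth_semigroup A T mu"
  obtains C where "\<And>u. u \<in> L_ideal A T \<Longrightarrow> nrm (L_alg A T mu) u \<le> C * nrm (L_alg A T lam) u"
proof -
  interpret l: growth_semigroup A T lam by fact
  interpret m: growth_semigroup A T mu by fact
  obtain b \<eta> where b: "b > 0" "\<eta> > 0"
    "\<And>s x. \<lbrakk>s \<ge> b; x \<in> carrier A\<rbrakk> \<Longrightarrow> nrm A (m.S s x) \<le> exp (- \<eta> * s) * nrm A x"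
    using m.S_decay by blast
  have "nrm (L_alg A T mu) u \<le> exp (\<bar>lam - mu\<bar> * b) * nrm (L_alg A T lam) u"
    if u: "u \<in> L_ideal A T" for u
  proof (rule m.L_norm_least)
    show uA: "u \<in> carrier A"
      using u by (rule l.L_closed)
    have pos: "nrm A u \<le> nrm (L_alg A T lam) u" "0 \<le> nrm A u"
      using l.L_norm_ge[OF u] l.norm_nonneg[OF uA] by auto
    fix s :: real assume s: "s \<ge> 0"
    have one: "1 \<le> exp (\<bar>lam - mu\<bar> * b)"
      using b by simp
    consider "s = 0" | "0 < s" "s < b" | "s \<ge> b"
      using s by linarith
    then show "nrm A (m.S s u) \<le> exp (\<bar>lam - mu\<bar> * b) * nrm (L_alg A T lam) u"
    proof cases
      case 1
      then show ?thesis
        using mult_mono[OF one pos(1)] pos by simp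
    next
      case 2
      have "exp (- mu * s) = exp ((lam - mu) * s) * exp (- lam * s)"
        by (simp add: algebra_simps flip: exp_add)
      then have "nrm A (m.S s u) = exp ((lam - mu) * s) * nrm A (l.S s u)"
        using 2 uA by (simp add: m.norm_S l.norm_S)
      also have "\<dots> \<le> exp (\<bar>lam - mu\<bar> * b) * nrm (L_alg A T lam) u"
      proof (rule mult_mono)
        have "(lam - mu) * s \<le> \<bar>lam - mu\<bar> * s"
          using 2 by (intro mult_right_mono) auto
        also have "\<dots> \<le> \<bar>lam - mu\<bar> * b"
          using 2 by (intro mult_left_mono) auto
        finally show "exp ((lam - mu) * s) \<le> exp (\<bar>lam - mu\<bar> * b)"
          by simp
        show "nrm A (l.S s u) \<le> nrm (L_alg A T lam) u"
          using u s by (rule l.L_norm_upper)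
      qed (use uA s in \<open>auto simp: l.norm_nonneg\<close>)
      finally show ?thesis .
    next
      case 3
      have "exp (- \<eta> * s) * nrm A u \<le> 1 * nrm A u"
        using b s pos by (intro mult_right_mono) auto
      then have "nrm A (m.S s u) \<le> nrm A u"
        using b(3)[OF 3 uA] by simp
      then show ?thesis
        using mult_mono[OF one pos(1)] pos by simp
    qed
  qed
  then show ?thesis
    using that by blast
qed

lemma norm_top_L_alg_eq:
  assumes "growth_semigroup A T lam" "growth_semigroup A T mu"
  shows "norm_top (L_alg A T mu) = norm_top (L_alg A T lam)"
proof -
  have cont: "continuous_map (norm_top (L_alg A T a)) (norm_top (L_alg A T b)) (\<lambda>x. x)"
    if a: "growth_semigroup A T a" and b: "growth_semigroup A T b" for a b
  proof -
    interpret a: growth_semigroup A T a by fact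
    interpret b: growth_semigroup A T b by fact
    obtain C where C: "\<And>u. u \<in> L_ideal A T \<Longrightarrow> nrm (L_alg A T b) u \<le> C * nrm (L_alg A T a) u"
      using L_norm_le[OF a b] by blast
    show ?thesis
      using a.L_normed_space b.L_normed_space
    proof (rule normed_space_continuous_mapI)
      show "nrm (L_alg A T b) (x \<ominus>\<^bsub>L_alg A T b\<^esub> y) \<le> C * nrm (L_alg A T a) (x \<ominus>\<^bsub>L_alg A T a\<^esub> y)"
        if "x \<in> carrier (L_alg A T a)" "y \<in> carrier (L_alg A T a)" for x y
        using that C[OF a.L_ideal_minus] by (simp add: a.L_minus b.L_minus)
    qed simp
  qed
  interpret l: growth_semigroup A T lam by fact
  interpret m: growth_semigroup A T mu by fact
  have top: "topspace (norm_top (L_alg A T lam)) = L_ideal A T" "topspace (norm_top (L_alg A T mu)) = L_ideal A T"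
    using normed_space.topspace_norm_top[OF l.L_normed_space]
      normed_space.topspace_norm_top[OF m.L_normed_space] by simp_all
  have "openin (norm_top (L_alg A T mu)) U \<longleftrightarrow> openin (norm_top (L_alg A T lam)) U" for U
  proof -
    have "{x \<in> L_ideal A T. x \<in> U} = U" if "U \<subseteq> L_ideal A T"
      using that by auto
    then show ?thesis
      using cont[OF assms] cont[OF assms(2,1)] top openin_subset
      unfolding continuous_map_def by metis
  qed
  then show ?thesis
    by (simp add: topology_eq)
qed

section \<open>Elements of \<open>\<Omega>(A) \<inter> L\<^sub>T\<close>\<close>

text \<open>Baire's theorem is applied in the closure of \<open>E\<close> and not in the whole
  space, because the conditions are known to be attainable by small perturbations only at points of
  \<open>E\<close>. The set \<open>E\<close> may be neither closed nor linear.\<close>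

lemma (in banach_algebra) Baire_generic_point:
  assumes E: "E \<subseteq> carrier A" "E \<noteq> {}"
    and op: "\<And>(n::nat) x. \<lbrakk>x \<in> carrier A; P n x\<rbrakk>
      \<Longrightarrow> \<exists>d>0. \<forall>y\<in>carrier A. nrm A (x \<ominus> y) < d \<longrightarrow> P n y"
    and ds: "\<And>n x e. \<lbrakk>x \<in> E; e > 0\<rbrakk> \<Longrightarrow> \<exists>y\<in>E. nrm A (x \<ominus> y) < e \<and> P n y"
  shows "\<exists>x\<in>carrier A. \<forall>n. P n x"
proof -
  define K where "K = met.mtopology closure_of E"
  have K: "K \<subseteq> carrier A" "closedin met.mtopology K"
    using closure_of_subset_topspace[of met.mtopology E] by (simp_all add: K_def)
  have EK: "E \<subseteq> K"
    using closure_of_subset[of E met.mtopology] E by (simp add: K_def)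
  interpret sub: Submetric "carrier A" "norm_dist A" K
    using K(1) by unfold_locales
  have K_iff: "x \<in> K \<longleftrightarrow> x \<in> carrier A \<and> (\<forall>e>0. \<exists>y\<in>E. nrm A (x \<ominus> y) < e)" for x
    using in_closure_iff[OF E(1), of x] by (simp add: K_def norm_top_eq)
  have ball: "y \<in> sub.sub.mball x d \<longleftrightarrow> x \<in> K \<and> y \<in> K \<and> nrm A (x \<ominus> y) < d" for x y d
    using K(1) by (auto simp: sub.sub.in_mball norm_dist_eq subset_iff)
  define G where "G n = {x \<in> K. P n x}" for n
  have "openin sub.sub.mtopology (G n)" for n
    unfolding sub.sub.openin_mtopology
  proof (intro conjI allI impI)
    fix x assume "x \<in> G n"
    then have x: "x \<in> K" "P n x"
      by (auto simp: G_def)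
    then obtain d where "d > 0" "\<forall>y\<in>carrier A. nrm A (x \<ominus> y) < d \<longrightarrow> P n y"
      using op[of x n] K(1) by blast
    then show "\<exists>r>0. sub.sub.mball x r \<subseteq> G n"
      using K(1) x by (intro exI[of _ d] conjI subsetI) (auto simp: G_def ball simp del: sub.sub.in_mball)
  qed (auto simp: G_def)
  moreover have "sub.sub.mtopology closure_of (G n) = K" for n
  proof -
    have "\<exists>y\<in>G n. y \<in> sub.sub.mball x r" if x: "x \<in> K" and r: "r > 0" for x r
    proof -
      \<comment> \<open>A point of the closure is first replaced by one of \<open>E\<close>, where
        the perturbation is available.\<close>
      obtain y where y: "y \<in> E" "nrm A (x \<ominus> y) < r / 2"
        using x r unfolding K_iff by (meson half_gt_zero)
      obtain z where z: "z \<in> E" "nrm A (y \<ominus> z) < r / 2" "P n z"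
        using ds[OF y(1), of "r / 2" n] r by auto
      have "x \<in> carrier A" "y \<in> carrier A" "z \<in> carrier A"
        using x y z K(1) E(1) by auto
      then have "nrm A (x \<ominus> z) < r"
        using norm_minus_triangle[of x y z] y(2) z(2) by simp
      then show ?thesis
        using z x EK by (intro bexI[of _ z]) (auto simp: ball G_def simp del: sub.sub.in_mball)
    qed
    then show ?thesis
      unfolding sub.sub.metric_closure_of by auto
  qed
  moreover have "sub.sub.mcomplete"
    using K(2) complete by (rule sub.closedin_mcomplete_imp_mcomplete)
  ultimately have "sub.sub.mtopology closure_of \<Inter>(range G) = K"
    by (intro sub.sub.metric_Baire_category) auto
  then have "\<Inter>(range G) \<noteq> {}"
    using E(2) EK by (metis closure_of_empty subset_empty)
  then show ?thesis
    using K(1) by (auto simp: G_def)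
qed

section \<open>Multipliers with dense range\<close>

context banach_algebra
begin

definition dense_multiplier :: "('a \<Rightarrow> 'a) \<Rightarrow> bool"
  where "dense_multiplier R \<longleftrightarrow> R \<in> carrier Mul \<and>
    (\<forall>x\<in>carrier A. \<forall>e>0. \<exists>z\<in>carrier A. nrm A (x \<ominus> R z) < e)"

text \<open>Continuity of \<open>R\<close> lets the preimage be taken from any dense
  \<open>D\<close>. It is applied with \<open>D\<close> the range of a second multiplier and with
  \<open>D\<close> a dense principal ideal.\<close>

lemma approx_multiplier:
  assumes R: "R \<in> carrier Mul" and D: "D \<subseteq> carrier A"
    and x: "x \<in> carrier A" and e: "e > 0"
    and appR: "\<And>e. e > 0 \<Longrightarrow> \<exists>z\<in>carrier A. nrm A (x \<ominus> R z) < e"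
    and appD: "\<And>z e. \<lbrakk>z \<in> carrier A; e > 0\<rbrakk> \<Longrightarrow> \<exists>y\<in>D. nrm A (z \<ominus> y) < e"
  shows "\<exists>y\<in>D. nrm A (x \<ominus> R y) < e"
proof -
  obtain z where z: "z \<in> carrier A" "nrm A (x \<ominus> R z) < e / 2"
    using appR[of "e / 2"] e by auto
  obtain d where d: "d > 0" "\<And>r. \<lbrakk>0 \<le> r; r < d\<rbrakk> \<Longrightarrow> nrm Mul R * r < e / 2"
    using ex_small_factor[of "e / 2"] e by auto
  then obtain y where y: "y \<in> D" "nrm A (z \<ominus> y) < d"
    using appD[OF z(1)] by blast
  then have yc: "y \<in> carrier A"
    using D by auto
  have "nrm A (R z \<ominus> R y) \<le> nrm Mul R * nrm A (z \<ominus> y)"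
    using norm_multiplier[OF R, of "z \<ominus> y"] z yc R by (simp add: multiplier_minus)
  also have "\<dots> < e / 2"
    using d(2)[OF norm_nonneg y(2)] z yc by simp
  finally have "nrm A (x \<ominus> R y) < e"
    using norm_minus_triangle[of x "R z" "R y"] x z yc R by simp
  then show ?thesis
    using y(1) by blast
qed

lemma dense_multiplier_comp:
  assumes "dense_multiplier R" "dense_multiplier R'"
  shows "dense_multiplier (R \<otimes>\<^bsub>Mul\<^esub> R')"
  unfolding dense_multiplier_def
proof (intro conjI ballI allI impI)
  have R: "R \<in> carrier Mul" "R' \<in> carrier Mul"
    using assms by (auto simp: dense_multiplier_def)
  then show "R \<otimes>\<^bsub>Mul\<^esub> R' \<in> carrier Mul"
    by (rule multiplier_mult_closed)
  fix x and e :: real assume x: "x \<in> carrier A" and e: "e > 0"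
  have "\<exists>y\<in>R' ` carrier A. nrm A (x \<ominus> R y) < e"
  proof (rule approx_multiplier[OF R(1) _ x e])
    show "R' ` carrier A \<subseteq> carrier A"
      using R(2) by auto
    show "\<exists>z\<in>carrier A. nrm A (x \<ominus> R z) < e" if "e > 0" for e
      using assms(1) x that by (simp add: dense_multiplier_def)
    show "\<exists>y\<in>R' ` carrier A. nrm A (z \<ominus> y) < e" if "z \<in> carrier A" "e > 0" for z e
      using assms(2) that by (auto simp: dense_multiplier_def)
  qed
  then show "\<exists>z\<in>carrier A. nrm A (x \<ominus> (R \<otimes>\<^bsub>Mul\<^esub> R') z) < e"
    by (auto simp: multiplier_alg_apply)
qed

lemma dense_multiplier_Omega:
  assumes "dense_multiplier R" "u \<in> Omega A" "x \<in> carrier A" "e > 0"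
  shows "\<exists>a\<in>carrier A. nrm A (x \<ominus> R (u \<otimes> a)) < e"
proof -
  have u: "u \<in> carrier A"
    using assms(2) by (rule Omega_carrier)
  have "\<exists>y\<in>(\<lambda>a. u \<otimes> a) ` carrier A. nrm A (x \<ominus> R y) < e"
  proof (rule approx_multiplier[OF _ _ assms(3,4)])
    show "R \<in> carrier Mul"
      using assms(1) by (simp add: dense_multiplier_def)
    show "\<exists>z\<in>carrier A. nrm A (x \<ominus> R z) < e" if "e > 0" for e
      using assms(1,3) that by (simp add: dense_multiplier_def)
    show "\<exists>y\<in>(\<lambda>a. u \<otimes> a) ` carrier A. nrm A (z \<ominus> y) < e" if "z \<in> carrier A" "e > 0" for z e
      using assms(2) that by (auto simp: Omega_iff)
  qed (use u in auto)
  then show ?thesis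
    by blast
qed

end

section \<open>Binomial averages of the semigroup\<close>

context growth_semigroup
begin

text \<open>As \<open>S (n t) \<rightarrow> 0\<close>, a truncated Neumann series for \<open>(I + S t) / 2\<close>
  shows that its range is dense.\<close>

definition half_step :: "real \<Rightarrow> 'a \<Rightarrow> 'a"
  where "half_step t = (\<lambda>x\<in>carrier A. (1 / 2) \<odot> (x \<oplus> S t x))"

lemma half_step_multiplier:
  assumes "t > 0"
  shows "half_step t \<in> carrier Mul"
proof -
  obtain C where C: "C > 0" "\<And>s x. \<lbrakk>s \<ge> t; x \<in> carrier A\<rbrakk> \<Longrightarrow> nrm A (S s x) \<le> C * nrm A x"
    using S_bounded[OF assms] by blast
  show ?thesis
  proof (rule multiplierI)
    show "half_step t \<in> carrier A \<rightarrow>\<^sub>E carrier A"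
      using assms by (auto simp: half_step_def)
    fix x assume x: "x \<in> carrier A"
    have "nrm A (x \<oplus> S t x) \<le> nrm A x + C * nrm A x"
      using norm_triangle[of x "S t x"] C(2)[of t x] x assms by simp
    then show "nrm A (half_step t x) \<le> ((1 + C) / 2) * nrm A x"
      using x assms by (simp add: half_step_def norm_smult distrib_right norm_divide)
    show "half_step t (c \<odot> x) = c \<odot> half_step t x" for c
      using x assms by (simp add: half_step_def S_smult scal_scal scal_add_right mult.commute)
    fix y assume y: "y \<in> carrier A"
    show "half_step t (x \<oplus> y) = half_step t x \<oplus> half_step t y"
      using x y assms by (simp add: half_step_def S_plus scal_add_right M.a_ac)
    show "half_step t (x \<otimes> y) = half_step t x \<otimes> y"
      using x y assms by (simp add: half_step_def S_mult distr_left smult_mult_left)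
  qed
qed

text \<open>Telescoping: \<open>z\<close> is twice the alternating sum of \<open>S (k * t) x\<close>
  over \<open>k < n\<close>. The remainder has the sign of the last term, kept as a scalar
  \<open>c\<close> of modulus 1 since only its size matters.\<close>

lemma half_step_Neumann:
  assumes "t > 0" "x \<in> carrier A"
  shows "\<exists>z\<in>carrier A. \<exists>c. cmod c = 1 \<and> x \<ominus> half_step t z = c \<odot> S (real n * t) x"
proof (induction n)
  case 0
  show ?case
    using assms multiplier_zero[OF half_step_multiplier[OF assms(1)]]
    by (intro bexI[of _ \<zero>] exI[of _ 1]) (auto simp: minus_alt)
next
  case (Suc n)
  then obtain z c where z: "z \<in> carrier A" "cmod c = 1" "x \<ominus> half_step t z = c \<odot> S (real n * t) x"
    by auto
  define p where "p = c \<odot> S (real n * t) x"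
  define q where "q = c \<odot> S (real (Suc n) * t) x"
  have nt: "real n * t \<ge> 0" "real (Suc n) * t \<ge> 0"
    using assms(1) by auto
  have pq: "p \<in> carrier A" "q \<in> carrier A"
    using nt assms by (auto simp: p_def q_def)
  have H: "half_step t \<in> carrier Mul"
    using assms(1) by (rule half_step_multiplier)
  have Sp: "S t p = q"
    using S_add[of t "real n * t" x] nt assms by (simp add: p_def q_def S_smult distrib_right)
  have "half_step t (2 \<odot> p) = p \<oplus> q"
    using pq assms(1) by (simp add: half_step_def S_smult Sp scal_add_right scal_scal)
  then have "x \<ominus> half_step t (z \<oplus> 2 \<odot> p) = (x \<oplus> \<zero>) \<ominus> (half_step t z \<oplus> (p \<oplus> q))"
    using z(1) pq H assms by (simp add: multiplier_add)
  also have "\<dots> = (x \<ominus> half_step t z) \<oplus> (\<zero> \<ominus> (p \<oplus> q))"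
    using z(1) pq H assms by (intro add_minus_add) auto
  also have "\<dots> = (p \<oplus> \<zero>) \<ominus> (p \<oplus> q)"
    using z(3) pq by (simp add: minus_alt flip: p_def)
  also have "\<dots> = (p \<ominus> p) \<oplus> (\<zero> \<ominus> q)"
    using pq by (intro add_minus_add) auto
  also have "\<dots> = (- c) \<odot> S (real (Suc n) * t) x"
    using pq nt assms by (simp add: minus_alt q_def scal_scal)
  finally show ?case
    using z pq by (intro bexI[of _ "z \<oplus> 2 \<odot> p"] exI[of _ "- c"]) auto
qed

lemma dense_multiplier_half_step:
  assumes "t > 0"
  shows "dense_multiplier (half_step t)"
  unfolding dense_multiplier_def
proof (intro conjI ballI allI impI)
  show "half_step t \<in> carrier Mul"
    using assms by (rule half_step_multiplier)
  fix x and e :: real assume x: "x \<in> carrier A" and e: "e > 0"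
  obtain n where n: "nrm A (S (real n * t) x) < e"
    using order_tendstoD(2)[OF S_tendsto_zero[OF assms x] e] by (auto simp: eventually_sequentially)
  obtain z c where "z \<in> carrier A" "cmod c = 1" "x \<ominus> half_step t z = c \<odot> S (real n * t) x"
    using half_step_Neumann[OF assms x] by blast
  then show "\<exists>z\<in>carrier A. nrm A (x \<ominus> half_step t z) < e"
    using n x assms by (intro bexI[of _ z]) (auto simp: norm_smult)
qed

primrec half_steps :: "real \<Rightarrow> nat \<Rightarrow> 'a \<Rightarrow> 'a"
  where "half_steps t 0 = \<one>\<^bsub>Mul\<^esub>"
  | "half_steps t (Suc n) = half_step t \<otimes>\<^bsub>Mul\<^esub> half_steps t n"

lemma half_steps_0 [simp]: "x \<in> carrier A \<Longrightarrow> half_steps t 0 x = x"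
  by (simp add: multiplier_alg_def)

lemma dense_multiplier_half_steps:
  assumes "t > 0"
  shows "dense_multiplier (half_steps t n)"
proof (induction n)
  case 0
  have "half_steps t 0 \<in> carrier Mul"
  proof (rule multiplierI)
    show "half_steps t 0 \<in> carrier A \<rightarrow>\<^sub>E carrier A"
      by (auto simp: multiplier_alg_def)
    show "nrm A (half_steps t 0 x) \<le> 1 * nrm A x" if "x \<in> carrier A" for x
      using that by (simp del: half_steps.simps)
  qed (simp_all del: half_steps.simps)
  moreover have "\<exists>z\<in>carrier A. nrm A (x \<ominus> half_steps t 0 z) < e" if "x \<in> carrier A" "e > 0" for x e
    using that by (intro bexI[of _ x]) (auto simp del: half_steps.simps)
  ultimately show ?case
    by (simp add: dense_multiplier_def del: half_steps.simps)
next
  case (Suc n)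
  then show ?case
    using dense_multiplier_comp[OF dense_multiplier_half_step[OF assms]] by simp
qed

lemma half_steps_multiplier: "t > 0 \<Longrightarrow> half_steps t n \<in> carrier Mul"
  using dense_multiplier_half_steps by (simp add: dense_multiplier_def)

text \<open>The right-hand side is the expectation of \<open>e + K (s + k t - a)\<^sup>2\<close> for a
  binomially distributed \<open>k\<close> with parameters \<open>n\<close> and \<open>1/2\<close>.\<close>

lemma half_steps_estimate:
  assumes "t > 0" "x \<in> carrier A" "y \<in> carrier A"
    and bound: "\<And>s. s \<ge> 0 \<Longrightarrow> nrm A (S s x \<ominus> y) \<le> e + K * (s - a)\<^sup>2"
    and "s \<ge> 0"
  shows "nrm A (half_steps t n (S s x) \<ominus> y)
    \<le> e + K * ((s + real n * t / 2 - a)\<^sup>2 + real n * t\<^sup>2 / 4)"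
  using assms(5)
proof (induction n arbitrary: s)
  case 0
  then show ?case
    using bound[OF 0] assms(2) by (simp del: half_steps.simps)
next
  case (Suc n)
  define p where "p = half_steps t n (S s x)"
  define q where "q = half_steps t n (S (s + t) x)"
  have H: "half_steps t n \<in> carrier Mul"
    using assms(1) by (rule half_steps_multiplier)
  have pq: "p \<in> carrier A" "q \<in> carrier A"
    using H assms Suc.prems by (auto simp: p_def q_def)
  \<comment> \<open>One more half step averages the results for the starting times \<open>s\<close>
    and \<open>s + t\<close>, which is why the induction runs over all \<open>s\<close>.\<close>
  have "S t p = q"
    using S_commute_multiplier[OF _ H, of t "S s x"] assms Suc.prems
    by (simp add: p_def q_def S_add add.commute[of s t])
  then have "half_steps t (Suc n) (S s x) = (1 / 2) \<odot> (p \<oplus> q)"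
    using H pq assms Suc.prems by (simp add: multiplier_alg_apply half_step_def flip: p_def)
  also have "\<dots> \<ominus> y = (1 / 2) \<odot> ((p \<ominus> y) \<oplus> (q \<ominus> y))"
  proof -
    have "y = (1 / 2) \<odot> (y \<oplus> y)"
      using assms(3) scal_add_left[of y "1/2" "1/2"] by (simp add: scal_add_right)
    then have "(1 / 2) \<odot> (p \<oplus> q) \<ominus> y = (1 / 2) \<odot> ((p \<oplus> q) \<ominus> (y \<oplus> y))"
      using pq assms(3) scal_minus_right[of "p \<oplus> q" "y \<oplus> y" "1/2"] by simp
    then show ?thesis
      using pq assms(3) by (simp add: add_minus_add)
  qed
  finally have "nrm A (half_steps t (Suc n) (S s x) \<ominus> y) \<le> (nrm A (p \<ominus> y) + nrm A (q \<ominus> y)) / 2"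
    using norm_triangle[of "p \<ominus> y" "q \<ominus> y"] pq assms(3) by (simp add: norm_smult norm_divide)
  also have "\<dots> \<le> ((e + K * ((s + real n * t / 2 - a)\<^sup>2 + real n * t\<^sup>2 / 4))
      + (e + K * ((s + t + real n * t / 2 - a)\<^sup>2 + real n * t\<^sup>2 / 4))) / 2"
    using Suc.IH[OF Suc.prems] Suc.IH[of "s + t"] Suc.prems assms(1)
    unfolding p_def q_def by (intro divide_right_mono add_mono) auto
  also have "\<dots> = e + K * ((s + real (Suc n) * t / 2 - a)\<^sup>2 + real (Suc n) * t\<^sup>2 / 4)"
  proof -
    define r where "r = s + real n * t / 2 - a"
    \<comment> \<open>Averaging the squares at \<open>r\<close> and \<open>r + t\<close> moves the
      centre by \<open>t / 2\<close> and adds \<open>t^2 / 4\<close>, the variance of one fair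
      step.\<close>
    have "((e + K * (r\<^sup>2 + N)) + (e + K * ((r + t)\<^sup>2 + N))) / 2 = e + K * ((r + t / 2)\<^sup>2 + (t\<^sup>2 / 4 + N))" for N
      by (simp add: power2_eq_square algebra_simps add_divide_distrib)
    moreover have eqs: "s + real n * t / 2 - a = r" "s + t + real n * t / 2 - a = r + t" "s + real (Suc n) * t / 2 - a = r + t / 2"
      "real (Suc n) * t\<^sup>2 / 4 = t\<^sup>2 / 4 + real n * t\<^sup>2 / 4"
      by (simp_all add: r_def algebra_simps add_divide_distrib)
    ultimately show ?thesis
      by (simp only: eqs)
  qed
  finally show ?case .
qed

text \<open>Chebyshev's argument: near time \<open>a\<close> the orbit is close to its value there
  by continuity, and elsewhere its uniform bound is dominated by a multiple of
  \<open>(s - a)^2\<close>. Starting at \<open>S d x\<close> with \<open>d > 0\<close> keeps the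
  orbit at times where it is bounded and continuous.\<close>

lemma half_steps_approx:
  assumes "d > 0" "a > 0" "x \<in> carrier A" "e > 0"
  shows "\<exists>t>0. \<exists>n. nrm A (half_steps t n (S d x) \<ominus> S a (S d x)) < e"
proof -
  define y where "y = S a (S d x)"
  have y: "y \<in> carrier A" "y = S (a + d) x"
    using assms by (auto simp: y_def S_add)
  obtain r where r: "r > 0" "\<And>t. \<lbrakk>t > 0; \<bar>t - (a + d)\<bar> < r\<rbrakk> \<Longrightarrow> nrm A (S t x \<ominus> S (a + d) x) < e / 2"
    using S_continuous[OF assms(3), of "a + d" "e / 2"] assms by auto
  obtain C where C: "C > 0" "\<And>s x. \<lbrakk>s \<ge> d; x \<in> carrier A\<rbrakk> \<Longrightarrow> nrm A (S s x) \<le> C * nrm A x"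
    using S_bounded[OF assms(1)] by blast
  \<comment> \<open>At distance \<open>r\<close> or more from \<open>a\<close>, the quadratic term
    is then at least \<open>2 * C * nrm A x\<close>, the bound for a difference of two orbit
    points.\<close>
  define K where "K = 2 * C * nrm A x / r\<^sup>2"
  have K: "K \<ge> 0"
    using C(1) norm_nonneg[OF assms(3)] by (simp add: K_def)
  have bound: "nrm A (S s (S d x) \<ominus> y) \<le> e / 2 + K * (s - a)\<^sup>2" if s: "s \<ge> 0" for s
  proof (cases "\<bar>s - a\<bar> < r")
    case True
    then have "nrm A (S (s + d) x \<ominus> S (a + d) x) < e / 2"
      using r(2)[of "s + d"] s assms(1) by simp
    then show ?thesis
      using K s assms by (simp add: y(2) S_add add_increasing2 less_imp_le)
  next
    case False
    have "nrm A (S (s + d) x \<ominus> S (a + d) x) \<le> C * nrm A x + C * nrm A x"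
      using norm_minus_le[of "S (s + d) x" "S (a + d) x"] C(2)[of "s + d" x] C(2)[of "a + d" x]
        s assms by simp
    also have "\<dots> = K * r\<^sup>2"
      using r(1) by (simp add: K_def)
    also have "\<dots> \<le> K * (s - a)\<^sup>2"
      using False r(1) K by (intro mult_left_mono) (auto simp: abs_le_square_iff[symmetric])
    finally show ?thesis
      using s assms by (simp add: y(2) S_add)
  qed
  obtain m :: nat where m: "K * a\<^sup>2 / (e / 2) < real m"
    using reals_Archimedean2 by blast
  define n where "n = Suc m"
  \<comment> \<open>Makes the mean \<open>n * t / 2\<close> equal to \<open>a\<close>; the variance
    \<open>n * t^2 / 4\<close> is then \<open>a^2 / n\<close>.\<close>
  define t where "t = 2 * a / real n"
  have t: "t > 0"
    using assms(2) by (simp add: t_def n_def)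
  have "nrm A (half_steps t n (S 0 (S d x)) \<ominus> y)
      \<le> e / 2 + K * ((0 + real n * t / 2 - a)\<^sup>2 + real n * t\<^sup>2 / 4)"
    using t assms y bound by (intro half_steps_estimate) auto
  also have "(0 + real n * t / 2 - a)\<^sup>2 + real n * t\<^sup>2 / 4 = a\<^sup>2 / real n"
  proof -
    have "real n > 0"
      by (simp add: n_def)
    then show ?thesis
      by (simp add: t_def power2_eq_square)
  qed
  also have "K * (a\<^sup>2 / real n) < e / 2"
  proof -
    have "K * a\<^sup>2 < e / 2 * real m"
      using m assms(4) by (simp add: pos_divide_less_eq mult.commute)
    also have "\<dots> \<le> e / 2 * real n"
      using assms(4) by (simp add: n_def)
    finally show ?thesis
      by (simp add: n_def pos_divide_less_eq)
  qed
  finally show ?thesis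
    using t unfolding y_def by (intro exI[of _ t] conjI exI[of _ n]) auto
qed

text \<open>Spending a little time \<open>d\<close> turns an estimate in the norm of
  \<open>A\<close> into one in the norm of \<open>L\<close>.\<close>

lemma S_into_L:
  assumes "d > 0"
  obtains C where "C > 0" "\<And>x. x \<in> carrier A \<Longrightarrow> S d x \<in> L_ideal A T"
    "\<And>x. x \<in> carrier A \<Longrightarrow> nrm L (S d x) \<le> C * nrm A x"
proof -
  obtain C where C: "C > 0" "\<And>s x. \<lbrakk>s \<ge> d; x \<in> carrier A\<rbrakk> \<Longrightarrow> nrm A (S s x) \<le> C * nrm A x"
    using S_bounded[OF assms] by blast
  have le: "nrm A (S s (S d x)) \<le> C * nrm A x" if "s \<ge> 0" "x \<in> carrier A" for s x
    using C(2)[of "s + d" x] that assms by (simp add: S_add)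
  show ?thesis
  proof (rule that[OF C(1)])
    fix x assume x: "x \<in> carrier A"
    then have Sx: "S d x \<in> carrier A"
      using assms by simp
    show "S d x \<in> L_ideal A T"
      by (rule L_idealI[OF Sx le[OF _ x]])
    show "nrm L (S d x) \<le> C * nrm A x"
      by (rule L_norm_least[OF Sx le[OF _ x]])
  qed
qed

text \<open>\<open>R'\<close> is \<open>R\<close> composed with averages standing in for
  \<open>S (d - d')\<close>, so the change is small in \<open>L\<close>. As \<open>R'\<close> and
  multiplication by \<open>u\<close> have dense range, the closure of the ideal generated by
  \<open>R' (S d' u)\<close> contains the range of \<open>S d'\<close>, which comes near
  \<open>u\<close> once \<open>d'\<close> is small.\<close>

lemma Omega_L_perturbation:
  assumes u: "u \<in> Omega A" and R: "dense_multiplier R" and d: "d > 0" and e: "e > 0" "r > 0"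
  shows "\<exists>R' d'. dense_multiplier R' \<and> d' > 0 \<and> nrm L (R (S d u) \<ominus> R' (S d' u)) < e \<and>
    (\<exists>a\<in>carrier A. nrm A (u \<ominus> R' (S d' u) \<otimes> a) < r)"
proof -
  have uA: "u \<in> carrier A"
    using u by (rule Omega_carrier)
  have RM: "R \<in> carrier Mul"
    using R by (simp add: dense_multiplier_def)
  obtain t0 a0 where t0: "t0 > 0" "a0 \<in> carrier A" "nrm A (u \<ominus> S t0 a0) < r / 2"
    using S_dense[OF uA, of "r / 2"] e by auto
  \<comment> \<open>At most \<open>t0\<close>, so that \<open>S t0 a0\<close> lies in the range of
    \<open>S d'\<close>; less than \<open>d\<close>, so that a positive time is left for the
    averages to replace.\<close>
  define d' where "d' = min t0 d / 2"
  have d': "d' > 0" "d' \<le> t0" "d' < d"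
    using t0 d by (auto simp: d'_def min_def)
  \<comment> \<open>Half of \<open>d'\<close> is held back to convert the averaging error from the
    norm of \<open>A\<close> to that of \<open>L\<close>; the other half is the positive starting
    time of the averaged orbit.\<close>
  obtain C where C: "C > 0" "\<And>x. x \<in> carrier A \<Longrightarrow> S (d' / 2) x \<in> L_ideal A T"
    "\<And>x. x \<in> carrier A \<Longrightarrow> nrm L (S (d' / 2) x) \<le> C * nrm A x"
    using S_into_L[of "d' / 2"] d' by auto
  define m where "m = nrm Mul R"
  have m: "m \<ge> 0"
    using norm_multiplier_nonneg[OF RM] by (simp add: m_def)
  define x where "x = S (d' / 2) u"
  have x: "x \<in> carrier A"
    using d' uA by (simp add: x_def)
  \<comment> \<open>With \<open>m + 1\<close> in place of \<open>m\<close>, the norm of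
    \<open>R\<close> need not be shown to be nonzero.\<close>
  have "e / ((m + 1) * C) > 0"
    using e m C(1) by (simp add: add_nonneg_pos)
  then have "\<exists>t>0. \<exists>n. nrm A (half_steps t n x \<ominus> S (d - d') x) < e / ((m + 1) * C)"
    unfolding x_def using d' uA by (intro half_steps_approx) auto
  then obtain t n where t: "t > 0"
    and tn: "nrm A (half_steps t n x \<ominus> S (d - d') x) < e / ((m + 1) * C)"
    by blast
  define Q where "Q = half_steps t n"
  have Q: "dense_multiplier Q" "Q \<in> carrier Mul"
    using t dense_multiplier_half_steps[OF t] half_steps_multiplier[OF t] by (simp_all add: Q_def)
  define R' where "R' = R \<otimes>\<^bsub>Mul\<^esub> Q"
  have R': "dense_multiplier R'" "R' \<in> carrier Mul"
    using dense_multiplier_comp[OF R Q(1)] by (simp_all add: R'_def dense_multiplier_def)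
  have S_d: "S d u = S (d' / 2) (S (d - d') x)"
    using d' uA by (simp add: x_def flip: S_add)
  have S_d': "S d' u = S (d' / 2) x"
    using d' uA by (simp add: x_def flip: S_add)
  define y where "y = S (d - d') x \<ominus> Q x"
  have y: "y \<in> carrier A"
    using d' x Q by (simp add: y_def)
  \<comment> \<open>\<open>Q\<close> commutes with the semigroup, so the whole difference is
    \<open>R\<close> and half of \<open>d'\<close> applied to the averaging error
    \<open>y\<close>.\<close>
  have "R (S d u) \<ominus> R' (S d' u) = R (S (d' / 2) y)"
    using d' x Q(2) RM y
    by (simp add: S_d S_d' R'_def multiplier_alg_apply S_commute_multiplier[OF _ Q(2)] y_def
        S_minus multiplier_minus)
  moreover have "nrm L (R (S (d' / 2) y)) \<le> m * nrm L (S (d' / 2) y)"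
    unfolding m_def using C(2)[OF y] RM by (rule L_ideal_multiplier)
  moreover have "m * nrm L (S (d' / 2) y) < e"
  proof -
    have Lpos: "0 \<le> nrm L (S (d' / 2) y)"
      using L_norm_ge[OF C(2)[OF y]] norm_nonneg[of "S (d' / 2) y"] y d' by simp
    have "m * nrm L (S (d' / 2) y) \<le> (m + 1) * (C * nrm A y)"
      using C(3)[OF y] m Lpos by (intro mult_mono) auto
    also have "nrm A y < e / ((m + 1) * C)"
      using tn norm_minus_commute[of "Q x" "S (d - d') x"] d' x Q by (simp add: y_def Q_def)
    finally show ?thesis
      using m C(1) by (simp add: add_nonneg_pos)
  qed
  ultimately have 1: "nrm L (R (S d u) \<ominus> R' (S d' u)) < e"
    by simp
  \<comment> \<open>The surplus time goes into the vector, so that \<open>a1\<close> can be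
    approximated by \<open>R' (u \<otimes> a)\<close> before \<open>S d'\<close> is applied, which
    costs the factor \<open>C'\<close>.\<close>
  define a1 where "a1 = S (t0 - d') a0"
  have a1: "a1 \<in> carrier A" "S t0 a0 = S d' a1"
    using d' t0 by (auto simp: a1_def simp flip: S_add)
  obtain C' where C': "C' > 0" "\<And>s x. \<lbrakk>s \<ge> d'; x \<in> carrier A\<rbrakk> \<Longrightarrow> nrm A (S s x) \<le> C' * nrm A x"
    using S_bounded[OF d'(1)] by blast
  obtain a where a: "a \<in> carrier A" "nrm A (a1 \<ominus> R' (u \<otimes> a)) < r / (2 * C')"
    using dense_multiplier_Omega[OF R'(1) u a1(1), of "r / (2 * C')"] e C'(1) by auto
  have "nrm A (S d' (a1 \<ominus> R' (u \<otimes> a))) \<le> C' * nrm A (a1 \<ominus> R' (u \<otimes> a))"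
    using C'(2) a a1 R' uA by simp
  also have "\<dots> < r / 2"
    using a(2) C'(1) by (simp add: field_simps)
  finally have "nrm A (S d' a1 \<ominus> R' (S d' u) \<otimes> a) < r / 2"
    using d' a a1 R' uA
    by (simp add: S_minus S_mult S_commute_multiplier[symmetric] multiplier_mult)
  then have "nrm A (u \<ominus> R' (S d' u) \<otimes> a) < r"
    using norm_minus_triangle[of u "S d' a1" "R' (S d' u) \<otimes> a"] t0 a1 a d' uA R' by simp
  then show ?thesis
    using 1 R'(1) d'(1) a(1) by blast
qed

text \<open>The \<open>n\<close>-th condition on \<open>w\<close> is that \<open>u\<close> lies
  within \<open>1 / (n + 1)\<close> of wA. It is open in \<open>w\<close>, and
  \<open>Omega_L_perturbation\<close> attains it near every point of \<open>E\<close>. Under all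
  conditions together the closure of wA contains \<open>u\<close>, hence uA, hence
  everything.\<close>

theorem Omega_Int_L_ideal_nonempty:
  assumes u: "u \<in> Omega A"
  shows "Omega A \<inter> L_ideal A T \<noteq> {}"
proof -
  interpret L: banach_algebra L
    by (rule L_banach_algebra)
  have uA: "u \<in> carrier A"
    using u by (rule Omega_carrier)
  define E where "E = {R (S d u) | R d. dense_multiplier R \<and> d > 0}"
  have EL: "E \<subseteq> carrier L"
  proof
    fix w assume "w \<in> E"
    then obtain R d where w: "w = R (S d u)" "dense_multiplier R" "d > 0"
      by (auto simp: E_def)
    then have "S d u \<in> L_ideal A T"
      using S_into_L[of d] uA by metis
    then show "w \<in> carrier L"
      using w by (simp add: L_ideal_multiplier dense_multiplier_def)
  qed
  have "\<exists>w\<in>carrier L. \<forall>n::nat. \<exists>a\<in>carrier A. nrm A (u \<ominus> w \<otimes> a) < 1 / (real n + 1)"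
  proof (rule L.Baire_generic_point[OF EL])
    \<comment> \<open>\<open>half_steps 1 0\<close> is the identity multiplier, so this element is
      \<open>S 1 u\<close>.\<close>
    have "half_steps 1 0 (S 1 u) \<in> E"
      unfolding E_def using dense_multiplier_half_steps[of 1 0] by fastforce
    then show "E \<noteq> {}"
      by blast
  next
    fix n :: nat and w
    assume "w \<in> carrier L" and "\<exists>a\<in>carrier A. nrm A (u \<ominus> w \<otimes> a) < 1 / (real n + 1)"
    then obtain a where a: "a \<in> carrier A" "nrm A (u \<ominus> w \<otimes> a) < 1 / (real n + 1)"
      and w: "w \<in> L_ideal A T" "w \<in> carrier A"
      by (auto simp: L_closed)
    obtain d where d: "d > 0"
      "\<And>r. \<lbrakk>0 \<le> r; r < d\<rbrakk> \<Longrightarrow> nrm A a * r < 1 / (real n + 1) - nrm A (u \<ominus> w \<otimes> a)"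
      using ex_small_factor[of "1 / (real n + 1) - nrm A (u \<ominus> w \<otimes> a)"] a(2) by auto
    have "nrm A (u \<ominus> w' \<otimes> a) < 1 / (real n + 1)" if w': "w' \<in> L_ideal A T" "nrm L (w \<ominus> w') < d" for w'
    proof -
      have w'A: "w' \<in> carrier A"
        using w'(1) by (rule L_closed)
      have "nrm A (w \<ominus> w') < d"
        using L_norm_ge[OF L_ideal_minus[OF w(1) w'(1)]] w'(2) by simp
      then have "nrm A a * nrm A (w \<ominus> w') < 1 / (real n + 1) - nrm A (u \<ominus> w \<otimes> a)"
        using w w'A by (intro d(2) norm_nonneg) auto
      moreover have "nrm A (w \<otimes> a \<ominus> w' \<otimes> a) \<le> nrm A a * nrm A (w \<ominus> w')"
        using nrm_mult[of "w \<ominus> w'" a] w w'A a by (simp add: mult_minus_left mult.commute)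
      ultimately show ?thesis
        using norm_minus_triangle[of u "w \<otimes> a" "w' \<otimes> a"] w w'A a uA by simp
    qed
    then show "\<exists>d>0. \<forall>w'\<in>carrier L. nrm L (w \<ominus>\<^bsub>L\<^esub> w') < d \<longrightarrow>
        (\<exists>a\<in>carrier A. nrm A (u \<ominus> w' \<otimes> a) < 1 / (real n + 1))"
      using a(1) w d(1) by (intro exI[of _ d]) (auto simp: L_minus)
  next
    fix n :: nat and w and e :: real assume w: "w \<in> E" and e: "e > 0"
    then obtain R d where Rd: "w = R (S d u)" "dense_multiplier R" "d > 0"
      by (auto simp: E_def)
    obtain R' d' where R'd': "dense_multiplier R'" "d' > 0"
      "nrm L (R (S d u) \<ominus> R' (S d' u)) < e"
      "\<exists>a\<in>carrier A. nrm A (u \<ominus> R' (S d' u) \<otimes> a) < 1 / (real n + 1)"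
      using Omega_L_perturbation[OF u Rd(2,3) e, of "1 / (real n + 1)"] by auto
    have "R' (S d' u) \<in> E"
      using R'd' by (auto simp: E_def)
    moreover have "nrm L (w \<ominus>\<^bsub>L\<^esub> R' (S d' u)) < e"
      using R'd'(3) w EL \<open>R' (S d' u) \<in> E\<close> Rd(1) by (subst L_minus) auto
    ultimately show "\<exists>y\<in>E. nrm L (w \<ominus>\<^bsub>L\<^esub> y) < e \<and>
        (\<exists>a\<in>carrier A. nrm A (u \<ominus> y \<otimes> a) < 1 / (real n + 1))"
      using R'd'(4) by blast
  qed
  then obtain w where w: "w \<in> L_ideal A T"
    "\<And>n::nat. \<exists>a\<in>carrier A. nrm A (u \<ominus> w \<otimes> a) < 1 / (real n + 1)"
    by auto
  have wA: "w \<in> carrier A"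
    using w(1) by (rule L_closed)
  have app: "\<exists>a\<in>carrier A. nrm A (u \<ominus> w \<otimes> a) < e" if "e > 0" for e
  proof -
    obtain n :: nat where "1 / (real n + 1) < e"
      using reals_Archimedean[OF \<open>e > 0\<close>] by (auto simp: inverse_eq_divide add.commute)
    then show ?thesis
      using w(2)[of n] by (meson less_trans)
  qed
  have "w \<in> Omega A"
    unfolding Omega_iff
  proof (intro conjI ballI allI impI wA)
    fix x and e :: real assume x: "x \<in> carrier A" and e: "e > 0"
    obtain b where b: "b \<in> carrier A" "nrm A (x \<ominus> u \<otimes> b) < e / 2"
      using u x e unfolding Omega_iff by (meson half_gt_zero)
    obtain d where d: "d > 0" "\<And>r. \<lbrakk>0 \<le> r; r < d\<rbrakk> \<Longrightarrow> nrm A b * r < e / 2"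
      using ex_small_factor[of "e / 2"] e by auto
    then obtain a where a: "a \<in> carrier A" "nrm A (u \<ominus> w \<otimes> a) < d"
      using app by blast
    have "nrm A (u \<otimes> b \<ominus> w \<otimes> (a \<otimes> b)) \<le> nrm A b * nrm A (u \<ominus> w \<otimes> a)"
      using nrm_mult[of "u \<ominus> w \<otimes> a" b] a b uA wA
      by (simp add: mult_minus_left mult_assoc mult.commute)
    also have "\<dots> < e / 2"
      using d(2)[OF norm_nonneg a(2)] a uA wA by simp
    finally have "nrm A (x \<ominus> w \<otimes> (a \<otimes> b)) < e"
      using norm_minus_triangle[of x "u \<otimes> b" "w \<otimes> (a \<otimes> b)"] x a b uA wA by simp
    then show "\<exists>y\<in>carrier A. nrm A (x \<ominus> w \<otimes> y) < e"
      using a b by (intro bexI[of _ "a \<otimes> b"]) auto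
  qed
  then show ?thesis
    using w(1) by blast
qed

end

section \<open>The closure \<open>A\<^sub>T\<close>\<close>

context growth_semigroup
begin

abbreviation "M \<equiv> multiplier_alg L"

abbreviation "J \<equiv> L_incl A T"

abbreviation "B \<equiv> closure_alg A T lam"

sublocale L: weakly_cancellative_algebra L
  by (rule L_weakly_cancellative)

sublocale M: banach_algebra M
  by (rule L.multiplier_banach_algebra)

lemma J_apply: "x \<in> L_ideal A T \<Longrightarrow> J u x = u \<otimes> x"
  by (simp add: L_incl_def)

lemma L_ideal_mult_left:
  "\<lbrakk>u \<in> carrier A; x \<in> L_ideal A T\<rbrakk> \<Longrightarrow> u \<otimes> x \<in> L_ideal A T"
  "\<lbrakk>u \<in> carrier A; x \<in> L_ideal A T\<rbrakk> \<Longrightarrow> nrm L (u \<otimes> x) \<le> nrm A u * nrm L x"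
  using L_ideal_mult[of x u] mult_comm[of u x] by (auto simp: L_closed mult.commute)

lemma J_multiplier:
  assumes "u \<in> carrier A"
  shows "J u \<in> carrier M" "nrm M (J u) \<le> nrm A u"
proof -
  show J: "J u \<in> carrier M"
  proof (rule L.multiplierI)
    show "J u \<in> carrier L \<rightarrow>\<^sub>E carrier L"
      using assms by (auto simp: L_incl_def L_ideal_mult_left)
    show "nrm L (J u x) \<le> nrm A u * nrm L x" if "x \<in> carrier L" for x
      using that assms by (simp add: J_apply L_ideal_mult_left)
  qed (use assms in \<open>auto simp: J_apply L_ideal_add L_ideal_smult L_ideal_mult L_closed
        distr_right smult_mult_right mult_assoc\<close>)
  show "nrm M (J u) \<le> nrm A u"
    using assms J by (intro L.norm_multiplier_le) (auto simp: J_apply L_ideal_mult_left norm_nonneg)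
qed

lemma M_eqI:
  assumes "R \<in> carrier M" "R' \<in> carrier M" "\<And>x. x \<in> L_ideal A T \<Longrightarrow> R x = R' x"
  shows "R = R'"
  using assms by (intro L.multiplier_eqI) auto

lemma M_apply:
  "x \<in> L_ideal A T \<Longrightarrow> (R \<oplus>\<^bsub>M\<^esub> R') x = R x \<oplus> R' x"
  "x \<in> L_ideal A T \<Longrightarrow> (c \<odot>\<^bsub>M\<^esub> R) x = c \<odot> R x"
  "x \<in> L_ideal A T \<Longrightarrow> (R \<otimes>\<^bsub>M\<^esub> R') x = R (R' x)"
  "x \<in> L_ideal A T \<Longrightarrow> \<zero>\<^bsub>M\<^esub> x = \<zero>"
  using L.multiplier_alg_apply[of x] by simp_all

lemma M_closed: "\<lbrakk>R \<in> carrier M; x \<in> L_ideal A T\<rbrakk> \<Longrightarrow> R x \<in> L_ideal A T"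
  using L.multiplier_closed by simp

lemma M_mult:
  assumes "R \<in> carrier M" "x \<in> L_ideal A T" "y \<in> L_ideal A T"
  shows "R (x \<otimes> y) = R x \<otimes> y" "R (x \<otimes> y) = x \<otimes> R y"
  using L.multiplier_mult[of R x y] L.multiplier_mult_left[of R x y] assms by simp_all

lemma J_add: "\<lbrakk>u \<in> carrier A; v \<in> carrier A\<rbrakk> \<Longrightarrow> J (u \<oplus> v) = J u \<oplus>\<^bsub>M\<^esub> J v"
  by (rule M_eqI) (auto simp: J_multiplier J_apply M_apply distr_left L_closed)

lemma J_smult: "u \<in> carrier A \<Longrightarrow> J (c \<odot> u) = c \<odot>\<^bsub>M\<^esub> J u"
  by (rule M_eqI) (auto simp: J_multiplier J_apply M_apply smult_mult_left L_closed)

lemma J_mult: "\<lbrakk>u \<in> carrier A; v \<in> carrier A\<rbrakk> \<Longrightarrow> J (u \<otimes> v) = J u \<otimes>\<^bsub>M\<^esub> J v"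
  by (rule M_eqI) (auto simp: J_multiplier J_apply M_apply mult_assoc L_closed L_ideal_mult_left)

lemma J_zero: "J \<zero> = \<zero>\<^bsub>M\<^esub>"
  by (rule M_eqI) (auto simp: J_multiplier J_apply M_apply L_closed)

lemma J_minus: "\<lbrakk>u \<in> carrier A; v \<in> carrier A\<rbrakk> \<Longrightarrow> J (u \<ominus> v) = J u \<ominus>\<^bsub>M\<^esub> J v"
  by (simp add: minus_alt M.minus_alt J_multiplier J_add J_smult)

text \<open>The ideal is dense in \<open>A\<close>, so an element of \<open>A\<close> is determined
  by its action on it.\<close>

lemma J_inj: "inj_on J (carrier A)"
proof (rule inj_onI)
  fix u v assume uv: "u \<in> carrier A" "v \<in> carrier A" "J u = J v"
  have "u \<ominus> v = \<zero>"
  proof (rule mult_eq_zero_dense[OF _ L_dense])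
    fix x assume x: "x \<in> L_ideal A T"
    then have "u \<otimes> x = v \<otimes> x"
      using uv(3) J_apply by metis
    then show "(u \<ominus> v) \<otimes> x = \<zero>"
      using uv x by (simp add: mult_minus_left L_closed)
  qed (use uv in auto)
  then show "u = v"
    using uv by (simp add: minus_eq_zero_iff)
qed

lemma J_subset: "J ` carrier A \<subseteq> carrier M"
  using J_multiplier by auto

lemma B_eq: "B = M\<lparr>carrier := norm_top M closure_of (J ` carrier A)\<rparr>"
  by (simp add: closure_alg_def)

lemma B_ops [simp]:
  "x \<oplus>\<^bsub>B\<^esub> y = x \<oplus>\<^bsub>M\<^esub> y" "x \<otimes>\<^bsub>B\<^esub> y = x \<otimes>\<^bsub>M\<^esub> y" "c \<odot>\<^bsub>B\<^esub> x = c \<odot>\<^bsub>M\<^esub> x"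
  "\<zero>\<^bsub>B\<^esub> = \<zero>\<^bsub>M\<^esub>" "nrm B = nrm M"
  by (simp_all add: closure_alg_def)

lemma B_carrier_iff:
  "b \<in> carrier B \<longleftrightarrow> b \<in> carrier M \<and> (\<forall>e>0. \<exists>u\<in>carrier A. nrm M (b \<ominus>\<^bsub>M\<^esub> J u) < e)"
  using M.in_closure_iff[OF J_subset, of b] by (simp add: B_eq)

lemma B_M: "b \<in> carrier B \<Longrightarrow> b \<in> carrier M"
  by (simp add: B_carrier_iff)

lemma J_B: "u \<in> carrier A \<Longrightarrow> J u \<in> carrier B"
  unfolding B_carrier_iff
  by (auto simp: J_multiplier intro!: bexI[of _ u])

lemma B_banach_algebra: "banach_algebra B"
  unfolding B_eq
proof (rule M.closure_banach_algebra)
  show "\<zero>\<^bsub>M\<^esub> \<in> J ` carrier A"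
    by (rule image_eqI[of _ _ \<zero>]) (simp_all add: J_zero)
qed (auto simp: J_multiplier simp flip: J_add J_smult J_mult)

sublocale B: banach_algebra B
  by (rule B_banach_algebra)

lemma B_minus: "\<lbrakk>a \<in> carrier B; b \<in> carrier B\<rbrakk> \<Longrightarrow> a \<ominus>\<^bsub>B\<^esub> b = a \<ominus>\<^bsub>M\<^esub> b"
  by (simp add: B.minus_alt M.minus_alt B_M)

text \<open>If \<open>b\<close> annihilates the images of the elements \<open>u\<close> of the
  ideal, then \<open>b x \<otimes> u = b (u \<otimes> x) = \<zero>\<close> for all such
  \<open>u\<close>, and the annihilator in \<open>L\<close> is trivial. Commutativity is that of the
  multipliers of \<open>L\<close>.\<close>

lemma B_weakly_cancellative: "weakly_cancellative_algebra B"
  unfolding weakly_cancellative_algebra_def weakly_cancellative_algebra_axioms_def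
proof (intro conjI allI impI)
  show "banach_algebra B"
    by (rule B_banach_algebra)
  show "a \<otimes>\<^bsub>B\<^esub> b = b \<otimes>\<^bsub>B\<^esub> a" if "a \<in> carrier B" "b \<in> carrier B" for a b
    using that L.multiplier_commute[of a b]
    by (intro M_eqI) (auto simp: B_M M_apply L.multiplier_mult_closed)
  show "carrier B \<noteq> {\<zero>\<^bsub>B\<^esub>}"
  proof
    assume B: "carrier B = {\<zero>\<^bsub>B\<^esub>}"
    have "u = \<zero>" if "u \<in> carrier A" for u
      using J_B[OF that] B J_zero that inj_onD[OF J_inj, of u \<zero>] by simp
    then show False
      using nonzero by blast
  qed
  fix b assume b: "b \<in> carrier B - {\<zero>\<^bsub>B\<^esub>}"
  show "(\<lambda>x. b \<otimes>\<^bsub>B\<^esub> x) ` carrier B \<noteq> {\<zero>\<^bsub>B\<^esub>}"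
  proof
    assume "(\<lambda>x. b \<otimes>\<^bsub>B\<^esub> x) ` carrier B = {\<zero>\<^bsub>B\<^esub>}"
    then have ann: "b \<otimes>\<^bsub>M\<^esub> c = \<zero>\<^bsub>M\<^esub>" if "c \<in> carrier B" for c
      using that by auto
    have bM: "b \<in> carrier M"
      using b B_M by auto
    have "b = \<zero>\<^bsub>M\<^esub>"
    proof (rule M_eqI[OF bM])
      show "\<zero>\<^bsub>M\<^esub> \<in> carrier M"
        by simp
      fix x assume x: "x \<in> L_ideal A T"
      have "b x \<otimes> u = \<zero>" if u: "u \<in> L_ideal A T" for u
      proof -
        have "b (J u x) = \<zero>"
          using ann[OF J_B[OF L_closed[OF u]]] x by (metis M_apply(3,4))
        then have "b (u \<otimes> x) = \<zero>"
          using x by (simp add: J_apply)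
        then show ?thesis
          using M_mult[OF bM x u] x u by (simp add: mult_comm L_closed)
      qed
      then have "b x = \<zero>\<^bsub>L\<^esub>"
        using M_closed[OF bM x] by (intro L.annihilator_trivial[of "b x"]) auto
      then show "b x = \<zero>\<^bsub>M\<^esub> x"
        using x by (simp add: M_apply)
    qed
    then show False
      using b by simp
  qed
qed

text \<open>For \<open>x\<close> in the ideal,
  \<open>b w \<otimes> x = b (w \<otimes> x) = w \<otimes> b x\<close>, so multiplication by
  \<open>b w\<close> is the operator \<open>b\<close> followed by \<open>J w\<close>. That
  \<open>w\<close> lies in the ideal makes \<open>b w\<close> defined and bounds it through
  \<open>nrm L w\<close>; the summand 1 makes the constant positive.\<close>

lemma bounded_QM_homomorphism_J:
  assumes "w \<in> Omega A \<inter> L_ideal A T"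
  shows "bounded_QM_homomorphism A B J w (\<lambda>b. b w) (nrm L w + 1)"
proof -
  have w: "w \<in> Omega A" "w \<in> L_ideal A T"
    using assms by auto
  have nw: "0 \<le> nrm L w"
    using w by (intro L.norm_nonneg) simp
  have norm: "nrm A (b w) \<le> (nrm L w + 1) * nrm B b" if b: "b \<in> carrier B" for b
  proof -
    have bM: "b \<in> carrier M"
      using b by (rule B_M)
    have "nrm A (b w) \<le> nrm L (b w)"
      using M_closed[OF bM w(2)] by (rule L_norm_ge)
    also have "\<dots> \<le> nrm M b * nrm L w"
      using L.norm_multiplier[OF bM, of w] w by simp
    also have "\<dots> \<le> nrm M b * (nrm L w + 1)"
      using bM by (intro mult_left_mono M.norm_nonneg) auto
    finally show ?thesis
      by (simp add: mult.commute)
  qed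
  have theta: "J (b w) = J w \<otimes>\<^bsub>M\<^esub> b" if b: "b \<in> carrier M" for b
  proof (rule M_eqI)
    show "J (b w) \<in> carrier M" "J w \<otimes>\<^bsub>M\<^esub> b \<in> carrier M"
      using b w M_closed[OF b w(2)] by (auto simp: J_multiplier L_closed)
    fix x assume x: "x \<in> L_ideal A T"
    show "J (b w) x = (J w \<otimes>\<^bsub>M\<^esub> b) x"
      using M_mult[OF b w(2) x] M_closed[OF b x] x by (simp add: J_apply M_apply)
  qed
  show ?thesis
    unfolding bounded_QM_homomorphism_def bounded_QM_homomorphism_axioms_def
  proof (intro conjI allI impI)
    show "\<exists>x\<in>carrier A. nrm B (b \<ominus>\<^bsub>B\<^esub> J x) < e" if "b \<in> carrier B" "e > 0" for b and e :: real
      using that B_carrier_iff[of b] by (auto simp: B_minus J_B)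
    show "b w \<in> carrier A" if "b \<in> carrier B" for b
      using M_closed[OF B_M[OF that] w(2)] by (rule L_closed)
  qed (use nw w norm theta in \<open>auto simp: weakly_cancellative_algebra_axioms B_weakly_cancellative J_B
        J_multiplier J_add J_mult J_smult J_inj B_M\<close>)
qed

section \<open>Extension of multipliers from A to its closure\<close>

lemma restrict_multiplier:
  assumes "R \<in> carrier Mul"
  shows "restrict R (L_ideal A T) \<in> carrier M"
    "nrm M (restrict R (L_ideal A T)) \<le> nrm Mul R"
proof -
  show R: "restrict R (L_ideal A T) \<in> carrier M"
  proof (rule L.multiplierI)
    show "restrict R (L_ideal A T) \<in> carrier L \<rightarrow>\<^sub>E carrier L"
      using assms by (auto simp: L_ideal_multiplier)
    show "nrm L (restrict R (L_ideal A T) x) \<le> nrm Mul R * nrm L x"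
      if "x \<in> carrier L" for x
      using that assms by (simp add: L_ideal_multiplier)
  qed (use assms in \<open>auto simp: L_ideal_add L_ideal_smult L_ideal_mult L_closed
        multiplier_add multiplier_smult multiplier_mult\<close>)
  show "nrm M (restrict R (L_ideal A T)) \<le> nrm Mul R"
    using assms R by (intro L.norm_multiplier_le)
      (auto simp: L_ideal_multiplier norm_multiplier_nonneg)
qed

lemma restrict_mult_J:
  assumes "R \<in> carrier Mul" "u \<in> carrier A"
  shows "restrict R (L_ideal A T) \<otimes>\<^bsub>M\<^esub> J u = J (R u)"
  by (rule M_eqI) (use assms in \<open>auto simp: restrict_multiplier J_multiplier M_apply J_apply
      L_ideal_mult_left multiplier_mult L_closed\<close>)

text \<open>Restricted twice: \<open>R\<close> to the ideal, to be an element of \<open>M\<close>,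
  and the result to the carrier of \<open>B\<close>, to be an element of
  \<open>multiplier_alg B\<close>.\<close>

definition lift_multiplier :: "('a \<Rightarrow> 'a) \<Rightarrow> ('a \<Rightarrow> 'a) \<Rightarrow> ('a \<Rightarrow> 'a)"
  where "lift_multiplier R = (\<lambda>b\<in>carrier B. restrict R (L_ideal A T) \<otimes>\<^bsub>M\<^esub> b)"

text \<open>Composition with the restricted \<open>R\<close> sends \<open>J u\<close> to
  \<open>J (R u)\<close> and is continuous, so it preserves the closure of \<open>J\<close> applied
  to \<open>A\<close>; the bound is submultiplicativity of the norm of \<open>M\<close>.\<close>

lemma lift_multiplier:
  assumes "R \<in> carrier Mul"
  shows "lift_multiplier R \<in> carrier (multiplier_alg B)"
    "nrm (multiplier_alg B) (lift_multiplier R) \<le> nrm M (restrict R (L_ideal A T))"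
proof -
  let ?R = "restrict R (L_ideal A T)"
  have R: "?R \<in> carrier M"
    using assms by (rule restrict_multiplier)
  have nR: "0 \<le> nrm M ?R"
    using R by (rule M.norm_nonneg)
  have closed: "?R \<otimes>\<^bsub>M\<^esub> b \<in> carrier B" if b: "b \<in> carrier B" for b
    unfolding B_carrier_iff
  proof (intro conjI allI impI)
    have bM: "b \<in> carrier M"
      using b by (rule B_M)
    then show "?R \<otimes>\<^bsub>M\<^esub> b \<in> carrier M"
      using R by simp
    fix e :: real assume "e > 0"
    then obtain d where d: "d > 0" "\<And>r. \<lbrakk>0 \<le> r; r < d\<rbrakk> \<Longrightarrow> nrm M ?R * r < e"
      using ex_small_factor by blast
    then obtain u where u: "u \<in> carrier A" "nrm M (b \<ominus>\<^bsub>M\<^esub> J u) < d"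
      using b unfolding B_carrier_iff by blast
    have "nrm M (?R \<otimes>\<^bsub>M\<^esub> b \<ominus>\<^bsub>M\<^esub> J (R u)) = nrm M (?R \<otimes>\<^bsub>M\<^esub> (b \<ominus>\<^bsub>M\<^esub> J u))"
      using R bM u assms by (simp add: M.mult_minus_right J_multiplier restrict_mult_J)
    also have "\<dots> \<le> nrm M ?R * nrm M (b \<ominus>\<^bsub>M\<^esub> J u)"
      using R bM u by (intro M.nrm_mult) (auto simp: J_multiplier)
    also have "\<dots> < e"
      using d(2)[OF M.norm_nonneg u(2)] bM u by (simp add: J_multiplier)
    finally show "\<exists>u\<in>carrier A. nrm M (?R \<otimes>\<^bsub>M\<^esub> b \<ominus>\<^bsub>M\<^esub> J u) < e"
      using u(1) assms by (intro bexI[of _ "R u"]) auto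
  qed
  show lift: "lift_multiplier R \<in> carrier (multiplier_alg B)"
  proof (rule B.multiplierI)
    show "lift_multiplier R \<in> carrier B \<rightarrow>\<^sub>E carrier B"
      using closed by (auto simp: lift_multiplier_def)
    show "nrm B (lift_multiplier R b) \<le> nrm M ?R * nrm B b" if "b \<in> carrier B" for b
      using M.nrm_mult[OF R B_M[OF that]] that by (simp add: lift_multiplier_def)
    fix b assume b: "b \<in> carrier B"
    show "lift_multiplier R (c \<odot>\<^bsub>B\<^esub> b) = c \<odot>\<^bsub>B\<^esub> lift_multiplier R b" for c
      using b R B.scal_closed[OF b, of c] by (simp add: lift_multiplier_def B_M M.smult_mult_right)
    fix b' assume b': "b' \<in> carrier B"
    show "lift_multiplier R (b \<oplus>\<^bsub>B\<^esub> b') = lift_multiplier R b \<oplus>\<^bsub>B\<^esub> lift_multiplier R b'"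
      using b b' R B.M.a_closed[OF b b'] by (simp add: lift_multiplier_def B_M M.distr_right)
    show "lift_multiplier R (b \<otimes>\<^bsub>B\<^esub> b') = lift_multiplier R b \<otimes>\<^bsub>B\<^esub> b'"
      using b b' R B.mult_closed[OF b b'] by (simp add: lift_multiplier_def B_M M.mult_assoc)
  qed
  show "nrm (multiplier_alg B) (lift_multiplier R) \<le> nrm M ?R"
  proof (rule B.norm_multiplier_le[OF lift nR])
    show "nrm B (lift_multiplier R b) \<le> nrm M ?R * nrm B b" if "b \<in> carrier B" for b
      using M.nrm_mult[OF R B_M[OF that]] that by (simp add: lift_multiplier_def)
  qed
qed

text \<open>As a quasimultiplier, \<open>R\<close> is the fraction of \<open>R v\<close> by
  \<open>v\<close>. Since \<open>J (R v) = lift_multiplier R (J v)\<close>, its image is the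
  fraction of the lifted multiplier with denominator \<open>J v\<close>.\<close>

lemma QM_incl_multiplier:
  assumes "v \<in> Omega A" "R \<in> carrier Mul"
  shows "QM_incl A T lam (mult_to_QM A R) = mult_to_QM B (lift_multiplier R)"
    "QM_to_mult B (QM_incl A T lam (mult_to_QM A R)) = lift_multiplier R"
proof -
  obtain w where w: "w \<in> Omega A \<inter> L_ideal A T"
    using Omega_Int_L_ideal_nonempty[OF assms(1)] by blast
  interpret h: bounded_QM_homomorphism A B J w "\<lambda>b. b w" "nrm L w + 1"
    using w by (rule bounded_QM_homomorphism_J)
  have v: "v \<in> carrier A"
    using assms(1) by (rule Omega_carrier)
  have "QM_incl A T lam (mult_to_QM A R) = quot_op B (J (R v)) (J v)"
    using assms v by (simp add: QM_incl_def mult_to_QM_eq_quot_op h.QM_map_quot_op)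
  also have "J (R v) = lift_multiplier R (J v)"
    using assms v by (simp add: lift_multiplier_def J_B restrict_mult_J)
  also have "quot_op B \<dots> (J v) = mult_to_QM B (lift_multiplier R)"
    using h.B.mult_to_QM_eq_quot_op[OF lift_multiplier(1)[OF assms(2)] h.hom_Omega[OF assms(1)]] by simp
  finally show eq: "QM_incl A T lam (mult_to_QM A R) = mult_to_QM B (lift_multiplier R)" .
  show "QM_to_mult B (QM_incl A T lam (mult_to_QM A R)) = lift_multiplier R"
    unfolding eq by (auto simp: QM_to_mult_def mult_to_QM_def lift_multiplier_def)
qed

text \<open>The rescaled orbit of \<open>T t x\<close> is \<open>exp (lam * t)\<close> times the
  orbit of \<open>x\<close> from time \<open>t\<close> on.\<close>

lemma norm_restrict_T:
  assumes "t > 0"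
  shows "nrm M (restrict (T t) (L_ideal A T)) \<le> exp (lam * t)"
proof (rule L.norm_multiplier_le)
  show "restrict (T t) (L_ideal A T) \<in> carrier M"
    using assms by (simp add: restrict_multiplier)
  fix x assume "x \<in> carrier L"
  then have x: "x \<in> L_ideal A T" "x \<in> carrier A"
    by (auto simp: L_closed)
  have "T t x = complex_of_real (exp (lam * t)) \<odot> S t x"
    using assms x by (simp add: S_def scal_scal flip: of_real_mult exp_add)
  then have "nrm A (S s (T t x)) \<le> exp (lam * t) * nrm L x" if "s \<ge> 0" for s
    using L_norm_upper[OF x(1), of "s + t"] that assms x by (simp add: S_smult norm_smult S_add)
  then have "nrm L (T t x) \<le> exp (lam * t) * nrm L x"
    using assms x by (intro L_norm_least) auto
  then show "nrm L (restrict (T t) (L_ideal A T) x) \<le> exp (lam * t) * nrm L x"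
    using x by simp
qed simp

lemma lift_T_tendsto:
  assumes b: "b \<in> carrier B"
  shows "((\<lambda>t. nrm M (lift_multiplier (T t) b \<ominus>\<^bsub>M\<^esub> b)) \<longlongrightarrow> 0) (at_right 0)"
  unfolding tendsto_iff
proof (intro allI impI)
  fix e :: real assume e: "e > 0"
  have bM: "b \<in> carrier M"
    using b by (rule B_M)
  define c where "c = exp \<bar>lam\<bar> + 1"
  have c: "c > 0"
    by (simp add: c_def add_pos_pos)
  \<comment> \<open>With \<open>J y\<close> within \<open>2 * r\<close> of \<open>b\<close>, the two
    outer terms of the final triangle inequality add up to at most
    \<open>2 * (c * r) = e / 2\<close> for \<open>t < 1\<close>; the middle term is below
    \<open>e / 2\<close> by continuity at \<open>d\<close>.\<close>
  define r where "r = e / (4 * c)"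
  have r: "r > 0"
    using e c by (simp add: r_def)
  obtain a where a: "a \<in> carrier A" "nrm M (b \<ominus>\<^bsub>M\<^esub> J a) < r"
    using b r unfolding B_carrier_iff by blast
  obtain d x where dx: "d > 0" "x \<in> carrier A" "nrm A (a \<ominus> T d x) < r"
  proof -
    have "\<exists>y\<in>(\<Union>t\<in>{0<..}. T t ` carrier A). nrm A (a \<ominus> y) < r"
      using dense_range a r unfolding dense_in_iff by blast
    then show ?thesis
      using that by auto
  qed
  define y where "y = T d x"
  have y: "y \<in> carrier A"
    using dx by (simp add: y_def)
  have JM: "J a \<in> carrier M" "J y \<in> carrier M"
    using a y by (simp_all add: J_multiplier)
  have "nrm M (J a \<ominus>\<^bsub>M\<^esub> J y) \<le> nrm A (a \<ominus> y)"
    using J_multiplier(2)[of "a \<ominus> y"] a y by (simp add: J_minus)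
  then have close: "nrm M (b \<ominus>\<^bsub>M\<^esub> J y) \<le> 2 * r"
    using M.norm_minus_triangle[OF bM JM] a(2) dx(3) by (simp add: y_def)
  obtain \<delta> where \<delta>: "\<delta> > 0" "\<And>t. \<lbrakk>t > 0; \<bar>t - d\<bar> < \<delta>\<rbrakk> \<Longrightarrow> nrm A (T t x \<ominus> T d x) < e / 2"
    using T_continuous[OF dx(2,1), of "e / 2"] e by auto
  have "nrm M (lift_multiplier (T t) b \<ominus>\<^bsub>M\<^esub> b) < e" if t: "0 < t" "t < min \<delta> 1" for t
  proof -
    let ?T = "restrict (T t) (L_ideal A T)"
    have TM: "?T \<in> carrier M"
      using t by (simp add: restrict_multiplier)
    have Ty: "T t y \<in> carrier A" "T t y = T (d + t) x"
      using t y dx T_add[of t d x] by (auto simp: y_def add.commute)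
    have "lam * t \<le> \<bar>lam\<bar> * t"
      using t by (intro mult_right_mono) auto
    also have "\<dots> \<le> \<bar>lam\<bar> * 1"
      using t by (intro mult_left_mono) auto
    finally have "nrm M ?T \<le> exp \<bar>lam\<bar>"
      using norm_restrict_T[OF t(1)] exp_le_cancel_iff[of "lam * t" "\<bar>lam\<bar>"] by linarith
    then have "nrm M ?T * nrm M (b \<ominus>\<^bsub>M\<^esub> J y) \<le> exp \<bar>lam\<bar> * (2 * r)"
      using close by (rule mult_mono) (simp_all add: M.norm_nonneg bM JM)
    moreover have "nrm M (?T \<otimes>\<^bsub>M\<^esub> (b \<ominus>\<^bsub>M\<^esub> J y)) \<le> nrm M ?T * nrm M (b \<ominus>\<^bsub>M\<^esub> J y)"
      using TM bM JM by (intro M.nrm_mult) auto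
    moreover have "?T \<otimes>\<^bsub>M\<^esub> (b \<ominus>\<^bsub>M\<^esub> J y) = ?T \<otimes>\<^bsub>M\<^esub> b \<ominus>\<^bsub>M\<^esub> J (T t y)"
      using TM bM JM y t by (simp add: M.mult_minus_right restrict_mult_J)
    ultimately have 1: "nrm M (?T \<otimes>\<^bsub>M\<^esub> b \<ominus>\<^bsub>M\<^esub> J (T t y)) \<le> exp \<bar>lam\<bar> * (2 * r)"
      by simp
    have 2: "nrm M (J (T t y) \<ominus>\<^bsub>M\<^esub> J y) < e / 2"
      using J_multiplier(2)[of "T t y \<ominus> y"] \<delta>(2)[of "d + t"] Ty y t dx(1)
      by (simp add: J_minus y_def)
    have "2 * (c * r) = exp \<bar>lam\<bar> * (2 * r) + 2 * r"
      by (simp add: c_def algebra_simps)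
    have "nrm M (?T \<otimes>\<^bsub>M\<^esub> b \<ominus>\<^bsub>M\<^esub> b)
        \<le> nrm M (?T \<otimes>\<^bsub>M\<^esub> b \<ominus>\<^bsub>M\<^esub> J (T t y)) + (nrm M (J (T t y) \<ominus>\<^bsub>M\<^esub> J y) + nrm M (J y \<ominus>\<^bsub>M\<^esub> b))"
      using M.norm_minus_triangle[of "?T \<otimes>\<^bsub>M\<^esub> b" "J (T t y)" b]
        M.norm_minus_triangle[of "J (T t y)" "J y" b] TM bM JM Ty(1) by (simp add: J_multiplier)
    also have "nrm M (J y \<ominus>\<^bsub>M\<^esub> b) \<le> 2 * r"
      using close M.norm_minus_commute[OF bM JM(2)] by simp
    finally have "nrm M (?T \<otimes>\<^bsub>M\<^esub> b \<ominus>\<^bsub>M\<^esub> b) < 2 * (c * r) + e / 2"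
      using 1 2 \<open>2 * (c * r) = exp \<bar>lam\<bar> * (2 * r) + 2 * r\<close> by linarith
    moreover have "c * r = e / 4"
      using c by (simp add: r_def)
    ultimately show ?thesis
      using b by (simp add: lift_multiplier_def)
  qed
  then show "\<forall>\<^sub>F t in at_right 0. dist (nrm M (lift_multiplier (T t) b \<ominus>\<^bsub>M\<^esub> b)) 0 < e"
    unfolding eventually_at_right_field
  proof (intro exI[of _ "min \<delta> 1"] conjI allI impI)
    fix t :: real assume t: "0 < t" "t < min \<delta> 1"
    have "lift_multiplier (T t) b \<in> carrier M"
      using t b bM by (simp add: lift_multiplier_def restrict_multiplier)
    then have "0 \<le> nrm M (lift_multiplier (T t) b \<ominus>\<^bsub>M\<^esub> b)"
      using bM by (intro M.norm_nonneg) auto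
    then show "dist (nrm M (lift_multiplier (T t) b \<ominus>\<^bsub>M\<^esub> b)) 0 < e"
      using \<open>\<And>t. \<lbrakk>0 < t; t < min \<delta> 1\<rbrakk> \<Longrightarrow> nrm M (lift_multiplier (T t) b \<ominus>\<^bsub>M\<^esub> b) < e\<close>[OF t]
      by (simp add: dist_real_def)
  qed (use \<delta> in auto)
qed

end

theorem proposition3p2:
  fixes A :: "'a normed_alg" and T :: "real \<Rightarrow> 'a \<Rightarrow> 'a" and lam :: real
  assumes "weakly_cancellative_algebra A" and "dense_principal_ideals A"
    and "strongly_continuous_semigroup A T"
    and "dense_in A (\<Union>t\<in>{0<..}. T t ` carrier A)"
    and "log_growth_rate A T < ereal lam"
  shows "(\<Union>t\<in>{0<..}. T t ` carrier A) \<subseteq> L_ideal A T \<and>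
    banach_algebra (L_alg A T lam) \<and>
    (\<forall>\<mu>. log_growth_rate A T < ereal \<mu> \<longrightarrow> norm_top (L_alg A T \<mu>) = norm_top (L_alg A T lam)) \<and>
    weakly_cancellative_algebra (closure_alg A T lam) \<and>
    dense_principal_ideals (closure_alg A T lam) \<and>
    \<comment> \<open>(i)\<close>
    (\<forall>w \<in> Omega A \<inter> L_ideal A T. QM_homomorphism A (closure_alg A T lam) w (L_incl A T)) \<and>
    (\<forall>u \<in> carrier A. \<forall>v \<in> Omega A. L_incl A T v \<in> Omega (closure_alg A T lam) \<and>
       QM_incl A T lam (quot_op A u v) =
         quot_op (closure_alg A T lam) (L_incl A T u) (L_incl A T v)) \<and>
    pseudobounded_iso A (closure_alg A T lam) (QM_incl A T lam) \<and>
    (\<forall>w \<in> Omega A \<inter> L_ideal A T.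
       \<forall>u \<in> carrier (closure_alg A T lam). \<forall>v \<in> Omega (closure_alg A T lam).
         u w \<in> carrier A \<and> v w \<in> Omega A \<and>
         inv_into (carrier (QM A)) (QM_incl A T lam) (quot_op (closure_alg A T lam) u v) =
           quot_op A (u w) (v w)) \<and>
    \<comment> \<open>(ii)\<close>
    QM_incl A T lam ` mult_to_QM A ` carrier (multiplier_alg A)
      \<subseteq> mult_to_QM (closure_alg A T lam) ` carrier (multiplier_alg (closure_alg A T lam)) \<and>
    (\<forall>R \<in> carrier (multiplier_alg A).
       nrm (multiplier_alg (closure_alg A T lam))
           (QM_to_mult (closure_alg A T lam) (QM_incl A T lam (mult_to_QM A R)))
         \<le> nrm (multiplier_alg A) R) \<and>
    \<comment> \<open>(iii)\<close>
    (\<forall>t>0. restrict (T t) (L_ideal A T) \<in> carrier (multiplier_alg (L_alg A T lam)) \<and>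
       nrm (multiplier_alg (closure_alg A T lam))
           (QM_to_mult (closure_alg A T lam) (QM_incl A T lam (mult_to_QM A (T t))))
         \<le> nrm (multiplier_alg (L_alg A T lam)) (restrict (T t) (L_ideal A T)) \<and>
       nrm (multiplier_alg (L_alg A T lam)) (restrict (T t) (L_ideal A T)) \<le> exp (lam * t)) \<and>
    (\<forall>u \<in> carrier (closure_alg A T lam).
       Limsup (at_right 0) (\<lambda>t. ereal (nrm (multiplier_alg (L_alg A T lam))
         (QM_to_mult (closure_alg A T lam) (QM_incl A T lam (mult_to_QM A (T t))) u
            \<ominus>\<^bsub>multiplier_alg (L_alg A T lam)\<^esub> u))) = 0)"
proof -
  \<comment> \<open>Stated for every admissible exponent, because the topologies belonging to two of
    them are compared.\<close>
  have semigroup: "growth_semigroup A T \<mu>" if "log_growth_rate A T < ereal \<mu>" for \<mu>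
    using assms that by (simp add: growth_semigroup_def growth_semigroup_axioms_def
        multiplier_semigroup_def multiplier_semigroup_axioms_def)
  interpret growth_semigroup A T lam
    using assms(5) by (rule semigroup)
  obtain v0 where v0: "v0 \<in> Omega A"
    using assms(2) by (auto simp: dense_principal_ideals_def)
  obtain w0 where w0: "w0 \<in> Omega A \<inter> L_ideal A T"
    using Omega_Int_L_ideal_nonempty[OF v0] by blast
  \<comment> \<open>The map on quasimultipliers does not involve \<open>w0\<close>, so one choice
    yields the isomorphism; the assertions about an arbitrary \<open>w\<close> use the fact
    \<open>h\<close> below.\<close>
  interpret h: bounded_QM_homomorphism A B J w0 "\<lambda>b. b w0" "nrm L w0 + 1"
    using w0 by (rule bounded_QM_homomorphism_J)
  have h: "bounded_QM_homomorphism A B J w (\<lambda>b. b w) (nrm L w + 1)"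
    if "w \<in> Omega A \<inter> L_ideal A T" for w
    using that by (rule bounded_QM_homomorphism_J)
  note incl = QM_incl_multiplier[OF v0]
  show ?thesis
  proof (intro conjI ballI allI impI)
    show "(\<Union>t\<in>{0<..}. T t ` carrier A) \<subseteq> L_ideal A T"
      by (rule T_range_subset_L)
    show "banach_algebra L"
      by (rule L_banach_algebra)
    show "norm_top (L_alg A T \<mu>) = norm_top L" if "log_growth_rate A T < ereal \<mu>" for \<mu>
      using semigroup[OF assms(5)] semigroup[OF that] by (rule norm_top_L_alg_eq)
    show "weakly_cancellative_algebra B"
      by (rule B_weakly_cancellative)
    show "dense_principal_ideals B"
      using h.hom_Omega[OF v0] by (auto simp: dense_principal_ideals_def)
    show "QM_homomorphism A B w J" if "w \<in> Omega A \<inter> L_ideal A T" for w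
      using h[OF that] by (rule bounded_QM_homomorphism.QM_homomorphism)
    show "J v \<in> Omega B" if "v \<in> Omega A" for v
      using that by (rule h.hom_Omega)
    show "QM_incl A T lam (quot_op A u v) = quot_op B (J u) (J v)" if "u \<in> carrier A" "v \<in> Omega A" for u v
      using that by (simp add: QM_incl_def h.QM_map_quot_op)
    show "pseudobounded_iso A B (QM_incl A T lam)"
      unfolding QM_incl_def by (rule h.QM_map_pseudobounded_iso)
    show "u w \<in> carrier A" if "w \<in> Omega A \<inter> L_ideal A T" "u \<in> carrier B" for u w
      using h[OF that(1)] that(2) by (rule bounded_QM_homomorphism.theta_closed)
    show "v w \<in> Omega A" if "w \<in> Omega A \<inter> L_ideal A T" "v \<in> Omega B" for v w
      using h[OF that(1)] that(2) by (rule bounded_QM_homomorphism.theta_Omega)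
    show "inv_into (carrier (QM A)) (QM_incl A T lam) (quot_op B u v) = quot_op A (u w) (v w)"
      if "w \<in> Omega A \<inter> L_ideal A T" "u \<in> carrier B" "v \<in> Omega B" for u v w
      unfolding QM_incl_def using h[OF that(1)] that(2,3)
      by (rule bounded_QM_homomorphism.inv_QM_map_quot_op)
    show "QM_incl A T lam ` mult_to_QM A ` carrier (multiplier_alg A)
        \<subseteq> mult_to_QM B ` carrier (multiplier_alg B)"
      using incl(1) lift_multiplier(1) by auto
    show "nrm (multiplier_alg B) (QM_to_mult B (QM_incl A T lam (mult_to_QM A R)))
        \<le> nrm (multiplier_alg A) R" if "R \<in> carrier (multiplier_alg A)" for R
      using incl(2)[OF that] lift_multiplier(2)[OF that] restrict_multiplier(2)[OF that] by simp
    show "restrict (T t) (L_ideal A T) \<in> carrier M" if "0 < t" for t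
      using that by (simp add: restrict_multiplier)
    show "nrm (multiplier_alg B) (QM_to_mult B (QM_incl A T lam (mult_to_QM A (T t))))
        \<le> nrm M (restrict (T t) (L_ideal A T))" if "0 < t" for t
      using that by (simp add: incl(2) lift_multiplier(2))
    show "nrm M (restrict (T t) (L_ideal A T)) \<le> exp (lam * t)" if "0 < t" for t
      using that by (rule norm_restrict_T)
    show "Limsup (at_right 0) (\<lambda>t. ereal (nrm M
        (QM_to_mult B (QM_incl A T lam (mult_to_QM A (T t))) b \<ominus>\<^bsub>M\<^esub> b))) = 0"
      if "b \<in> carrier B" for b
    proof (rule lim_imp_Limsup)
      have "((\<lambda>t. ereal (nrm M (lift_multiplier (T t) b \<ominus>\<^bsub>M\<^esub> b))) \<longlongrightarrow> ereal 0) (at_right 0)"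
        using lift_T_tendsto[OF that] by (intro tendsto_ereal)
      \<comment> \<open>The filter sees only \<open>t > 0\<close>, where \<open>T t\<close> is a
        multiplier and its extension is \<open>lift_multiplier (T t)\<close>.\<close>
      moreover have "\<forall>\<^sub>F t in at_right 0. ereal (nrm M (lift_multiplier (T t) b \<ominus>\<^bsub>M\<^esub> b)) =
          ereal (nrm M (QM_to_mult B (QM_incl A T lam (mult_to_QM A (T t))) b \<ominus>\<^bsub>M\<^esub> b))"
        using eventually_at_right_less[of 0] by eventually_elim (simp add: incl(2))
      ultimately show "((\<lambda>t. ereal (nrm M
          (QM_to_mult B (QM_incl A T lam (mult_to_QM A (T t))) b \<ominus>\<^bsub>M\<^esub> b))) \<longlongrightarrow> 0) (at_right 0)"
        by (simp add: zero_ereal_def tendsto_cong)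
    qed simp
  qed
qed

end
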